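(* The measure ring $\Theta(L\mathfrak{T})$ of the class $L\mathfrak{T}$ of labeled tree structures is isomorphic to the zero ring; consequently there are no ($\mathbb{C}$-valued) measures on $L\mathfrak{T}$.
   Context: A structure is a set with a family of relations; an embedding is an injective map that is an isomorphism onto the induced substructure on its image. Given embeddings $i:W\to X$, $j:W\to Y$, an amalgamation of $X$ and $Y$ over $W$ is a structure $Z$ with jointly surjective embeddings $j':X\to Z$, $i':Y\to Z$ such that $i'\circ j=j'\circ i$, taken up to compatible isomorphism. For a class $\mathfrak{F}$ of finite structures (closed under isomorphism and substructures, with the amalgamation property), the measure ring $\Theta(\mathfrak{F})$ is the commutative ring generated by symbols $[i]$ for embeddings $i$ in $\mathfrak{F}$, subject to: $[i]=1$ for isomorphisms; $[j\circ i]=[j][i]$; and for embeddings $i:W\to X$, $j:W\to Y$, $[i]=\sum_k [i'_k]$ where $Z_k$ runs over all amalgamations of $X,Y$ over $W$ in $\mathfrak{F}$ and $i'_k:Y\to Z_k$ are the corresponding embeddings. Measures on $\mathfrak{F}$ are ring homomorphisms $\Theta(\mathfrak{F})\to\mathbb{C}$. For a finite tree $T$ with leaf set $L(T)$, let $R$ be the quartic relation with $R(a,b;c,d)$ true iff $a,b,c,d$ are distinct and the simple path from $a$ to $b$ is disjoint from that from $c$ to $d$. A labeled tree structure is $L(T)$ equipped with $R$ and a total order $<$ (an arbitrary total order, independent of the tree). $L\mathfrak{T}$ is the class of all structures isomorphic to labeled tree structures; it is a Fraïssé class. *)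

theory Defs
  imports
    "HOL-Algebra.QuotRing"
    "HOL-Algebra.Algebraic_Closure_Type"
    "HOL-Library.Poly_Mapping"
begin

section \<open>Relational structures, embeddings and amalgamations\<close>

text \<open>The type \<open>'r\<close> is the type of relation symbols; a relation is a set of tuples
  (lists) of elements of the carrier.\<close>

record ('a, 'r) rel_structure = "'a partial_object" +
  rel :: "'r \<Rightarrow> 'a list set"

definition is_structure :: "('a, 'r) rel_structure \<Rightarrow> bool" where
  "is_structure S \<longleftrightarrow> (\<forall>r. rel S r \<subseteq> lists (carrier S))"

datatype ('a, 'r) arrow =
  Arrow (src: "('a, 'r) rel_structure") (tgt: "('a, 'r) rel_structure") (fn: "'a \<Rightarrow> 'a")

text \<open>Membership in \<open>\<rightarrow>\<^sub>E\<close> fixes the value of the underlying function outside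
  the source, so that equality of arrows is equality of maps between structures.\<close>

definition is_embedding :: "('a, 'r) arrow \<Rightarrow> bool" where
  "is_embedding i \<longleftrightarrow>
     is_structure (src i) \<and> is_structure (tgt i) \<and>
     fn i \<in> carrier (src i) \<rightarrow>\<^sub>E carrier (tgt i) \<and>
     inj_on (fn i) (carrier (src i)) \<and>
     (\<forall>r. \<forall>xs \<in> lists (carrier (src i)).
        xs \<in> rel (src i) r \<longleftrightarrow> map (fn i) xs \<in> rel (tgt i) r)"

definition is_isomorphism :: "('a, 'r) arrow \<Rightarrow> bool" where
  "is_isomorphism i \<longleftrightarrow> is_embedding i \<and> fn i ` carrier (src i) = carrier (tgt i)"

definition isomorphic :: "('a, 'r) rel_structure \<Rightarrow> ('a, 'r) rel_structure \<Rightarrow> bool" where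
  "isomorphic S S' \<longleftrightarrow> (\<exists>i. src i = S \<and> tgt i = S' \<and> is_isomorphism i)"

text \<open>\<open>arrow_comp j i\<close> is the composite \<open>j \<circ> i\<close>, meaningful if \<open>tgt i = src j\<close>.\<close>

definition arrow_comp :: "('a, 'r) arrow \<Rightarrow> ('a, 'r) arrow \<Rightarrow> ('a, 'r) arrow" where
  "arrow_comp j i = Arrow (src i) (tgt j) (compose (carrier (src i)) (fn j) (fn i))"

definition embeddings :: "('a, 'r) rel_structure set \<Rightarrow> ('a, 'r) arrow set" where
  "embeddings F = {i. src i \<in> F \<and> tgt i \<in> F \<and> is_embedding i}"

text \<open>For \<open>i : W \<rightarrow> X\<close> and \<open>j : W \<rightarrow> Y\<close>, an amalgamation is given by the pair
  \<open>(j', i')\<close> of embeddings \<open>j' : X \<rightarrow> Z\<close> and \<open>i' : Y \<rightarrow> Z\<close>.\<close>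

definition amalgamations ::
  "('a, 'r) rel_structure set \<Rightarrow> ('a, 'r) arrow \<Rightarrow> ('a, 'r) arrow
     \<Rightarrow> (('a, 'r) arrow \<times> ('a, 'r) arrow) set" where
  "amalgamations F i j =
     {(j', i'). j' \<in> embeddings F \<and> i' \<in> embeddings F \<and>
        src j' = tgt i \<and> src i' = tgt j \<and> tgt j' = tgt i' \<and>
        fn j' ` carrier (src j') \<union> fn i' ` carrier (src i') = carrier (tgt i') \<and>
        arrow_comp i' j = arrow_comp j' i}"

definition amalg_iso ::
  "('a, 'r) arrow \<times> ('a, 'r) arrow \<Rightarrow> ('a, 'r) arrow \<times> ('a, 'r) arrow \<Rightarrow> bool" where
  "amalg_iso a b \<longleftrightarrow>
     (\<exists>h. is_isomorphism h \<and> src h = tgt (fst a) \<and> tgt h = tgt (fst b) \<and>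
          arrow_comp h (fst a) = fst b \<and> arrow_comp h (snd a) = snd b)"

text \<open>A system of representatives for the amalgamations up to compatible isomorphism.\<close>

definition amalg_representatives ::
  "('a, 'r) rel_structure set \<Rightarrow> ('a, 'r) arrow \<Rightarrow> ('a, 'r) arrow
     \<Rightarrow> (('a, 'r) arrow \<times> ('a, 'r) arrow) set \<Rightarrow> bool" where
  "amalg_representatives F i j A \<longleftrightarrow>
     A \<subseteq> amalgamations F i j \<and> (\<forall>a \<in> amalgamations F i j. \<exists>!b. b \<in> A \<and> amalg_iso a b)"


section \<open>The measure ring\<close>

text \<open>The polynomial ring with integer coefficients in the variables \<open>G\<close>: monomials are
  finitely supported exponent functions, and polynomials are finitely supported
  coefficient functions on monomials.\<close>

definition free_cring :: "'g set \<Rightarrow> (('g \<Rightarrow>\<^sub>0 nat) \<Rightarrow>\<^sub>0 int) ring" where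
  "free_cring G =
     (ring_of_type_algebra :: (('g \<Rightarrow>\<^sub>0 nat) \<Rightarrow>\<^sub>0 int) ring)
       \<lparr>carrier := {p. \<forall>m \<in> Poly_Mapping.keys p. Poly_Mapping.keys m \<subseteq> G}\<rparr>"

lemma cring_free_cring:
  fixes G :: "'g set"
  shows "cring (free_cring G)"
proof -
  let ?C = "{p :: ('g \<Rightarrow>\<^sub>0 nat) \<Rightarrow>\<^sub>0 int. \<forall>m \<in> Poly_Mapping.keys p. Poly_Mapping.keys m \<subseteq> G}"
  have add: "p + q \<in> ?C" if "p \<in> ?C" "q \<in> ?C" for p q
    using that Poly_Mapping.keys_add[of p q] by blast
  have mult: "p * q \<in> ?C" if "p \<in> ?C" "q \<in> ?C" for p q
  proof -
    have "Poly_Mapping.keys m \<subseteq> G" if m: "m \<in> Poly_Mapping.keys (p * q)" for m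
    proof -
      obtain a b where "m = a + b" "a \<in> Poly_Mapping.keys p" "b \<in> Poly_Mapping.keys q"
        using m keys_mult[of p q] by blast
      then show ?thesis
        using \<open>p \<in> ?C\<close> \<open>q \<in> ?C\<close> Poly_Mapping.keys_add[of a b] by blast
    qed
    then show ?thesis by blast
  qed
  have carrier: "carrier (free_cring G) = ?C"
    and ops: "x \<oplus>\<^bsub>free_cring G\<^esub> y = x + y" "x \<otimes>\<^bsub>free_cring G\<^esub> y = x * y"
      "\<zero>\<^bsub>free_cring G\<^esub> = 0" "\<one>\<^bsub>free_cring G\<^esub> = 1" for x y
    by (simp_all add: free_cring_def ring_of_type_algebra_def)
  have neg: "\<exists>q \<in> ?C. q + p = 0" if "p \<in> ?C" for p
    using that by (intro bexI[of _ "- p"]) auto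
  have zero_one: "0 \<in> ?C" "1 \<in> ?C"
    by auto
  show ?thesis
    by (intro cringI abelian_groupI comm_monoidI; unfold carrier ops)
       ((rule add mult neg zero_one; assumption) | rule zero_one
         | rule add.assoc add.commute mult.assoc mult.commute distrib_right add_0_left mult_1_left)+
qed

definition gen :: "'g \<Rightarrow> (('g \<Rightarrow>\<^sub>0 nat) \<Rightarrow>\<^sub>0 int)" where
  "gen g = Poly_Mapping.single (Poly_Mapping.single g 1) 1"

text \<open>In the third family, all systems of representatives are allowed, so no choice is
  made; two choices give the same relation modulo the first two families. For finite
  structures in a finite relational language every such system is finite.\<close>

definition measure_relations ::
  "('a, 'r) rel_structure set \<Rightarrow> ((('a, 'r) arrow \<Rightarrow>\<^sub>0 nat) \<Rightarrow>\<^sub>0 int) set" where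
  "measure_relations F =
     {gen i - 1 | i. i \<in> embeddings F \<and> is_isomorphism i} \<union>
     {gen (arrow_comp j i) - gen j * gen i | i j.
        i \<in> embeddings F \<and> j \<in> embeddings F \<and> tgt i = src j} \<union>
     {gen i - (\<Sum>a\<in>A. gen (snd a)) | i j A.
        i \<in> embeddings F \<and> j \<in> embeddings F \<and> src i = src j \<and>
        amalg_representatives F i j A \<and> finite A}"

text \<open>The class \<open>F\<close> is represented by its members whose carrier is a subset of
  the type \<open>'a\<close>. If \<open>'a\<close> is infinite and \<open>F\<close> is closed under isomorphism, these
  include an isomorphic copy of every finite structure of the class and of every
  amalgamation.\<close>

definition measure_ring ::
  "('a, 'r) rel_structure set \<Rightarrow> ((('a, 'r) arrow \<Rightarrow>\<^sub>0 nat) \<Rightarrow>\<^sub>0 int) set ring" where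
  "measure_ring F =
     free_cring (embeddings F) Quot
       (genideal (free_cring (embeddings F)) (measure_relations F))"

lemma arrow_comp_embeddings:
  assumes "i \<in> embeddings F" "j \<in> embeddings F" "tgt i = src j"
  shows "arrow_comp j i \<in> embeddings F"
proof -
  note defs = embeddings_def is_embedding_def mem_Collect_eq
  have i: "fn i \<in> carrier (src i) \<rightarrow>\<^sub>E carrier (src j)" "inj_on (fn i) (carrier (src i))"
    using assms(1,3) unfolding defs by metis+
  have j: "fn j \<in> carrier (src j) \<rightarrow>\<^sub>E carrier (tgt j)" "inj_on (fn j) (carrier (src j))"
    using assms(2) unfolding defs by metis+
  let ?f = "compose (carrier (src i)) (fn j) (fn i)"
  have f: "?f x = fn j (fn i x)" if "x \<in> carrier (src i)" for x
    using that by (simp add: compose_def)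
  have "?f \<in> carrier (src i) \<rightarrow>\<^sub>E carrier (tgt j)"
    using PiE_mem[OF j(1) PiE_mem[OF i(1)]] by (simp add: compose_def)
  moreover have "inj_on ?f (carrier (src i))"
  proof (rule inj_onI)
    fix x y assume x: "x \<in> carrier (src i)" and y: "y \<in> carrier (src i)" and eq: "?f x = ?f y"
    have "fn i x = fn i y"
      by (rule inj_onD[OF j(2)]) (use eq f x y PiE_mem[OF i(1)] in simp_all)
    then show "x = y"
      using inj_onD[OF i(2)] x y by blast
  qed
  moreover have "xs \<in> rel (src i) r \<longleftrightarrow> map ?f xs \<in> rel (tgt j) r"
    if xs: "xs \<in> lists (carrier (src i))" for xs r
  proof -
    have "map ?f xs = map (fn j) (map (fn i) xs)"
      using xs f by (simp add: in_lists_conv_set)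
    moreover have "map (fn i) xs \<in> lists (carrier (src j))"
      using xs PiE_mem[OF i(1)] by (simp add: in_lists_conv_set)
    moreover have "xs \<in> rel (src i) r \<longleftrightarrow> map (fn i) xs \<in> rel (src j) r"
      using assms(1,3) xs unfolding defs by (metis (no_types))
    moreover have "ys \<in> rel (src j) r \<longleftrightarrow> map (fn j) ys \<in> rel (tgt j) r"
      if "ys \<in> lists (carrier (src j))" for ys
      using assms(2) that unfolding defs by (metis (no_types))
    ultimately show ?thesis
      by metis
  qed
  ultimately show ?thesis
    using assms(1,2) unfolding defs arrow_comp_def arrow.sel by metis
qed

text \<open>\<open>genideal\<close> is only meaningful for subsets of the carrier.\<close>

lemma measure_relations_subset: "measure_relations F \<subseteq> carrier (free_cring (embeddings F))"
proof -
  let ?R = "free_cring (embeddings F)"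
  interpret R: cring ?R by (rule cring_free_cring)
  have gen: "gen i \<in> carrier ?R" if "i \<in> embeddings F" for i
    using that by (auto simp: gen_def free_cring_def)
  have minus: "p - q \<in> carrier ?R" if "p \<in> carrier ?R" "q \<in> carrier ?R" for p q
    using that Poly_Mapping.keys_diff[of p q] unfolding free_cring_def
    by (simp add: subset_iff) blast
  have one: "1 \<in> carrier ?R"
    using R.one_closed by (simp add: free_cring_def ring_of_type_algebra_def)
  have mult: "p * q \<in> carrier ?R" if "p \<in> carrier ?R" "q \<in> carrier ?R" for p q
    using R.m_closed[OF that] by (simp add: free_cring_def ring_of_type_algebra_def)
  have add: "p + q \<in> carrier ?R" if "p \<in> carrier ?R" "q \<in> carrier ?R" for p q
    using R.add.m_closed[OF that] by (simp add: free_cring_def ring_of_type_algebra_def)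
  have zero: "0 \<in> carrier ?R"
    by (simp add: free_cring_def)
  have sum: "(\<Sum>a\<in>A. f a) \<in> carrier ?R" if "\<And>a. a \<in> A \<Longrightarrow> f a \<in> carrier ?R"
    for A and f :: "('a, 'b) arrow \<times> ('a, 'b) arrow \<Rightarrow> _"
    using that by (induction A rule: infinite_finite_induct) (auto intro: add zero)
  have "(\<Sum>a\<in>A. gen (snd a)) \<in> carrier ?R" if "amalg_representatives F i j A" for i j A
    using that by (intro sum gen) (auto simp: amalg_representatives_def amalgamations_def)
  then show ?thesis
    unfolding measure_relations_def by (auto intro!: minus one mult gen arrow_comp_embeddings)
qed

lemma cring_measure_ring: "cring (measure_ring F)"
proof -
  interpret R: cring "free_cring (embeddings F)" by (rule cring_free_cring)
  show ?thesis unfolding measure_ring_def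
    using R.genideal_ideal[OF measure_relations_subset] ideal.quotient_is_cring R.is_cring by blast
qed

definition complex_measures ::
  "('a, 'r) rel_structure set
     \<Rightarrow> (((('a, 'r) arrow \<Rightarrow>\<^sub>0 nat) \<Rightarrow>\<^sub>0 int) set \<Rightarrow> complex) set" where
  "complex_measures F = ring_hom (measure_ring F) (ring_of_type_algebra :: complex ring)"

definition zero_ring :: "unit ring" where
  "zero_ring =
     \<lparr>carrier = {()}, monoid.mult = (\<lambda>_ _. ()), one = (), ring.zero = (), add = (\<lambda>_ _. ())\<rparr>"


section \<open>Labeled tree structures\<close>

record 'v ugraph =
  nodes :: "'v set"
  edges :: "'v set set"

definition simple_path :: "'v ugraph \<Rightarrow> 'v \<Rightarrow> 'v list \<Rightarrow> 'v \<Rightarrow> bool" where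
  "simple_path T a p b \<longleftrightarrow>
     p \<noteq> [] \<and> hd p = a \<and> last p = b \<and> set p \<subseteq> nodes T \<and> distinct p \<and>
     successively (\<lambda>u v. {u, v} \<in> edges T) p"

definition is_cycle :: "'v ugraph \<Rightarrow> 'v list \<Rightarrow> bool" where
  "is_cycle T p \<longleftrightarrow>
     3 \<le> length p \<and> set p \<subseteq> nodes T \<and> distinct p \<and>
     successively (\<lambda>u v. {u, v} \<in> edges T) p \<and> {last p, hd p} \<in> edges T"

text \<open>The empty graph is allowed as a tree; its leaf structure is the empty structure, which
  has to be present because the class is closed under substructures.\<close>

definition finite_tree :: "'v ugraph \<Rightarrow> bool" where
  "finite_tree T \<longleftrightarrow>
     finite (nodes T) \<and> (\<forall>e \<in> edges T. e \<subseteq> nodes T \<and> card e = 2) \<and>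
     (\<forall>a \<in> nodes T. \<forall>b \<in> nodes T. \<exists>p. simple_path T a p b) \<and>
     (\<nexists>p. is_cycle T p)"

text \<open>Degree at most 1, so that the vertex of the one-vertex tree is a leaf.\<close>

definition leaves :: "'v ugraph \<Rightarrow> 'v set" where
  "leaves T = {v \<in> nodes T. card {u \<in> nodes T. {u, v} \<in> edges T} \<le> 1}"

text \<open>In a tree the simple path between two vertices exists and is unique.\<close>

definition tree_quartic :: "'v ugraph \<Rightarrow> 'v \<Rightarrow> 'v \<Rightarrow> 'v \<Rightarrow> 'v \<Rightarrow> bool" where
  "tree_quartic T a b c d \<longleftrightarrow>
     distinct [a, b, c, d] \<and>
     (\<exists>p q. simple_path T a p b \<and> simple_path T c q d \<and> set p \<inter> set q = {})"

datatype tree_symbol = Quartic | Less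

definition labeled_tree_structure ::
  "'v ugraph \<Rightarrow> ('v \<times> 'v) set \<Rightarrow> ('v, tree_symbol) rel_structure" where
  "labeled_tree_structure T lt =
     \<lparr>carrier = leaves T,
      rel = (\<lambda>r. case r of
        Quartic \<Rightarrow> {[a, b, c, d] | a b c d. {a, b, c, d} \<subseteq> leaves T \<and> tree_quartic T a b c d}
      | Less \<Rightarrow> {[a, b] | a b. {a, b} \<subseteq> leaves T \<and> (a, b) \<in> lt})\<rparr>"

definition labeled_trees :: "(nat, tree_symbol) rel_structure set" where
  "labeled_trees =
     {S. \<exists>(T :: nat ugraph) lt. finite_tree T \<and> strict_linear_order_on (leaves T) lt \<and>
           isomorphic S (labeled_tree_structure T lt)}"

end

theory Submission
  imports Defs
begin

text \<open>Write \<open>[W \<rightarrow> Z]\<close> for the class of an inclusion. Sorting points by the total order, the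
  amalgamation relations on at most three points give \<open>[{a, c} \<rightarrow> {a, b, c}] = -1\<close> for
  \<open>a < b < c\<close>. As this is invertible, the class of a one-point extension from three to four points
  \<open>a < b < c < d\<close> by a middle point depends only on the tree spanned by the four points; call it
  \<open>s\<close>, \<open>x\<close>, \<open>y\<close>, \<open>z\<close> for a star, \<open>ab|cd\<close>, \<open>ac|bd\<close>, \<open>ad|bc\<close>. Then \<open>s + x + y + z = -1\<close>.

  Fix \<open>a < b < c < d\<close> with tree \<open>ac|bd\<close> and add a point between \<open>a\<close> and \<open>c\<close>, attached at a place
  of the tree that can be described without \<open>b\<close>. Comparing the two gaps next to \<open>b\<close> with the gap
  that remains once \<open>b\<close> is forgotten gives \<open>s = s + s\<close>, \<open>x = x + y\<close> and \<open>z = y + x\<close>,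
  so \<open>2 z = -1\<close>. On the other hand, for fixed \<open>a < e\<close> the relation \<open>ae|bc\<close> is an
  equivalence relation in \<open>b\<close> and \<open>c\<close>, and counting triples of equivalent points in two ways gives
  \<open>z\<^sup>2 + z = 0\<close>. Hence \<open>1 = - 4 (z\<^sup>2 + z) = 0\<close>.

  Only the existence of structures on at most four points is needed; for five points it suffices to
  know some consequences of the tree axioms, since the sums over amalgamations are compared as sums.\<close>

section \<open>Quartic relations of trees\<close>

text \<open>The class of a one-point extension of W behaves like the size of the set of points that
  can be added to W in the prescribed way. Amalgamating with a second one-point extension splits
  this set by the position of its points relative to the point y of the second extension; a summand
  1 stands for y itself if y belongs to the set. In this reading an open interval of the order has
  size -1, like an Euler characteristic, and z is the size of the part of an equivalence class that
  lies below (or above) one of its points. Pairs of points below a common bound come in two orders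
  or on the diagonal, which gives z^2 = z + 2 z^2, so over a field z would be 0 or -1. The gap
  relations instead put z at -1/2, and (2 z + 1)^2 - 4 (z^2 + z) = 1 makes the two incompatible. The
  defining relations need complete systems of representatives of amalgams. One-point extensions
  realised as inclusions make such systems explicit: the structures on the union of the two
  carriers, and at most one further amalgam, which identifies the added points.\<close>

lemma simple_path_rev:
  assumes "simple_path T a p b"
  shows "simple_path T b (rev p) a"
  using assms unfolding simple_path_def
  by (simp add: hd_rev last_rev successively_rev insert_commute)

text \<open>Reachability only yields walks; a path results from cutting back whenever an earlier
  vertex is met again. The region \<open>A\<close> is recorded because it will be the tree without
  one vertex.\<close>

lemma simple_path_of_rtranclp:
  assumes "(\<lambda>u v. {u, v} \<in> edges T \<and> v \<in> A)\<^sup>*\<^sup>* a b" "a \<in> A" "A \<subseteq> nodes T"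
  shows "\<exists>p. simple_path T a p b \<and> set p \<subseteq> A"
  using assms(1)
proof (induction rule: rtranclp_induct)
  case base
  show ?case
    using assms(2,3) by (intro exI[of _ "[a]"]) (auto simp: simple_path_def)
next
  case (step b c)
  then obtain p where p: "simple_path T a p b" "set p \<subseteq> A" by blast
  show ?case
  proof (cases "c \<in> set p")
    case True
    then obtain xs ys where split: "p = xs @ c # ys" by (meson split_list)
    have "simple_path T a (xs @ [c]) c"
      using p unfolding split simple_path_def
      by (auto simp: successively_append_iff hd_append split: if_splits)
    then show ?thesis
      using p split by (intro exI[of _ "xs @ [c]"]) auto
  next
    case False
    have "simple_path T a (p @ [c]) c"
      using p False step assms(3) unfolding simple_path_def
      by (auto simp: successively_append_iff)
    then show ?thesis
      using p step by (intro exI[of _ "p @ [c]"]) auto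
  qed
qed

section \<open>Sides of an edge in a tree\<close>

definition edge_cut :: "'v ugraph \<Rightarrow> 'v \<Rightarrow> 'v \<Rightarrow> 'v set \<Rightarrow> bool" where
  "edge_cut T y z A \<longleftrightarrow> y \<in> A \<and> z \<notin> A \<and>
     (\<forall>u v. {u, v} \<in> edges T \<and> u \<in> A \<and> v \<notin> A \<longrightarrow> u = y \<and> v = z)"

lemma successively_crossing:
  assumes "successively P p" "u \<in> set p" "v \<in> set p" "u \<in> A" "v \<notin> A"
  shows "\<exists>xs s t ys. p = xs @ s # t # ys \<and> P s t \<and> (s \<in> A \<longleftrightarrow> t \<notin> A)"
  using assms
proof (induction p arbitrary: u v)
  case Nil
  then show ?case by simp
next
  case (Cons s p)
  show ?case
  proof (cases p)
    case Nil
    then show ?thesis using Cons.prems by auto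
  next
    case (Cons t ys)
    show ?thesis
    proof (cases "s \<in> A \<longleftrightarrow> t \<in> A")
      case False
      then show ?thesis
        using Cons Cons.prems by (intro exI[of _ "[]"]) auto
    next
      case True
      obtain u' v' where "u' \<in> set p" "v' \<in> set p" "u' \<in> A" "v' \<notin> A"
        using Cons.prems Cons True by (auto split: if_splits)
      moreover have "successively P p"
        using Cons.prems Cons by (cases p) auto
      ultimately obtain xs s' t' ys' where "p = xs @ s' # t' # ys' \<and> P s' t' \<and> (s' \<in> A \<longleftrightarrow> t' \<notin> A)"
        using Cons.IH by blast
      then show ?thesis by (intro exI[of _ "s # xs"]) auto
    qed
  qed
qed

lemma walk_crosses_cut:
  assumes "edge_cut T y z A" "successively (\<lambda>u v. {u, v} \<in> edges T) p" "u \<in> set p" "v \<in> set p" "u \<in> A" "v \<notin> A"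
  shows "y \<in> set p \<and> z \<in> set p"
proof -
  obtain xs s t ys where "p = xs @ s # t # ys" "{s, t} \<in> edges T" "s \<in> A \<longleftrightarrow> t \<notin> A"
    using successively_crossing[OF assms(2-6)] by blast
  moreover have "{t, s} \<in> edges T"
    using calculation(2) by (simp add: insert_commute)
  ultimately show ?thesis
    using assms(1) unfolding edge_cut_def by auto
qed

lemma path_crosses_cut:
  assumes "edge_cut T y z A" "simple_path T a p b" "u \<in> set p" "v \<in> set p" "u \<in> A" "v \<notin> A"
  shows "y \<in> set p \<and> z \<in> set p"
  using walk_crosses_cut[OF assms(1) _ assms(3-6)] assms(2) by (simp add: simple_path_def)

text \<open>Leaving and re-entering one side of the cut would use its single edge twice.\<close>

lemma path_within_cut_side:
  assumes "edge_cut T y z A" "simple_path T a p b" "a \<in> A \<longleftrightarrow> b \<in> A"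
  shows "\<forall>w \<in> set p. w \<in> A \<longleftrightarrow> a \<in> A"
proof (rule ccontr)
  assume "\<not> ?thesis"
  then obtain w where w: "w \<in> set p" "w \<in> A \<longleftrightarrow> a \<notin> A" by blast
  then obtain xs ys where p: "p = xs @ w # ys" by (meson split_list)
  have sp: "hd p = a" "last p = b" "distinct p" "successively (\<lambda>u v. {u, v} \<in> edges T) p" "p \<noteq> []"
    using assms(2) by (auto simp: simple_path_def)
  have ne: "xs \<noteq> []" "ys \<noteq> []"
    using w(2) assms(3) sp(1,2) unfolding p by auto
  define q where "q = xs @ [w]"
  define r where "r = w # ys"
  have sq: "successively (\<lambda>u v. {u, v} \<in> edges T) q" "successively (\<lambda>u v. {u, v} \<in> edges T) r"
    using sp(4) unfolding p q_def r_def by (auto simp: successively_append_iff successively_Cons)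
  have e: "a \<in> set q" "b \<in> set r" "w \<in> set q" "w \<in> set r"
    using sp(1,2) ne unfolding p q_def r_def by (auto simp: hd_append)
  have "y \<in> set q \<and> z \<in> set q"
    using walk_crosses_cut[OF assms(1) sq(1)] e w assms(3) by metis
  moreover have "y \<in> set r \<and> z \<in> set r"
    using walk_crosses_cut[OF assms(1) sq(2)] e w assms(3) by metis
  moreover have "set q \<inter> set r = {w}"
    using sp(3) unfolding p q_def r_def by auto
  ultimately have "y = w" "z = w" by auto
  then show False
    using assms(1) unfolding edge_cut_def by auto
qed

lemma finite_tree_path:
  "finite_tree T \<Longrightarrow> a \<in> nodes T \<Longrightarrow> b \<in> nodes T \<Longrightarrow> \<exists>p. simple_path T a p b"
  unfolding finite_tree_def by blast

text \<open>A path from \<open>a\<close> to \<open>b\<close> and one from \<open>c\<close> to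
  \<open>d\<close> both cross the cut \<open>B\<close> and so share \<open>y'\<close>; but the first
  stays inside \<open>A\<close> and the second outside. Exclusivity, transitivity and the shift rule
  below are applications of this to the four corners of two cuts.\<close>

lemma cuts_not_crossing:
  assumes T: "finite_tree T" and A: "edge_cut T y z A" and B: "edge_cut T y' z' B"
    and nodes: "{a, b, c, d} \<subseteq> nodes T"
    and corners: "a \<in> A \<inter> B" "b \<in> A - B" "c \<in> B - A" "d \<notin> A \<union> B"
  shows False
proof -
  obtain p q where p: "simple_path T a p b" and q: "simple_path T c q d"
    using finite_tree_path[OF T, of a b] finite_tree_path[OF T, of c d] nodes by auto
  have mem: "a \<in> set p" "b \<in> set p" "c \<in> set q" "d \<in> set q"
    using p q unfolding simple_path_def by auto
  have "y' \<in> set p" "y' \<in> set q"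
    using path_crosses_cut[OF B p] path_crosses_cut[OF B q] mem corners by auto
  then show False
    using path_within_cut_side[OF A p] path_within_cut_side[OF A q] corners by blast
qed

text \<open>The separating edge is found on a path from \<open>a\<close> to \<open>c\<close>:
  \<open>z\<close> is its first vertex on \<open>q\<close> and \<open>y\<close> the vertex before
  it. The side \<open>A\<close> is the component of \<open>y\<close> after deletion of
  \<open>z\<close>.\<close>

lemma cut_of_disjoint_paths:
  assumes T: "finite_tree T" and p: "simple_path T a p b" and q: "simple_path T c q d"
    and disj: "set p \<inter> set q = {}"
  shows "\<exists>y z A. edge_cut T y z A \<and> a \<in> A \<and> b \<in> A \<and> c \<notin> A \<and> d \<notin> A"
proof -
  have mem: "a \<in> set p" "b \<in> set p" "c \<in> set q" "d \<in> set q" "a \<in> nodes T" "c \<in> nodes T"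
    using p q unfolding simple_path_def by auto
  obtain r where r: "simple_path T a r c"
    using T mem unfolding finite_tree_def by blast
  then have "\<exists>x \<in> set r. x \<in> set q"
    using mem unfolding simple_path_def by (metis last_in_set)
  then obtain xs z zs where rz: "r = xs @ z # zs" "z \<in> set q" "\<forall>x \<in> set xs. x \<notin> set q"
    using split_list_first_prop[of r "\<lambda>x. x \<in> set q"] by blast
  have "xs \<noteq> []"
    using r rz mem disj unfolding simple_path_def by auto
  then obtain ws y where ws: "xs = ws @ [y]" by (meson rev_exhaust)
  have sxs: "simple_path T a xs y"
    using r \<open>xs \<noteq> []\<close> unfolding rz ws simple_path_def
    by (auto simp: successively_append_iff hd_append)
  have yz: "{y, z} \<in> edges T" "y \<noteq> z" "y \<notin> set q" "z \<notin> set xs"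
    using r rz unfolding ws simple_path_def by (auto simp: successively_append_iff)
  have inT: "y \<in> nodes T" "z \<in> nodes T" "set xs \<subseteq> nodes T"
    using r rz ws unfolding simple_path_def by auto
  define E where "E = (\<lambda>u v. {u, v} \<in> edges T \<and> v \<in> nodes T - {z})"
  define A where "A = {w. E\<^sup>*\<^sup>* y w}"
  have Az: "w \<noteq> z" if "w \<in> A" for w
    using that yz(2) unfolding A_def mem_Collect_eq by cases (auto simp: E_def)
  have cut: "edge_cut T y z A"
    unfolding edge_cut_def
  proof (intro conjI allI impI)
    show "y \<in> A" by (simp add: A_def)
    show "z \<notin> A" using Az by blast
    fix u v assume uv: "{u, v} \<in> edges T \<and> u \<in> A \<and> v \<notin> A"
    have "{u, v} \<subseteq> nodes T"
      using T uv unfolding finite_tree_def by blast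
    moreover have "\<not> E u v"
      using uv rtranclp.rtrancl_into_rtrancl[of E y u v] unfolding A_def by blast
    ultimately show vz: "v = z"
      using uv unfolding E_def by blast
    \<comment> \<open>A second edge from \<open>A\<close> to \<open>z\<close> would close a cycle
      with the path from \<open>y\<close> to \<open>u\<close> that avoids \<open>z\<close>.\<close>
    show "u = y"
    proof (rule ccontr)
      assume "u \<noteq> y"
      have "\<exists>p. simple_path T y p u \<and> set p \<subseteq> nodes T - {z}"
        using uv yz inT unfolding A_def E_def by (intro simple_path_of_rtranclp) auto
      then obtain s where s: "simple_path T y s u" "set s \<subseteq> nodes T - {z}" by blast
      have "2 \<le> length s"
        using s(1) \<open>u \<noteq> y\<close> unfolding simple_path_def
        by (cases s rule: remdups_adj.cases) auto
      then have "is_cycle T (z # s)"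
        using s uv yz inT vz unfolding is_cycle_def simple_path_def
        by (auto simp: successively_Cons insert_commute)
      then show False
        using T unfolding finite_tree_def by blast
    qed
  qed
  have "a \<in> A"
  proof (rule ccontr)
    assume "a \<notin> A"
    then have "z \<in> set xs"
      using path_crosses_cut[OF cut sxs, of y a] sxs cut \<open>xs \<noteq> []\<close>
      unfolding simple_path_def edge_cut_def by auto
    then show False using yz by blast
  qed
  moreover have "b \<in> A"
  proof (rule ccontr)
    assume "b \<notin> A"
    then have "z \<in> set p"
      using path_crosses_cut[OF cut p, of a b] mem \<open>a \<in> A\<close> by auto
    then show False using rz disj by blast
  qed
  \<comment> \<open>A vertex of \<open>q\<close> inside \<open>A\<close> would force
    \<open>q\<close> to pass through \<open>y\<close> as well, since \<open>q\<close> contains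
    \<open>z\<close>; but \<open>y\<close> is not on \<open>q\<close>.\<close>
  moreover have "w \<notin> A" if "w \<in> set q" for w
    using path_crosses_cut[OF cut q that rz(2)] yz(3) Az by blast
  ultimately show ?thesis
    using cut mem by blast
qed

text \<open>Disjointness of two paths becomes separation by a single edge, which reduces statements
  about quartets to intersections of vertex sets.\<close>

lemma tree_quartic_iff_cut:
  assumes T: "finite_tree T" and nodes: "{a, b, c, d} \<subseteq> nodes T"
  shows "tree_quartic T a b c d \<longleftrightarrow> distinct [a, b, c, d] \<and>
    (\<exists>y z A. edge_cut T y z A \<and> a \<in> A \<and> b \<in> A \<and> c \<notin> A \<and> d \<notin> A)"
proof
  assume q: "tree_quartic T a b c d"
  then obtain p q where "simple_path T a p b" "simple_path T c q d" "set p \<inter> set q = {}"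
    unfolding tree_quartic_def by blast
  from cut_of_disjoint_paths[OF T this]
  show "distinct [a, b, c, d] \<and>
    (\<exists>y z A. edge_cut T y z A \<and> a \<in> A \<and> b \<in> A \<and> c \<notin> A \<and> d \<notin> A)"
    using q unfolding tree_quartic_def by simp
next
  assume r: "distinct [a, b, c, d] \<and>
    (\<exists>y z A. edge_cut T y z A \<and> a \<in> A \<and> b \<in> A \<and> c \<notin> A \<and> d \<notin> A)"
  then obtain y z A where A: "edge_cut T y z A" "a \<in> A" "b \<in> A" "c \<notin> A" "d \<notin> A" by blast
  obtain p q where p: "simple_path T a p b" and q: "simple_path T c q d"
    using finite_tree_path[OF T, of a b] finite_tree_path[OF T, of c d] nodes by auto
  have "set p \<inter> set q = {}"
    using path_within_cut_side[OF A(1) p] path_within_cut_side[OF A(1) q] A by blast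
  then show "tree_quartic T a b c d"
    using r p q unfolding tree_quartic_def by blast
qed

section \<open>Axioms of the quartic relation\<close>

lemma tree_quartic_swap:
  assumes "tree_quartic T a b c d"
  shows "tree_quartic T b a c d" "tree_quartic T c d a b"
proof -
  obtain p q where p: "simple_path T a p b" and q: "simple_path T c q d" and pq: "set p \<inter> set q = {}"
    and d: "distinct [a, b, c, d]"
    using assms unfolding tree_quartic_def by blast
  have r: "simple_path T b (rev p) a" "set (rev p) \<inter> set q = {}" "set q \<inter> set p = {}"
    using simple_path_rev[OF p] pq by auto
  show "tree_quartic T b a c d"
    unfolding tree_quartic_def using d r(1,2) q by (intro conjI exI[of _ "rev p"] exI[of _ q]) auto
  show "tree_quartic T c d a b"
    unfolding tree_quartic_def using d r(3) p q by (intro conjI exI[of _ q] exI[of _ p]) auto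
qed

lemma tree_quartic_exclusive:
  assumes T: "finite_tree T" and nodes: "{a, b, c, d} \<subseteq> nodes T"
    and "tree_quartic T a b c d"
  shows "\<not> tree_quartic T a c b d"
proof
  assume "tree_quartic T a c b d"
  then obtain y z B where B: "edge_cut T y z B" "a \<in> B" "c \<in> B" "b \<notin> B" "d \<notin> B"
    using tree_quartic_iff_cut[OF T, of a c b d] nodes by auto
  obtain y' z' A where A: "edge_cut T y' z' A" "a \<in> A" "b \<in> A" "c \<notin> A" "d \<notin> A"
    using tree_quartic_iff_cut[OF T nodes] assms(3) by auto
  show False
    using cuts_not_crossing[OF T A(1) B(1) nodes] A B by auto
qed

text \<open>The cuts obtained from \<open>c, d\<close> and from \<open>c, x\<close> do not cross, so
  \<open>x\<close> lies outside the first or \<open>d\<close> outside the second. That cut separates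
  \<open>a, b\<close> from \<open>d, x\<close>.\<close>

lemma tree_quartic_trans:
  assumes T: "finite_tree T" and nodes: "{a, b, c, d, x} \<subseteq> nodes T"
    and "tree_quartic T a b c d" "tree_quartic T a b c x" "d \<noteq> x"
  shows "tree_quartic T a b d x"
proof -
  obtain y z A where A: "edge_cut T y z A" "a \<in> A" "b \<in> A" "c \<notin> A" "d \<notin> A"
    using tree_quartic_iff_cut[OF T, of a b c d] nodes assms(3) by auto
  obtain y' z' B where B: "edge_cut T y' z' B" "a \<in> B" "b \<in> B" "c \<notin> B" "x \<notin> B"
    using tree_quartic_iff_cut[OF T, of a b c x] nodes assms(4) by auto
  have "x \<notin> A \<or> d \<notin> B"
    using cuts_not_crossing[OF T A(1) B(1), of a x d c] nodes A B by auto
  moreover have "distinct [a, b, d, x]"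
    using assms(3-5) unfolding tree_quartic_def by auto
  ultimately show ?thesis
    using tree_quartic_iff_cut[OF T, of a b d x] nodes A B by auto
qed

text \<open>Three corners of the two cuts are occupied by \<open>a\<close>, \<open>b\<close> and
  \<open>c\<close>, so \<open>d\<close> cannot lie in the fourth. Hence the cut that separates
  \<open>a, x\<close> from \<open>b, c\<close> leaves \<open>d\<close> outside too.\<close>

lemma tree_quartic_shift:
  assumes T: "finite_tree T" and nodes: "{a, b, c, d, x} \<subseteq> nodes T"
    and "tree_quartic T a b c d" "tree_quartic T a x b c" "d \<noteq> x"
  shows "tree_quartic T a x b d"
proof -
  obtain y z A where A: "edge_cut T y z A" "a \<in> A" "b \<in> A" "c \<notin> A" "d \<notin> A"
    using tree_quartic_iff_cut[OF T, of a b c d] nodes assms(3) by auto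
  obtain y' z' B where B: "edge_cut T y' z' B" "a \<in> B" "x \<in> B" "b \<notin> B" "c \<notin> B"
    using tree_quartic_iff_cut[OF T, of a x b c] nodes assms(4) by auto
  have "d \<notin> B"
    using cuts_not_crossing[OF T A(1) B(1), of a b d c] nodes A B by auto
  moreover have "distinct [a, x, b, d]"
    using assms(3-5) unfolding tree_quartic_def by auto
  ultimately show ?thesis
    using tree_quartic_iff_cut[OF T, of a x b d] nodes B by auto
qed

section \<open>Amalgamations of one-point extensions\<close>

definition restr :: "('a, 'r) rel_structure \<Rightarrow> 'a set \<Rightarrow> ('a, 'r) rel_structure" where
  "restr Z A = \<lparr>carrier = A, rel = (\<lambda>r. rel Z r \<inter> lists A)\<rparr>"

definition inclusion :: "('a, 'r) rel_structure \<Rightarrow> ('a, 'r) rel_structure \<Rightarrow> ('a, 'r) arrow" where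
  "inclusion M Z = Arrow M Z (\<lambda>x\<in>carrier M. x)"

lemma carrier_restr [simp]: "carrier (restr Z A) = A"
  by (simp add: restr_def)

lemma rel_restr [simp]: "rel (restr Z A) r = rel Z r \<inter> lists A"
  by (simp add: restr_def)

lemma inclusion_sel [simp]:
  "src (inclusion M Z) = M" "tgt (inclusion M Z) = Z"
  "fn (inclusion M Z) = (\<lambda>x\<in>carrier M. x)"
  by (simp_all add: inclusion_def)

lemma rel_structure_eqI:
  fixes M N :: "('a, 'r) rel_structure"
  assumes "carrier M = carrier N" "\<And>r. rel M r = rel N r"
  shows "M = N"
  using assms by (intro rel_structure.equality) auto

lemma restr_carrier: "is_structure Z \<Longrightarrow> restr Z (carrier Z) = Z"
  by (rule rel_structure_eqI) (auto simp: is_structure_def)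

lemma is_structure_restr: "is_structure (restr Z A)"
  by (simp add: is_structure_def)

lemma map_restrict_lists: "xs \<in> lists A \<Longrightarrow> map (\<lambda>x\<in>A. f x) xs = map f xs"
  by (induction xs) auto

lemma is_embedding_inclusion:
  assumes "is_structure Z" "carrier M \<subseteq> carrier Z" "M = restr Z (carrier M)"
  shows "is_embedding (inclusion M Z)"
proof -
  have "xs \<in> rel M r \<longleftrightarrow> xs \<in> rel Z r" if "xs \<in> lists (carrier M)" for xs r
    using that by (subst assms(3)) simp
  moreover have "is_structure M"
    by (subst assms(3)) (rule is_structure_restr)
  ultimately show ?thesis
    using assms(1,2) unfolding is_embedding_def
    by (auto simp: map_restrict_lists inj_on_def)
qed

lemma embedding_app:
  assumes "is_embedding i" "x \<in> carrier (src i)"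
  shows "fn i x \<in> carrier (tgt i)"
  using assms unfolding is_embedding_def by auto

lemma embedding_rel:
  assumes "is_embedding i" "set xs \<subseteq> carrier (src i)"
  shows "map (fn i) xs \<in> rel (tgt i) r \<longleftrightarrow> xs \<in> rel (src i) r"
  using assms unfolding is_embedding_def by (auto simp: in_lists_conv_set subset_iff)

lemma embedding_inj:
  assumes "is_embedding i" "x \<in> carrier (src i)" "y \<in> carrier (src i)" "fn i x = fn i y"
  shows "x = y"
  using assms unfolding is_embedding_def inj_on_def by auto

lemma restr_eqD:
  assumes "restr Z A = M"
  shows "carrier M = A" "set xs \<subseteq> A \<Longrightarrow> xs \<in> rel M r \<longleftrightarrow> xs \<in> rel Z r"
  using assms by (auto simp: in_lists_conv_set)

lemma arrow_eqI:
  assumes "src i = src j" "tgt i = tgt j" "is_embedding i" "is_embedding j"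
    "\<And>x. x \<in> carrier (src i) \<Longrightarrow> fn i x = fn j x"
  shows "i = j"
proof -
  have "fn i = fn j"
  proof
    fix x
    show "fn i x = fn j x"
      using assms unfolding is_embedding_def by (cases "x \<in> carrier (src i)") (auto simp: PiE_iff extensional_def)
  qed
  then show ?thesis
    using assms(1,2) by (simp add: arrow.expand)
qed

lemma fn_arrow_comp:
  "x \<in> carrier (src i) \<Longrightarrow> fn (arrow_comp j i) x = fn j (fn i x)"
  by (simp add: arrow_comp_def compose_def)

lemma is_embedding_arrow_comp:
  assumes "is_embedding i" "is_embedding j" "tgt i = src j"
  shows "is_embedding (arrow_comp j i)"
  using arrow_comp_embeddings[of i UNIV j] assms unfolding embeddings_def by auto

lemma arrow_comp_sel [simp]: "src (arrow_comp j i) = src i" "tgt (arrow_comp j i) = tgt j"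
  by (simp_all add: arrow_comp_def)

lemma is_isomorphism_arrow_comp:
  assumes "is_isomorphism i" "is_isomorphism j" "tgt i = src j"
  shows "is_isomorphism (arrow_comp j i)"
proof -
  have "fn (arrow_comp j i) ` carrier (src i) = fn j ` fn i ` carrier (src i)"
    unfolding image_image by (rule image_cong) (simp_all add: fn_arrow_comp)
  then show ?thesis
    using assms is_embedding_arrow_comp[of i j] unfolding is_isomorphism_def by simp
qed

lemma is_isomorphismI:
  assumes "is_structure M" "is_structure N" "bij_betw f (carrier M) (carrier N)"
    "\<And>xs r. set xs \<subseteq> carrier M \<Longrightarrow> xs \<in> rel M r \<longleftrightarrow> map f xs \<in> rel N r"
  shows "is_isomorphism (Arrow M N (\<lambda>x\<in>carrier M. f x))"
  using assms unfolding is_isomorphism_def is_embedding_def bij_betw_def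
  by (auto simp: map_restrict_lists inj_on_def in_lists_conv_set subset_iff)

definition pullback :: "('a, 'r) rel_structure \<Rightarrow> ('b \<Rightarrow> 'a) \<Rightarrow> 'b set \<Rightarrow> ('b, 'r) rel_structure" where
  "pullback Z f A = \<lparr>carrier = A, rel = (\<lambda>r. {xs \<in> lists A. map f xs \<in> rel Z r})\<rparr>"

lemma is_isomorphism_pullback:
  assumes "is_structure Z" "bij_betw f A (carrier Z)"
  shows "is_isomorphism (Arrow (pullback Z f A) Z (\<lambda>x\<in>A. f x))"
  using is_isomorphismI[of "pullback Z f A" Z f] assms
  by (auto simp: pullback_def is_structure_def in_lists_conv_set subset_iff)

lemma inverse_isomorphism:
  assumes "is_isomorphism i"
  obtains j where "is_isomorphism j" "src j = tgt i" "tgt j = src i"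
    "\<And>x. x \<in> carrier (src i) \<Longrightarrow> fn j (fn i x) = x"
    "\<And>y. y \<in> carrier (tgt i) \<Longrightarrow> fn i (fn j y) = y"
proof -
  define g where "g = inv_into (carrier (src i)) (fn i)"
  have bij: "bij_betw (fn i) (carrier (src i)) (carrier (tgt i))"
    using assms unfolding is_isomorphism_def is_embedding_def bij_betw_def by blast
  have bij': "bij_betw g (carrier (tgt i)) (carrier (src i))"
    unfolding g_def by (rule bij_betw_inv_into[OF bij])
  have gi: "g (fn i x) = x" if "x \<in> carrier (src i)" for x
    unfolding g_def using bij_betw_inv_into_left[OF bij that] .
  have ig: "fn i (g y) = y" if "y \<in> carrier (tgt i)" for y
    unfolding g_def using bij_betw_inv_into_right[OF bij that] .
  have emb: "is_embedding i" using assms by (simp add: is_isomorphism_def)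
  have "xs \<in> rel (tgt i) r \<longleftrightarrow> map g xs \<in> rel (src i) r" if "set xs \<subseteq> carrier (tgt i)" for xs r
  proof -
    have "set (map g xs) \<subseteq> carrier (src i)"
      using that bij' unfolding bij_betw_def by auto
    moreover have "map (fn i) (map g xs) = xs"
      using that ig by (induction xs) auto
    ultimately show ?thesis
      using embedding_rel[OF emb, of "map g xs" r] by simp
  qed
  then have "is_isomorphism (Arrow (tgt i) (src i) (\<lambda>x\<in>carrier (tgt i). g x))"
    using emb bij' unfolding is_embedding_def by (intro is_isomorphismI) auto
  then show ?thesis
    using that[of "Arrow (tgt i) (src i) (\<lambda>x\<in>carrier (tgt i). g x)"] gi ig embedding_app[OF emb]
    by auto
qed

text \<open>Closure under isomorphism is what lets an amalgam be renamed so that its carrier is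
  literally the union of the two given carriers.\<close>

locale structure_class =
  fixes F :: "('a, 'r) rel_structure set"
  assumes is_struct: "Z \<in> F \<Longrightarrow> is_structure Z"
    and iso_closed: "is_isomorphism i \<Longrightarrow> tgt i \<in> F \<Longrightarrow> src i \<in> F"
begin

lemma inclusion_in_embeddings:
  assumes "M \<in> F" "Z \<in> F" "carrier M \<subseteq> carrier Z" "M = restr Z (carrier M)"
  shows "inclusion M Z \<in> embeddings F"
  using assms is_embedding_inclusion[OF is_struct, of Z M] by (simp add: embeddings_def)

text \<open>If the images of \<open>x\<close> and \<open>y\<close> differ, the amalgam is isomorphic
  to exactly one structure on the union of the carriers, with inclusions as maps; these structures
  form \<open>S\<close>. If the images coincide, \<open>N\<close> itself serves as the amalgam, and
  \<open>h\<close> has to be an isomorphism.\<close>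

lemma amalg_representatives_one_point:
  fixes W M N :: "('a, 'r) rel_structure"
  assumes M: "M \<in> F" "carrier M = insert x (carrier W)" "W = restr M (carrier W)"
    and N: "N \<in> F" "carrier N = insert y (carrier W)" "W = restr N (carrier W)"
    and W: "W \<in> F" and xy: "x \<notin> carrier W" "y \<notin> carrier W" "x \<noteq> y"
  defines "S \<equiv> {Z \<in> F. carrier Z = insert x (insert y (carrier W)) \<and>
                  restr Z (carrier M) = M \<and> restr Z (carrier N) = N}"
    and "h \<equiv> Arrow M N (\<lambda>z\<in>carrier M. if z = x then y else z)"
  shows "amalg_representatives F (inclusion W M) (inclusion W N)
           ((\<lambda>Z. (inclusion M Z, inclusion N Z)) ` S \<union>
            (if is_isomorphism h then {(h, inclusion N N)} else {}))"
    (is "amalg_representatives F ?i ?j (?A \<union> ?D)")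
proof -
  have WM: "inclusion W M \<in> embeddings F" and WN: "inclusion W N \<in> embeddings F"
    using M N W by (auto intro!: inclusion_in_embeddings)
  have SD: "inclusion M Z \<in> embeddings F" "inclusion N Z \<in> embeddings F" if "Z \<in> S" for Z
    using that M N unfolding S_def by (auto intro!: inclusion_in_embeddings)
  have NN: "inclusion N N \<in> embeddings F"
    using N restr_carrier[OF is_struct, OF N(1)] by (intro inclusion_in_embeddings) auto
  have A: "?A \<subseteq> amalgamations F ?i ?j"
  proof
    fix a assume "a \<in> ?A"
    then obtain Z where Z: "Z \<in> S" and a: "a = (inclusion M Z, inclusion N Z)" by blast
    have "arrow_comp (inclusion N Z) (inclusion W N) = arrow_comp (inclusion M Z) (inclusion W M)"
      unfolding arrow_comp_def using M(2) N(2) by (auto simp: compose_def)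
    then show "a \<in> amalgamations F ?i ?j"
      using SD[OF Z] Z M(2) N(2) unfolding a amalgamations_def S_def by auto
  qed
  have D: "?D \<subseteq> amalgamations F ?i ?j"
  proof (cases "is_isomorphism h")
    case True
    then have "h \<in> embeddings F"
      using M N by (simp add: embeddings_def is_isomorphism_def h_def)
    moreover have "arrow_comp (inclusion N N) (inclusion W N) = arrow_comp h (inclusion W M)"
      unfolding arrow_comp_def h_def using M(2) N(2) xy by (auto simp: compose_def)
    moreover have "fn h ` carrier M \<subseteq> carrier N"
      unfolding h_def using M(2) N(2) by auto
    ultimately show ?thesis
      using True NN unfolding amalgamations_def by (auto simp: h_def)
  qed simp
  have unique: "b = b'"
    if a: "a \<in> amalgamations F ?i ?j" and b: "b \<in> ?A \<union> ?D" "amalg_iso a b"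
      and b': "b' \<in> ?A \<union> ?D" "amalg_iso a b'" for a b b'
  proof -
    obtain j' i' where a_def: "a = (j', i')" by (cases a)
    have src: "src j' = M" "src i' = N" "tgt j' = tgt i'" and emb: "is_embedding j'" "is_embedding i'"
      and surj: "fn j' ` carrier M \<union> fn i' ` carrier N = carrier (tgt i')"
      using a unfolding a_def amalgamations_def embeddings_def by auto
    obtain k where k: "is_isomorphism k" "src k = tgt j'" "tgt k = tgt (fst b)"
      "arrow_comp k j' = fst b" "arrow_comp k i' = snd b"
      using b(2) unfolding a_def amalg_iso_def by auto
    obtain k' where k': "is_isomorphism k'" "src k' = tgt j'" "tgt k' = tgt (fst b')"
      "arrow_comp k' j' = fst b'" "arrow_comp k' i' = snd b'"
      using b'(2) unfolding a_def amalg_iso_def by auto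
    have kM: "fn k (fn j' z) = fn (fst b) z" "fn k' (fn j' z) = fn (fst b') z" if "z \<in> carrier M" for z
      unfolding k(4,5)[symmetric] k'(4,5)[symmetric] using that src by (simp_all add: fn_arrow_comp)
    have kN: "fn k (fn i' z) = fn (snd b) z" "fn k' (fn i' z) = fn (snd b') z" if "z \<in> carrier N" for z
      unfolding k(4,5)[symmetric] k'(4,5)[symmetric] using that src by (simp_all add: fn_arrow_comp)
    have x: "x \<in> carrier M" and y: "y \<in> carrier N" using M N by auto
    have embk: "is_embedding k" "is_embedding k'"
      using k(1) k'(1) by (auto simp: is_isomorphism_def)
    have j'x: "fn j' x \<in> carrier (tgt j')" "fn i' y \<in> carrier (tgt j')"
      using embedding_app[OF emb(1)] embedding_app[OF emb(2)] x y src by auto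
    \<comment> \<open>Whether the images of \<open>x\<close> and \<open>y\<close> coincide is
      invariant under \<open>amalg_iso\<close>, so it decides between \<open>?A\<close> and
      \<open>?D\<close>.\<close>
    have typA: "fn j' x \<noteq> fn i' y"
      if "c \<in> ?A" "\<And>z. z \<in> carrier M \<Longrightarrow> fn l (fn j' z) = fn (fst c) z"
        "\<And>z. z \<in> carrier N \<Longrightarrow> fn l (fn i' z) = fn (snd c) z" for c l
      using that(1) that(2)[OF x] that(3)[OF y] x y xy by auto
    have typD: "fn j' x = fn i' y"
      if "c \<in> ?D" "\<And>z. z \<in> carrier M \<Longrightarrow> fn l (fn j' z) = fn (fst c) z"
        "\<And>z. z \<in> carrier N \<Longrightarrow> fn l (fn i' z) = fn (snd c) z"
        "is_embedding l" "src l = tgt j'" for c l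
    proof -
      have c: "c = (h, inclusion N N)"
        using that(1) by (auto split: if_splits)
      have "fn l (fn j' x) = fn l (fn i' y)"
        using that(2)[OF x] that(3)[OF y] x y unfolding c by (simp add: h_def)
      then show ?thesis
        using embedding_inj[OF that(4)] j'x that(5) by auto
    qed
    show ?thesis
    proof (cases "fn j' x = fn i' y")
      case True
      then have "b \<in> ?D" "b' \<in> ?D"
        using b(1) b'(1) typA[of b k, OF _ kM(1) kN(1)] typA[of b' k', OF _ kM(2) kN(2)] by blast+
      then show ?thesis by (auto split: if_splits)
    next
      case False
      have "b \<notin> ?D"
        using typD[of b k, OF _ kM(1) kN(1) embk(1) k(2)] False by blast
      moreover have "b' \<notin> ?D"
        using typD[of b' k', OF _ kM(2) kN(2) embk(2) k'(2)] False by blast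
      ultimately obtain Z Z' where Z: "Z \<in> S" "b = (inclusion M Z, inclusion N Z)"
        and Z': "Z' \<in> S" "b' = (inclusion M Z', inclusion N Z')"
        using b(1) b'(1) by auto
      \<comment> \<open>The two isomorphisms agree on the images of \<open>M\<close> and
        \<open>N\<close>, which cover the amalgam; hence they transport its relations in the same
        way.\<close>
      have kk': "fn k u = fn k' u" if "u \<in> carrier (tgt j')" for u
      proof -
        have "u \<in> fn j' ` carrier M \<union> fn i' ` carrier N"
          using that src(3) unfolding surj by simp
        then consider z where "z \<in> carrier M" "u = fn j' z" | z where "z \<in> carrier N" "u = fn i' z"
          by blast
        then show ?thesis
          by cases (use kM kN Z Z' in auto)
      qed
      have "rel Z r = rel Z' r" for r
      proof -
        have sub: "rel Z1 r \<subseteq> rel Z2 r"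
          if kk: "is_isomorphism k1" "src k1 = tgt j'" "tgt k1 = Z1"
            "is_isomorphism k2" "src k2 = tgt j'" "tgt k2 = Z2" "Z1 \<in> S"
            "\<And>u. u \<in> carrier (tgt j') \<Longrightarrow> fn k1 u = fn k2 u" for k1 k2 Z1 Z2
        proof
          fix xs assume xs: "xs \<in> rel Z1 r"
          have "set xs \<subseteq> carrier Z1"
            using xs is_struct[of Z1] kk(7) unfolding S_def is_structure_def by auto
          also have "carrier Z1 = fn k1 ` carrier (tgt j')"
            using kk(1-3) unfolding is_isomorphism_def by auto
          finally have "xs \<in> map (fn k1) ` lists (carrier (tgt j'))"
            unfolding lists_image[symmetric] by (simp add: in_lists_conv_set subset_iff)
          then obtain us where us: "set us \<subseteq> carrier (tgt j')" "xs = map (fn k1) us"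
            by (auto simp: in_lists_conv_set)
          have "us \<in> rel (tgt j') r"
            using embedding_rel[of k1 us r] us xs kk(1-3) by (auto simp: is_isomorphism_def)
          then have "map (fn k2) us \<in> rel Z2 r"
            using embedding_rel[of k2 us r] us kk(4-6) by (auto simp: is_isomorphism_def)
          moreover have "map (fn k2) us = xs"
            unfolding us(2) using us(1) kk(8) by (intro map_cong) auto
          ultimately show "xs \<in> rel Z2 r" by simp
        qed
        have t: "tgt k = Z" "tgt k' = Z'" using k(3) k'(3) Z Z' by auto
        have "rel Z r \<subseteq> rel Z' r"
          by (rule sub[OF k(1,2) t(1) k'(1,2) t(2) Z(1)]) (rule kk')
        moreover have "rel Z' r \<subseteq> rel Z r"
          by (rule sub[OF k'(1,2) t(2) k(1,2) t(1) Z'(1)]) (rule kk'[symmetric])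
        ultimately show ?thesis by blast
      qed
      then have "Z = Z'"
        using Z(1) Z'(1) unfolding S_def by (intro rel_structure_eqI) auto
      then show ?thesis using Z Z' by simp
    qed
  qed
  have exists: "\<exists>b \<in> ?A \<union> ?D. amalg_iso a b" if a: "a \<in> amalgamations F ?i ?j" for a
  proof -
    obtain j' i' where a_def: "a = (j', i')" by (cases a)
    have src: "src j' = M" "src i' = N" "tgt j' = tgt i'" and emb: "is_embedding j'" "is_embedding i'"
      and surj: "fn j' ` carrier M \<union> fn i' ` carrier N = carrier (tgt i')"
      and comm: "arrow_comp i' ?j = arrow_comp j' ?i" and tF: "tgt i' \<in> F"
      using a unfolding a_def amalgamations_def embeddings_def by auto
    have x: "x \<in> carrier M" and y: "y \<in> carrier N" using M N by auto
    have j'W: "fn j' w = fn i' w" if "w \<in> carrier W" for w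
      using fn_arrow_comp[of w ?j i'] fn_arrow_comp[of w ?i j'] comm that by simp
    show ?thesis
    proof (cases "fn j' x = fn i' y")
      case True
      \<comment> \<open>The image of \<open>x\<close> adds nothing to that of \<open>N\<close>, so
        \<open>i'\<close> is onto; its inverse carries the amalgam to the representative
        \<open>(h, inclusion N N)\<close>.\<close>
      have "is_isomorphism i'"
        using emb surj src True j'W M(2) N(2) unfolding is_isomorphism_def by auto
      then obtain k where k: "is_isomorphism k" "src k = tgt i'" "tgt k = N"
        "\<And>z. z \<in> carrier N \<Longrightarrow> fn k (fn i' z) = z"
        using inverse_isomorphism[of i'] src by metis
      have embk: "is_embedding k" using k(1) by (simp add: is_isomorphism_def)
      have kj: "is_embedding (arrow_comp k j')"
        using is_embedding_arrow_comp[OF emb(1) embk] k src by simp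
      have "fn (arrow_comp k j') z = fn h z" if "z \<in> carrier M" for z
        using that M(2) N(2) xy j'W True k(4) src by (auto simp: fn_arrow_comp h_def)
      moreover have "fn (arrow_comp k j') \<in> extensional (carrier M)"
        by (simp add: arrow_comp_def src)
      ultimately have "fn (arrow_comp k j') = fn h"
        unfolding h_def by (auto simp: extensional_def)
      then have h: "arrow_comp k j' = h"
        using src k by (intro arrow.expand) (auto simp: h_def)
      have "fn h ` carrier M = carrier N"
        unfolding h_def using M(2) N(2) xy by (auto simp: image_iff)
      then have "is_isomorphism h"
        using kj unfolding h is_isomorphism_def by (simp add: h_def)
      moreover have "arrow_comp k i' = inclusion N N"
        using is_embedding_arrow_comp[OF emb(2) embk] k src NN
        by (intro arrow_eqI) (auto simp: fn_arrow_comp embeddings_def)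
      ultimately have "amalg_iso a (h, inclusion N N)"
        using k h src unfolding a_def amalg_iso_def by (intro exI[of _ k]) (auto simp: h_def)
      then show ?thesis using \<open>is_isomorphism h\<close> by auto
    next
      case False
      \<comment> \<open>\<open>g\<close> glues the two maps on the union of the carriers; pulling
        the relations of the amalgam back along \<open>g\<close> gives its representative in
        \<open>S\<close>.\<close>
      define g where "g = (\<lambda>z. if z = x then fn j' x else fn i' z)"
      define B where "B = insert x (insert y (carrier W))"
      have gM: "g z = fn j' z" if "z \<in> carrier M" for z
        using that j'W M(2) by (auto simp: g_def)
      have gN: "g z = fn i' z" if "z \<in> carrier N" for z
        using that N(2) xy by (auto simp: g_def)
      have BMN: "B = carrier M \<union> carrier N"
        using M(2) N(2) by (auto simp: B_def)
      have "inj_on g B"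
      proof (rule inj_onI)
        fix u v assume uv: "u \<in> B" "v \<in> B" "g u = g v"
        consider "u \<in> carrier M" "v \<in> carrier M" | "u \<in> carrier N" "v \<in> carrier N"
          | "u = x" "v = y" | "u = y" "v = x"
          using uv M(2) N(2) unfolding B_def by auto
        then show "u = v"
        proof cases
          case 1
          then show ?thesis using uv embedding_inj[OF emb(1)] src gM by auto
        next
          case 2
          then show ?thesis using uv embedding_inj[OF emb(2)] src gN by auto
        qed (use uv gM gN x y False in auto)
      qed
      moreover have "g ` B = carrier (tgt i')"
        unfolding surj[symmetric] BMN image_Un using gM gN by auto
      ultimately have bij: "bij_betw g B (carrier (tgt i'))"
        by (simp add: bij_betw_def)
      define Z where "Z = pullback (tgt i') g B"
      define l where "l = Arrow Z (tgt i') (\<lambda>z\<in>B. g z)"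
      have l: "is_isomorphism l"
        unfolding l_def Z_def by (rule is_isomorphism_pullback[OF is_struct[OF tF] bij])
      have ZF: "Z \<in> F"
        using iso_closed[OF l] tF by (simp add: l_def)
      have cZ: "carrier Z = B" by (simp add: Z_def pullback_def)
      have relZ: "xs \<in> rel Z r \<longleftrightarrow> map g xs \<in> rel (tgt i') r" if "set xs \<subseteq> B" for xs r
        using that by (auto simp: Z_def pullback_def in_lists_conv_set)
      have "restr Z (carrier M) = M"
      proof (rule rel_structure_eqI)
        fix r
        have "xs \<in> rel Z r \<longleftrightarrow> xs \<in> rel M r" if "set xs \<subseteq> carrier M" for xs
        proof -
          have "map g xs = map (fn j') xs" using that gM by auto
          moreover have "set xs \<subseteq> B" using that BMN by blast
          ultimately show ?thesis
            using relZ[of xs r] embedding_rel[OF emb(1), of xs r] that src by (simp del: map_eq_conv)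
        qed
        then show "rel (restr Z (carrier M)) r = rel M r"
          using is_struct[OF M(1)] unfolding is_structure_def
          by (auto simp: in_lists_conv_set subset_iff)
      qed simp
      moreover have "restr Z (carrier N) = N"
      proof (rule rel_structure_eqI)
        fix r
        have "xs \<in> rel Z r \<longleftrightarrow> xs \<in> rel N r" if "set xs \<subseteq> carrier N" for xs
        proof -
          have "map g xs = map (fn i') xs" using that gN by auto
          moreover have "set xs \<subseteq> B" using that BMN by blast
          ultimately show ?thesis
            using relZ[of xs r] embedding_rel[OF emb(2), of xs r] that src by (simp del: map_eq_conv)
        qed
        then show "rel (restr Z (carrier N)) r = rel N r"
          using is_struct[OF N(1)] unfolding is_structure_def
          by (auto simp: in_lists_conv_set subset_iff)
      qed simp
      ultimately have ZS: "Z \<in> S"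
        using ZF cZ unfolding S_def B_def by auto
      obtain k where k: "is_isomorphism k" "src k = tgt i'" "tgt k = Z"
        "\<And>z. z \<in> carrier Z \<Longrightarrow> fn k (fn l z) = z"
        using inverse_isomorphism[OF l] by (metis arrow.sel(1) arrow.sel(2) l_def)
      have embk: "is_embedding k" using k(1) by (simp add: is_isomorphism_def)
      have kg: "fn k (g z) = z" if "z \<in> B" for z
        using k(4)[of z] that cZ by (simp add: l_def)
      have kM: "fn k (fn j' z) = z" if "z \<in> carrier M" for z
        using kg[of z] gM[OF that] BMN that by (metis UnI1)
      have kN: "fn k (fn i' z) = z" if "z \<in> carrier N" for z
        using kg[of z] gN[OF that] BMN that by (metis UnI2)
      have "arrow_comp k j' = inclusion M Z"
      proof (rule arrow_eqI)
        show "is_embedding (arrow_comp k j')"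
          by (rule is_embedding_arrow_comp[OF emb(1) embk]) (simp add: k(2) src)
      qed (use SD(1)[OF ZS] in \<open>simp_all add: embeddings_def fn_arrow_comp k(2,3) src kM\<close>)
      moreover have "arrow_comp k i' = inclusion N Z"
      proof (rule arrow_eqI)
        show "is_embedding (arrow_comp k i')"
          by (rule is_embedding_arrow_comp[OF emb(2) embk]) (simp add: k(2) src)
      qed (use SD(2)[OF ZS] in \<open>simp_all add: embeddings_def fn_arrow_comp k(2,3) src kN\<close>)
      ultimately have "amalg_iso a (inclusion M Z, inclusion N Z)"
        using k(1-3) src unfolding a_def amalg_iso_def by (intro exI[of _ k]) auto
      then show ?thesis by (intro bexI[of _ "(inclusion M Z, inclusion N Z)"] UnI1 imageI ZS)
    qed
  qed
  show ?thesis
    unfolding amalg_representatives_def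
  proof (intro conjI ballI)
    show "?A \<union> ?D \<subseteq> amalgamations F ?i ?j" by (rule Un_least[OF A D])
    fix a assume a: "a \<in> amalgamations F ?i ?j"
    show "\<exists>!b. b \<in> ?A \<union> ?D \<and> amalg_iso a b"
    proof (rule ex_ex1I)
      show "\<exists>b. b \<in> ?A \<union> ?D \<and> amalg_iso a b"
        using exists[OF a] by (simp only: Bex_def)
      fix b b' assume "b \<in> ?A \<union> ?D \<and> amalg_iso a b" "b' \<in> ?A \<union> ?D \<and> amalg_iso a b'"
      then show "b = b'"
        by (elim conjE) (rule unique[OF a])
    qed
  qed
qed

end

section \<open>Congruences in the measure ring\<close>

lemma free_cring_simps:
  "x \<oplus>\<^bsub>free_cring G\<^esub> y = x + y" "x \<otimes>\<^bsub>free_cring G\<^esub> y = x * y"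
  "\<zero>\<^bsub>free_cring G\<^esub> = 0" "\<one>\<^bsub>free_cring G\<^esub> = 1"
  by (simp_all add: free_cring_def ring_of_type_algebra_def)

lemma free_cring_uminus:
  assumes "x \<in> carrier (free_cring G)"
  shows "- x \<in> carrier (free_cring G)" "\<ominus>\<^bsub>free_cring G\<^esub> x = - x"
proof -
  interpret R: cring "free_cring G" by (rule cring_free_cring)
  show closed: "- x \<in> carrier (free_cring G)"
    using assms by (simp add: free_cring_def)
  show "\<ominus>\<^bsub>free_cring G\<^esub> x = - x"
    by (rule R.sum_zero_eq_neg[symmetric, OF closed assms]) (simp add: free_cring_simps)
qed

definition meas_ideal ::
  "('a, 'r) rel_structure set \<Rightarrow> ((('a, 'r) arrow \<Rightarrow>\<^sub>0 nat) \<Rightarrow>\<^sub>0 int) set" where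
  "meas_ideal F = genideal (free_cring (embeddings F)) (measure_relations F)"

text \<open>Membership of both sides in the ring is included because the ideal absorbs only products
  with ring elements; it also lets closure be read off from any congruence.\<close>

definition meas_cong ::
  "('a, 'r) rel_structure set \<Rightarrow> ((('a, 'r) arrow \<Rightarrow>\<^sub>0 nat) \<Rightarrow>\<^sub>0 int)
     \<Rightarrow> ((('a, 'r) arrow \<Rightarrow>\<^sub>0 nat) \<Rightarrow>\<^sub>0 int) \<Rightarrow> bool" where
  "meas_cong F p q \<longleftrightarrow> p \<in> carrier (free_cring (embeddings F)) \<and>
     q \<in> carrier (free_cring (embeddings F)) \<and> p - q \<in> meas_ideal F"

lemma ideal_meas_ideal: "ideal (meas_ideal F) (free_cring (embeddings F))"
  unfolding meas_ideal_def
  by (rule ring.genideal_ideal[OF cring.axioms(1)[OF cring_free_cring] measure_relations_subset])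

lemma meas_ideal_closed:
  fixes F :: "('a, 'r) rel_structure set"
  shows "0 \<in> meas_ideal F"
    "p \<in> meas_ideal F \<Longrightarrow> q \<in> meas_ideal F \<Longrightarrow> p + q \<in> meas_ideal F"
    "p \<in> meas_ideal F \<Longrightarrow> - p \<in> meas_ideal F"
    "p \<in> meas_ideal F \<Longrightarrow> c \<in> carrier (free_cring (embeddings F)) \<Longrightarrow> c * p \<in> meas_ideal F"
proof -
  interpret I: ideal "meas_ideal F" "free_cring (embeddings F)" by (rule ideal_meas_ideal)
  show "0 \<in> meas_ideal F"
    using additive_subgroup.zero_closed[OF ideal.axioms(1)[OF ideal_meas_ideal, of F]]
    by (simp add: free_cring_simps)
  show "p \<in> meas_ideal F \<Longrightarrow> q \<in> meas_ideal F \<Longrightarrow> p + q \<in> meas_ideal F"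
    using additive_subgroup.a_closed[OF ideal.axioms(1)[OF ideal_meas_ideal, of F], of p q]
    by (simp add: free_cring_simps)
  show "p \<in> meas_ideal F \<Longrightarrow> - p \<in> meas_ideal F"
    using additive_subgroup.a_inv_closed[OF ideal.axioms(1)[OF ideal_meas_ideal, of F], of p] I.Icarr[of p]
    by (simp add: free_cring_uminus)
  show "p \<in> meas_ideal F \<Longrightarrow> c \<in> carrier (free_cring (embeddings F)) \<Longrightarrow> c * p \<in> meas_ideal F"
    using I.I_l_closed[of p c] by (simp add: free_cring_simps)
qed

lemma free_cring_closed:
  "0 \<in> carrier (free_cring G)" "1 \<in> carrier (free_cring G)"
  "p \<in> carrier (free_cring G) \<Longrightarrow> q \<in> carrier (free_cring G) \<Longrightarrow> p + q \<in> carrier (free_cring G)"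
  "p \<in> carrier (free_cring G) \<Longrightarrow> q \<in> carrier (free_cring G) \<Longrightarrow> p * q \<in> carrier (free_cring G)"
  "g \<in> G \<Longrightarrow> gen g \<in> carrier (free_cring G)"
proof -
  interpret R: cring "free_cring G" by (rule cring_free_cring)
  show "0 \<in> carrier (free_cring G)" "1 \<in> carrier (free_cring G)"
    using R.zero_closed R.one_closed by (simp_all add: free_cring_simps)
  show "p \<in> carrier (free_cring G) \<Longrightarrow> q \<in> carrier (free_cring G) \<Longrightarrow> p + q \<in> carrier (free_cring G)"
    using R.add.m_closed[of p q] by (simp add: free_cring_simps)
  show "p \<in> carrier (free_cring G) \<Longrightarrow> q \<in> carrier (free_cring G) \<Longrightarrow> p * q \<in> carrier (free_cring G)"
    using R.m_closed[of p q] by (simp add: free_cring_simps)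
  show "g \<in> G \<Longrightarrow> gen g \<in> carrier (free_cring G)"
    by (auto simp: gen_def free_cring_def)
qed

lemma meas_cong_refl: "p \<in> carrier (free_cring (embeddings F)) \<Longrightarrow> meas_cong F p p"
  by (simp add: meas_cong_def meas_ideal_closed)

lemma meas_cong_sym: "meas_cong F p q \<Longrightarrow> meas_cong F q p"
  using meas_ideal_closed(3)[of "p - q" F] by (simp add: meas_cong_def)

lemma meas_cong_trans [trans]: "meas_cong F p q \<Longrightarrow> meas_cong F q r \<Longrightarrow> meas_cong F p r"
  using meas_ideal_closed(2)[of "p - q" F "q - r"] by (simp add: meas_cong_def)

lemma meas_cong_add:
  "meas_cong F p q \<Longrightarrow> meas_cong F p' q' \<Longrightarrow> meas_cong F (p + p') (q + q')"
  using meas_ideal_closed(2)[of "p - q" F "p' - q'"]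
  by (simp add: meas_cong_def free_cring_closed algebra_simps)

lemma meas_cong_mult:
  assumes "meas_cong F p q" "meas_cong F p' q'"
  shows "meas_cong F (p * p') (q * q')"
proof -
  have "p' * (p - q) + q * (p' - q') \<in> meas_ideal F"
    using assms unfolding meas_cong_def by (intro meas_ideal_closed) auto
  moreover have "p' * (p - q) + q * (p' - q') = p * p' - q * q'"
    by (simp add: algebra_simps)
  ultimately show ?thesis
    using assms unfolding meas_cong_def by (simp add: free_cring_closed)
qed

lemma meas_cong_sum:
  "(\<And>a. a \<in> A \<Longrightarrow> meas_cong F (f a) (g a)) \<Longrightarrow> meas_cong F (sum f A) (sum g A)"
  by (induction A rule: infinite_finite_induct)
    (auto intro: meas_cong_add meas_cong_refl free_cring_closed)

lemma meas_cong_of_relation: "p - q \<in> measure_relations F \<Longrightarrow>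
  p \<in> carrier (free_cring (embeddings F)) \<Longrightarrow> q \<in> carrier (free_cring (embeddings F)) \<Longrightarrow>
  meas_cong F p q"
  using ring.genideal_self[OF cring.axioms(1)[OF cring_free_cring] measure_relations_subset, of F]
  unfolding meas_cong_def meas_ideal_def by blast

lemma meas_cong_isomorphism:
  assumes "i \<in> embeddings F" "is_isomorphism i"
  shows "meas_cong F (gen i) 1"
  using assms by (intro meas_cong_of_relation free_cring_closed) (auto simp: measure_relations_def)

lemma meas_cong_comp:
  assumes "i \<in> embeddings F" "j \<in> embeddings F" "tgt i = src j"
  shows "meas_cong F (gen (arrow_comp j i)) (gen j * gen i)"
  using assms by (intro meas_cong_of_relation free_cring_closed arrow_comp_embeddings)
    (auto simp: measure_relations_def)

context structure_class
begin

lemma meas_cong_inclusion_trans: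
  assumes "M \<in> F" "Z \<in> F" "W \<in> F" "carrier W \<subseteq> carrier M" "carrier M \<subseteq> carrier Z"
    "M = restr Z (carrier M)" "W = restr M (carrier W)"
  shows "meas_cong F (gen (inclusion W Z)) (gen (inclusion M Z) * gen (inclusion W M))"
proof -
  have MZ: "inclusion M Z \<in> embeddings F" and WM: "inclusion W M \<in> embeddings F"
    using assms by (auto intro!: inclusion_in_embeddings)
  have "arrow_comp (inclusion M Z) (inclusion W M) = inclusion W Z"
    using assms(4) by (auto simp: arrow_comp_def inclusion_def compose_def intro!: restrict_ext)
  then show ?thesis
    using meas_cong_comp[OF WM MZ] by simp
qed

text \<open>The bijection restricts to isomorphisms \<open>k\<close> and \<open>l\<close> of the
  large and the small structures. They form a commuting square with the two inclusions, and
  isomorphisms have class 1.\<close>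

lemma meas_cong_relabel:
  fixes f :: "'a \<Rightarrow> 'a"
  assumes "M \<in> F" "M' \<in> F" "W \<in> F" "W' \<in> F"
    and W: "carrier W \<subseteq> carrier M" "W = restr M (carrier W)"
    and W': "carrier W' = f ` carrier W" "W' = restr M' (carrier W')"
    and f: "bij_betw f (carrier M) (carrier M')"
    and rel: "\<And>xs r. set xs \<subseteq> carrier M \<Longrightarrow> xs \<in> rel M r \<longleftrightarrow> map f xs \<in> rel M' r"
  shows "meas_cong F (gen (inclusion W M)) (gen (inclusion W' M'))"
proof -
  have W'M': "carrier W' \<subseteq> carrier M'"
    using W W' f unfolding bij_betw_def by auto
  define k where "k = Arrow M M' (\<lambda>x\<in>carrier M. f x)"
  define l where "l = Arrow W W' (\<lambda>x\<in>carrier W. f x)"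
  have k: "is_isomorphism k"
    unfolding k_def using assms(1,2) f rel by (intro is_isomorphismI is_struct)
  have l: "is_isomorphism l"
    unfolding l_def
  proof (intro is_isomorphismI is_struct)
    show "bij_betw f (carrier W) (carrier W')"
      unfolding W'(1) using f W(1) unfolding bij_betw_def by (auto intro: inj_on_subset)
    fix xs r assume xs: "set xs \<subseteq> carrier W"
    have "xs \<in> rel W r \<longleftrightarrow> xs \<in> rel M r"
      using restr_eqD(2)[OF W(2)[symmetric] xs] .
    also have "\<dots> \<longleftrightarrow> map f xs \<in> rel M' r"
      using xs W(1) by (intro rel) auto
    also have "\<dots> \<longleftrightarrow> map f xs \<in> rel W' r"
      using restr_eqD(2)[OF W'(2)[symmetric], of "map f xs"] xs W'(1) by auto
    finally show "xs \<in> rel W r \<longleftrightarrow> map f xs \<in> rel W' r" .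
  qed (use assms in auto)
  have emb: "k \<in> embeddings F" "l \<in> embeddings F"
    using k l assms(1-4) by (auto simp: embeddings_def is_isomorphism_def k_def l_def)
  have inc: "inclusion W M \<in> embeddings F" "inclusion W' M' \<in> embeddings F"
    using assms(1-4) W W'(2) W'M' by (auto intro!: inclusion_in_embeddings)
  note closed = free_cring_closed(5)[OF inc(1)] free_cring_closed(5)[OF inc(2)]
  have "meas_cong F (gen (inclusion W M)) (gen k * gen (inclusion W M))"
    using meas_cong_mult[OF meas_cong_sym[OF meas_cong_isomorphism[OF emb(1) k]] meas_cong_refl[OF closed(1)]]
    by simp
  also have "meas_cong F \<dots> (gen (arrow_comp k (inclusion W M)))"
    using emb inc by (intro meas_cong_sym[OF meas_cong_comp]) (simp_all add: k_def)
  also have "arrow_comp k (inclusion W M) = arrow_comp (inclusion W' M') l"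
    using W(1) W'(1) by (auto simp: arrow_comp_def k_def l_def compose_def intro!: restrict_ext)
  also have "meas_cong F (gen \<dots>) (gen (inclusion W' M') * gen l)"
    using emb inc by (intro meas_cong_comp) (simp_all add: l_def)
  also have "meas_cong F \<dots> (gen (inclusion W' M') * 1)"
    by (rule meas_cong_mult[OF meas_cong_refl[OF closed(2)] meas_cong_isomorphism[OF emb(2) l]])
  finally show ?thesis by simp
qed

text \<open>The amalgamation relation with its sum made explicit. The amalgam that identifies
  \<open>x\<close> with \<open>y\<close> contributes the class of the identity of \<open>N\<close>,
  hence 1.\<close>

lemma meas_cong_one_point:
  fixes W M N :: "('a, 'r) rel_structure"
  assumes M: "M \<in> F" "carrier M = insert x (carrier W)" "W = restr M (carrier W)"
    and N: "N \<in> F" "carrier N = insert y (carrier W)" "W = restr N (carrier W)"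
    and W: "W \<in> F" and xy: "x \<notin> carrier W" "y \<notin> carrier W" "x \<noteq> y"
  defines "S \<equiv> {Z \<in> F. carrier Z = insert x (insert y (carrier W)) \<and>
                  restr Z (carrier M) = M \<and> restr Z (carrier N) = N}"
    and "h \<equiv> Arrow M N (\<lambda>z\<in>carrier M. if z = x then y else z)"
  assumes S: "finite S"
  shows "meas_cong F (gen (inclusion W M))
           ((if is_isomorphism h then 1 else 0) + (\<Sum>Z\<in>S. gen (inclusion N Z)))"
proof -
  let ?A = "(\<lambda>Z. (inclusion M Z, inclusion N Z)) ` S"
  let ?D = "if is_isomorphism h then {(h, inclusion N N)} else {}"
  have WM: "inclusion W M \<in> embeddings F" and WN: "inclusion W N \<in> embeddings F"
    using M N W by (auto intro!: inclusion_in_embeddings)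
  have NN: "inclusion N N \<in> embeddings F"
    using N restr_carrier[OF is_struct, OF N(1)] by (intro inclusion_in_embeddings) auto
  have SN: "gen (inclusion N Z) \<in> carrier (free_cring (embeddings F))" if "Z \<in> S" for Z
    using that N unfolding S_def by (auto intro!: inclusion_in_embeddings free_cring_closed)
  have closed: "sum (\<lambda>Z. gen (inclusion N Z)) S \<in> carrier (free_cring (embeddings F))"
    using meas_cong_sum[of S F, OF meas_cong_refl[OF SN]] by (auto simp: meas_cong_def)
  have NNc: "gen (inclusion N N) \<in> carrier (free_cring (embeddings F))"
    by (rule free_cring_closed(5)[OF NN])
  have inj: "inj_on (\<lambda>Z. (inclusion M Z, inclusion N Z)) S"
    by (rule inj_onI) (simp add: inclusion_def)
  have disj: "?A \<inter> ?D = {}"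
  proof -
    have "N \<notin> S"
      using N(2) xy unfolding S_def by auto
    then show ?thesis by (auto simp: inclusion_def)
  qed
  have "(\<Sum>a\<in>?A \<union> ?D. gen (snd a)) = (\<Sum>a\<in>?A. gen (snd a)) + (\<Sum>a\<in>?D. gen (snd a))"
    using S disj by (intro sum.union_disjoint) auto
  also have "(\<Sum>a\<in>?A. gen (snd a)) = (\<Sum>Z\<in>S. gen (inclusion N Z))"
    by (simp add: sum.reindex[OF inj])
  finally have sum: "(\<Sum>a\<in>?A \<union> ?D. gen (snd a)) =
      (if is_isomorphism h then gen (inclusion N N) else 0) + (\<Sum>Z\<in>S. gen (inclusion N Z))"
    by (simp add: add.commute)
  have "meas_cong F (gen (inclusion W M)) (\<Sum>a\<in>?A \<union> ?D. gen (snd a))"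
  proof (rule meas_cong_of_relation)
    have "amalg_representatives F (inclusion W M) (inclusion W N) (?A \<union> ?D)"
      unfolding S_def h_def by (rule amalg_representatives_one_point[OF M N W xy])
    moreover have "finite (?A \<union> ?D)" using S by simp
    ultimately show "gen (inclusion W M) - (\<Sum>a\<in>?A \<union> ?D. gen (snd a)) \<in> measure_relations F"
      using WM WN unfolding measure_relations_def
      by (intro UnI2 CollectI exI[of _ "inclusion W M"] exI[of _ "inclusion W N"] exI[of _ "?A \<union> ?D"]) simp
    show "(\<Sum>a\<in>?A \<union> ?D. gen (snd a)) \<in> carrier (free_cring (embeddings F))"
      unfolding sum using closed NNc by (auto intro: free_cring_closed)
  qed (rule free_cring_closed(5)[OF WM])
  also have "meas_cong F \<dots> ((if is_isomorphism h then 1 else 0) + (\<Sum>Z\<in>S. gen (inclusion N Z)))"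
  proof -
    have "is_isomorphism (inclusion N N)"
      using NN by (simp add: is_isomorphism_def embeddings_def)
    then have "meas_cong F (gen (inclusion N N)) 1"
      by (rule meas_cong_isomorphism[OF NN])
    then show ?thesis
      unfolding sum using closed by (intro meas_cong_add) (auto intro: meas_cong_refl free_cring_closed)
  qed
  finally show ?thesis .
qed

end

lemma trivial_measure_ring:
  assumes "meas_cong F 1 0"
  shows "measure_ring F \<simeq> zero_ring" "complex_measures F = {}"
proof -
  let ?R = "free_cring (embeddings F)"
  interpret R: cring ?R by (rule cring_free_cring)
  interpret I: ideal "meas_ideal F" ?R by (rule ideal_meas_ideal)
  interpret Q: cring "measure_ring F" by (rule cring_measure_ring)
  have "meas_ideal F = carrier ?R"
    using I.one_imp_carrier assms by (simp add: meas_cong_def free_cring_simps)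
  then have quot: "\<zero>\<^bsub>measure_ring F\<^esub> = carrier ?R" "\<one>\<^bsub>measure_ring F\<^esub> = \<zero>\<^bsub>measure_ring F\<^esub>"
    using I.a_rcos_const[of "\<one>\<^bsub>?R\<^esub>"] unfolding measure_ring_def meas_ideal_def[symmetric] FactRing_def
    by auto
  have carrier: "carrier (measure_ring F) = {\<zero>\<^bsub>measure_ring F\<^esub>}"
    by (rule Q.one_zeroD[OF quot(2)])
  have "(\<lambda>_. ()) \<in> ring_iso (measure_ring F) zero_ring"
    unfolding ring_iso_def ring_hom_def bij_betw_def carrier by (auto simp: zero_ring_def)
  then show "measure_ring F \<simeq> zero_ring"
    unfolding is_ring_iso_def by blast
  have False if "h \<in> complex_measures F" for h
  proof -
    have h: "h \<in> ring_hom (measure_ring F) (ring_of_type_algebra :: complex ring)"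
      using that by (simp add: complex_measures_def)
    have "h \<one>\<^bsub>measure_ring F\<^esub> = 1"
      using ring_hom_one[OF h] by (simp add: ring_of_type_algebra_def)
    \<comment> \<open>\<open>ring_hom\<close> prescribes only sums, products and one, so the value
      at zero is found from additivity.\<close>
    moreover have "h \<zero>\<^bsub>measure_ring F\<^esub> = h \<zero>\<^bsub>measure_ring F\<^esub> + h \<zero>\<^bsub>measure_ring F\<^esub>"
      using ring_hom_add[OF h Q.zero_closed Q.zero_closed] by (simp add: ring_of_type_algebra_def)
    ultimately show False
      using quot(2) by simp
  qed
  then show "complex_measures F = {}" by blast
qed

section \<open>Small trees\<close>

text \<open>Acyclicity is the main point: \<open>x\<close> has the single neighbour
  \<open>v\<close>, whereas the two neighbours of a vertex on a cycle are different. The trees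
  needed later are built leaf by leaf with this.\<close>

lemma finite_tree_add_leaf:
  assumes T: "finite_tree T" and v: "v \<in> nodes T" and x: "x \<notin> nodes T"
  shows "finite_tree \<lparr>nodes = insert x (nodes T), edges = insert {x, v} (edges T)\<rparr>"
    (is "finite_tree ?T'")
proof -
  have edge: "e \<subseteq> nodes T" "card e = 2" if "e \<in> edges T" for e
    using T that unfolding finite_tree_def by auto
  have old: "{s, t} \<in> edges T" if "{s, t} \<in> edges ?T'" "s \<noteq> x" "t \<noteq> x" for s t
    using that by (auto simp: doubleton_eq_iff)
  have new: "t = v" if "{x, t} \<in> edges ?T' \<or> {t, x} \<in> edges ?T'" for t
    using that edge x by (auto simp: doubleton_eq_iff)
  have lift: "simple_path ?T' a p b" if "simple_path T a p b" for a p b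
    using that unfolding simple_path_def by (auto elim: successively_mono)
  have to_x: "\<exists>p. simple_path ?T' a p x" if "a \<in> nodes T" for a
  proof -
    obtain p where p: "simple_path T a p v"
      using finite_tree_path[OF T \<open>a \<in> nodes T\<close> v] by blast
    then have "x \<notin> set p" using x by (auto simp: simple_path_def)
    then have "simple_path ?T' a (p @ [x]) x"
      using lift[OF p] unfolding simple_path_def by (auto simp: successively_append_iff insert_commute)
    then show ?thesis by blast
  qed
  have "\<exists>p. simple_path ?T' a p b" if ab: "a \<in> insert x (nodes T)" "b \<in> insert x (nodes T)" for a b
  proof -
    consider "a = x" "b = x" | "a \<in> nodes T" "b = x" | "a = x" "b \<in> nodes T" | "a \<in> nodes T" "b \<in> nodes T"
      using ab by auto
    then show ?thesis
    proof cases
      case 1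
      then show ?thesis by (intro exI[of _ "[x]"]) (simp add: simple_path_def)
    next
      case 2
      then show ?thesis using to_x by simp
    next
      case 3
      then show ?thesis using to_x[of b] simple_path_rev by metis
    next
      case 4
      then show ?thesis using finite_tree_path[OF T 4] lift by blast
    qed
  qed
  moreover have "\<not> is_cycle ?T' p" for p
  proof
    assume cyc: "is_cycle ?T' p"
    have p: "3 \<le> length p" "set p \<subseteq> insert x (nodes T)" "distinct p"
      "successively (\<lambda>u v. {u, v} \<in> edges ?T') p" "{last p, hd p} \<in> edges ?T'"
      using cyc unfolding is_cycle_def by auto
    show False
    proof (cases "x \<in> set p")
      case False
      have ne: "p \<noteq> []" using p(1) by auto
      have "successively (\<lambda>u v. {u, v} \<in> edges T) p"
        by (rule successively_mono[OF p(4)]) (use False old in metis)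
      moreover have "{last p, hd p} \<in> edges T"
        using p(5) by (rule old) (use False ne in \<open>metis last_in_set hd_in_set\<close>)+
      ultimately have "is_cycle T p"
        using p False unfolding is_cycle_def by auto
      then show False using T unfolding finite_tree_def by blast
    next
      case True
      \<comment> \<open>A cycle is given as a list, so the neighbours of \<open>x\<close> are the
        adjacent entries, except that the two ends of the list count as adjacent; this causes the
        cases below.\<close>
      then obtain xs ys where split: "p = xs @ x # ys" by (meson split_list)
      have pred: "last xs = v" if "xs \<noteq> []"
        using p(4) that new unfolding split by (auto simp: successively_append_iff)
      have succ: "hd ys = v" if "ys \<noteq> []"
        using p(4) that new unfolding split by (cases ys) (auto simp: successively_append_iff)
      show False
      proof (cases "xs = []")
        case True
        then have "ys \<noteq> []" "last ys = v" "2 \<le> length ys"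
          using p(1,5) new unfolding split by (auto simp: last_append split: if_splits)
        then show False
          using succ p(3) unfolding split True by (cases ys) (auto split: if_splits)
      next
        case xs: False
        show False
        proof (cases "ys = []")
          case True
          then have "hd xs = v" "2 \<le> length xs"
            using p(1,5) new xs unfolding split by auto
          then show False
            using pred xs p(3) unfolding split True by (cases xs) (auto split: if_splits)
        next
          case False
          have "last xs \<in> set xs" "hd ys \<in> set ys" using xs False by auto
          then show False
            using pred[OF xs] succ[OF False] p(3) unfolding split by auto
        qed
      qed
    qed
  qed
  moreover have "e \<subseteq> nodes ?T' \<and> card e = 2" if "e \<in> edges ?T'" for e
  proof -
    have "e = {x, v} \<or> e \<in> edges T" using that by simp
    moreover have "x \<noteq> v" using v x by blast
    ultimately show ?thesis using edge[of e] v by auto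
  qed
  moreover have "finite (nodes ?T')"
    using T by (simp add: finite_tree_def)
  ultimately show ?thesis
    unfolding finite_tree_def by simp
qed

section \<open>Stars and the trees with four leaves\<close>

definition star_tree :: "'v \<Rightarrow> 'v set \<Rightarrow> 'v ugraph" where
  "star_tree u A = \<lparr>nodes = insert u A, edges = (\<lambda>x. {x, u}) ` A\<rparr>"

lemma finite_tree_star_tree:
  assumes "finite A" "u \<notin> A"
  shows "finite_tree (star_tree u A)"
  using assms
proof (induction A rule: finite_induct)
  case empty
  have "\<not> is_cycle (star_tree u {}) p" for p
  proof
    assume p: "is_cycle (star_tree u {}) p"
    then have "length p = card (set p)" "card (set p) \<le> card {u}"
      unfolding is_cycle_def star_tree_def by (auto simp: distinct_card intro!: card_mono)
    then show False using p unfolding is_cycle_def by simp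
  qed
  moreover have "simple_path (star_tree u {}) u [u] u"
    by (simp add: simple_path_def star_tree_def)
  ultimately show ?case
    unfolding finite_tree_def by (auto simp: star_tree_def)
next
  case (insert x A)
  then have "finite_tree \<lparr>nodes = insert x (nodes (star_tree u A)),
      edges = insert {x, u} (edges (star_tree u A))\<rparr>"
    by (intro finite_tree_add_leaf) (auto simp: star_tree_def)
  then show ?case by (simp add: star_tree_def insert_commute)
qed

text \<open>With a single outer vertex the centre would have degree one and count as a leaf itself,
  hence the bound on the cardinality.\<close>

lemma leaves_star_tree:
  assumes "finite A" "2 \<le> card A" "u \<notin> A"
  shows "leaves (star_tree u A) = A"
proof -
  have "{w \<in> insert u A. {w, u} \<in> edges (star_tree u A)} = A"
    using assms(3) by (auto simp: star_tree_def doubleton_eq_iff)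
  moreover have "{w \<in> insert u A. {w, x} \<in> edges (star_tree u A)} = {u}" if "x \<in> A" for x
    using assms(3) that by (auto simp: star_tree_def doubleton_eq_iff)
  ultimately show ?thesis
    using assms unfolding leaves_def by (auto simp: star_tree_def)
qed

lemma path_through_unique_neighbour:
  assumes "simple_path T a p b" "a \<noteq> b" "\<And>w. {a, w} \<in> edges T \<Longrightarrow> w = u"
  shows "u \<in> set p"
  using assms unfolding simple_path_def by (cases p rule: remdups_adj.cases) auto

text \<open>Every path between distinct outer vertices passes through the centre, so two such paths
  always meet.\<close>

lemma not_tree_quartic_star_tree:
  assumes "u \<notin> A" "{a, b, c, d} \<subseteq> A"
  shows "\<not> tree_quartic (star_tree u A) a b c d"
proof
  have neighbour: "w = u" if "x \<in> A" "{x, w} \<in> edges (star_tree u A)" for x w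
    using assms(1) that by (auto simp: star_tree_def doubleton_eq_iff)
  assume "tree_quartic (star_tree u A) a b c d"
  then obtain p q where pq: "simple_path (star_tree u A) a p b" "simple_path (star_tree u A) c q d"
    "set p \<inter> set q = {}" "a \<noteq> b" "c \<noteq> d"
    unfolding tree_quartic_def by auto
  have "u \<in> set p" "u \<in> set q"
    using path_through_unique_neighbour[OF pq(1,4)] path_through_unique_neighbour[OF pq(2,5)]
      neighbour assms(2) by auto
  then show False using pq(3) by blast
qed

lemma ex_quartet_tree:
  fixes a b c d :: nat
  assumes dist: "distinct [a, b, c, d]"
  shows "\<exists>T. finite_tree T \<and> leaves T = {a, b, c, d} \<and> tree_quartic T a b c d"
proof -
  \<comment> \<open>The two inner vertices exceed all four leaves, which makes them fresh.\<close>
  define u where "u = a + b + c + d + 1"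
  define v where "v = a + b + c + d + 2"
  have uv: "distinct [a, b, c, d, u, v]"
    using dist by (auto simp: u_def v_def)
  define T where "T = \<lparr>nodes = {d, c, u, a, b, v}, edges = {{d, v}, {c, v}, {a, u}, {b, u}, {v, u}}\<rparr>"
  \<comment> \<open>\<open>v\<close> starts as an outer vertex of the star around \<open>u\<close>;
    attaching \<open>c\<close> and \<open>d\<close> to it makes it the second inner vertex.\<close>
  have "finite_tree (star_tree u {a, b, v})"
    using uv by (intro finite_tree_star_tree) auto
  from finite_tree_add_leaf[OF this, of v c]
  have "finite_tree \<lparr>nodes = {c, u, a, b, v}, edges = {{c, v}, {a, u}, {b, u}, {v, u}}\<rparr>"
    using uv by (auto simp: star_tree_def)
  from finite_tree_add_leaf[OF this, of v d]
  have T: "finite_tree T"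
    using uv by (auto simp: T_def)
  have nb: "{w \<in> nodes T. {w, a} \<in> edges T} = {u}" "{w \<in> nodes T. {w, b} \<in> edges T} = {u}"
    "{w \<in> nodes T. {w, c} \<in> edges T} = {v}" "{w \<in> nodes T. {w, d} \<in> edges T} = {v}"
    "{w \<in> nodes T. {w, u} \<in> edges T} = {a, b, v}" "{w \<in> nodes T. {w, v} \<in> edges T} = {c, d, u}"
    using uv by (auto simp: T_def doubleton_eq_iff)
  have nodes: "nodes T = {d, c, u, a, b, v}" by (simp add: T_def)
  have "leaves T = {a, b, c, d}"
    unfolding leaves_def set_eq_iff mem_Collect_eq
  proof
    fix x
    show "(x \<in> nodes T \<and> card {w \<in> nodes T. {w, x} \<in> edges T} \<le> 1) = (x \<in> {a, b, c, d})"
    proof (cases "x \<in> nodes T")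
      case True
      then consider "x = a" | "x = b" | "x = c" | "x = d" | "x = u" | "x = v"
        unfolding nodes by blast
      then show ?thesis
        by cases (use True uv in \<open>simp_all only: nb, auto\<close>)
    qed (simp add: nodes)
  qed
  moreover have "tree_quartic T a b c d"
    unfolding tree_quartic_def
    using uv by (intro conjI exI[of _ "[a, u, b]"] exI[of _ "[c, v, d]"])
      (auto simp: simple_path_def T_def insert_commute)
  ultimately show ?thesis using T by blast
qed

section \<open>Labeled tree structures\<close>

definition quart :: "('a, tree_symbol) rel_structure \<Rightarrow> 'a \<Rightarrow> 'a \<Rightarrow> 'a \<Rightarrow> 'a \<Rightarrow> bool" where
  "quart Z a b c d \<longleftrightarrow> [a, b, c, d] \<in> rel Z Quartic"

definition precedes :: "('a, tree_symbol) rel_structure \<Rightarrow> 'a \<Rightarrow> 'a \<Rightarrow> bool" where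
  "precedes Z a b \<longleftrightarrow> [a, b] \<in> rel Z Less"

lemma labeled_trees_iso_closed:
  assumes "is_isomorphism i" "tgt i \<in> labeled_trees"
  shows "src i \<in> labeled_trees"
proof -
  obtain T :: "nat ugraph" and lt where T: "finite_tree T" "strict_linear_order_on (leaves T) lt"
    "isomorphic (tgt i) (labeled_tree_structure T lt)"
    using assms(2) unfolding labeled_trees_def by blast
  then obtain j where j: "is_isomorphism j" "src j = tgt i" "tgt j = labeled_tree_structure T lt"
    unfolding isomorphic_def by blast
  then have "isomorphic (src i) (labeled_tree_structure T lt)"
    using is_isomorphism_arrow_comp[OF assms(1) j(1)] unfolding isomorphic_def
    by (intro exI[of _ "arrow_comp j i"]) simp
  then show ?thesis
    using T unfolding labeled_trees_def by blast
qed

lemma labeled_trees_is_structure: "Z \<in> labeled_trees \<Longrightarrow> is_structure Z"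
  unfolding labeled_trees_def isomorphic_def is_isomorphism_def is_embedding_def by auto

interpretation LT: structure_class labeled_trees
  by standard (fact labeled_trees_is_structure, fact labeled_trees_iso_closed)

lemma labeled_treesE:
  assumes "Z \<in> labeled_trees"
  obtains T :: "nat ugraph" and lt f where "finite_tree T" "strict_linear_order_on (leaves T) lt"
    "bij_betw f (carrier Z) (leaves T)"
    "\<And>xs. xs \<in> rel Z Quartic \<Longrightarrow> \<exists>a b c d. xs = [a, b, c, d]"
    "\<And>xs. xs \<in> rel Z Less \<Longrightarrow> \<exists>a b. xs = [a, b]"
    "\<And>a b c d. {a, b, c, d} \<subseteq> carrier Z \<Longrightarrow> quart Z a b c d \<longleftrightarrow> tree_quartic T (f a) (f b) (f c) (f d)"
    "\<And>a b. a \<in> carrier Z \<Longrightarrow> b \<in> carrier Z \<Longrightarrow> precedes Z a b \<longleftrightarrow> (f a, f b) \<in> lt"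
proof -
  obtain T :: "nat ugraph" and lt i where T: "finite_tree T" "strict_linear_order_on (leaves T) lt"
    and i: "is_isomorphism i" "src i = Z" "tgt i = labeled_tree_structure T lt"
    using assms unfolding labeled_trees_def isomorphic_def by blast
  have emb: "is_embedding i" using i by (simp add: is_isomorphism_def)
  have ct: "carrier (tgt i) = leaves T" by (simp add: i(3) labeled_tree_structure_def)
  have app: "fn i x \<in> leaves T" if "x \<in> carrier Z" for x
    using embedding_app[OF emb, of x] that i ct by simp
  have rel: "map (fn i) xs \<in> rel (labeled_tree_structure T lt) r \<longleftrightarrow> xs \<in> rel Z r"
    if "set xs \<subseteq> carrier Z" for xs r
    using embedding_rel[OF emb, of xs r] that i by simp
  have sub: "set xs \<subseteq> carrier Z" if "xs \<in> rel Z r" for xs r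
    using labeled_trees_is_structure[OF assms] that by (auto simp: is_structure_def)
  show thesis
  proof (rule that[OF T, of "fn i"])
    show "bij_betw (fn i) (carrier Z) (leaves T)"
      using i ct unfolding bij_betw_def is_isomorphism_def is_embedding_def by auto
    show "\<exists>a b c d. xs = [a, b, c, d]" if "xs \<in> rel Z Quartic" for xs
      using rel[OF sub[OF that], of Quartic] that
      by (auto simp: labeled_tree_structure_def map_eq_Cons_conv)
    show "\<exists>a b. xs = [a, b]" if "xs \<in> rel Z Less" for xs
      using rel[OF sub[OF that], of Less] that
      by (auto simp: labeled_tree_structure_def map_eq_Cons_conv)
    show "quart Z a b c d \<longleftrightarrow> tree_quartic T (fn i a) (fn i b) (fn i c) (fn i d)"
      if "{a, b, c, d} \<subseteq> carrier Z" for a b c d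
      using rel[of "[a, b, c, d]" Quartic] that app
      by (auto simp: labeled_tree_structure_def quart_def)
    show "precedes Z a b \<longleftrightarrow> (fn i a, fn i b) \<in> lt"
      if "a \<in> carrier Z" "b \<in> carrier Z" for a b
      using rel[of "[a, b]" Less] that app
      by (auto simp: labeled_tree_structure_def precedes_def)
  qed
qed

lemma is_structure_set: "is_structure Z \<Longrightarrow> xs \<in> rel Z r \<Longrightarrow> set xs \<subseteq> carrier Z"
  unfolding is_structure_def in_lists_conv_set by blast

lemma quart_carrier: "Z \<in> labeled_trees \<Longrightarrow> quart Z a b c d \<Longrightarrow> {a, b, c, d} \<subseteq> carrier Z"
  using is_structure_set[OF labeled_trees_is_structure, of Z "[a, b, c, d]"] unfolding quart_def by simp

lemma quartic_axioms:
  assumes Z: "Z \<in> labeled_trees"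
  shows quart_distinct: "quart Z a b c d \<Longrightarrow> distinct [a, b, c, d]"
    and quart_swap: "quart Z a b c d \<Longrightarrow> quart Z b a c d" "quart Z a b c d \<Longrightarrow> quart Z c d a b"
    and quart_exclusive: "quart Z a b c d \<Longrightarrow> \<not> quart Z a c b d"
    and quart_trans: "quart Z a b c d \<Longrightarrow> quart Z a b c x \<Longrightarrow> d \<noteq> x \<Longrightarrow> quart Z a b d x"
    and quart_shift: "quart Z a b c d \<Longrightarrow> quart Z a x b c \<Longrightarrow> d \<noteq> x \<Longrightarrow> quart Z a x b d"
proof -
  obtain T :: "nat ugraph" and lt f where T: "finite_tree T" and lin: "strict_linear_order_on (leaves T) lt"
    and f: "bij_betw f (carrier Z) (leaves T)"
    and len: "\<And>xs. xs \<in> rel Z Quartic \<Longrightarrow> \<exists>a b c d. xs = [a, b, c, d]"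
      "\<And>xs. xs \<in> rel Z Less \<Longrightarrow> \<exists>a b. xs = [a, b]"
    and iff: "\<And>a b c d. {a, b, c, d} \<subseteq> carrier Z \<Longrightarrow> quart Z a b c d \<longleftrightarrow> tree_quartic T (f a) (f b) (f c) (f d)"
    and iffl: "\<And>a b. a \<in> carrier Z \<Longrightarrow> b \<in> carrier Z \<Longrightarrow> precedes Z a b \<longleftrightarrow> (f a, f b) \<in> lt"
    by (rule labeled_treesE[OF Z]) (rule that)
  have node: "f x \<in> nodes T" if "x \<in> carrier Z" for x
    using bij_betwE[OF f] that by (auto simp: leaves_def)
  have inj: "f x \<noteq> f y" if "x \<in> carrier Z" "y \<in> carrier Z" "x \<noteq> y" for x y
    using f that unfolding bij_betw_def inj_on_def by blast
  note car = quart_carrier[OF Z]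
  note to_tree = iff[THEN iffD1] and of_tree = iff[THEN iffD2]
  show "distinct [a, b, c, d]" if "quart Z a b c d"
    using to_tree[OF car[OF that] that] by (auto simp: tree_quartic_def)
  show "quart Z b a c d" if "quart Z a b c d"
    by (rule of_tree[OF _ tree_quartic_swap(1)[OF to_tree[OF car[OF that] that]]]) (use car[OF that] in auto)
  show "quart Z c d a b" if "quart Z a b c d"
    by (rule of_tree[OF _ tree_quartic_swap(2)[OF to_tree[OF car[OF that] that]]]) (use car[OF that] in auto)
  show "\<not> quart Z a c b d" if q: "quart Z a b c d"
  proof
    assume r: "quart Z a c b d"
    show False
      using tree_quartic_exclusive[OF T _ to_tree[OF car[OF q] q]] to_tree[OF car[OF r] r] car[OF q] node by auto
  qed
  show "quart Z a b d x" if q: "quart Z a b c d" and r: "quart Z a b c x" and "d \<noteq> x"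
  proof (rule of_tree)
    show "{a, b, d, x} \<subseteq> carrier Z" using car[OF q] car[OF r] by auto
    show "tree_quartic T (f a) (f b) (f d) (f x)"
      using car[OF q] car[OF r] node inj \<open>d \<noteq> x\<close>
      by (intro tree_quartic_trans[OF T _ to_tree[OF car[OF q] q] to_tree[OF car[OF r] r]]) auto
  qed
  show "quart Z a x b d" if q: "quart Z a b c d" and r: "quart Z a x b c" and "d \<noteq> x"
  proof (rule of_tree)
    show "{a, x, b, d} \<subseteq> carrier Z" using car[OF q] car[OF r] by auto
    show "tree_quartic T (f a) (f x) (f b) (f d)"
      using car[OF q] car[OF r] node inj \<open>d \<noteq> x\<close>
      by (intro tree_quartic_shift[OF T _ to_tree[OF car[OF q] q] to_tree[OF car[OF r] r]]) auto
  qed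
qed

lemma order_axioms:
  assumes Z: "Z \<in> labeled_trees"
  shows precedes_irrefl: "\<not> precedes Z a a"
    and precedes_trans: "precedes Z a b \<Longrightarrow> precedes Z b c \<Longrightarrow> precedes Z a c"
    and precedes_total: "a \<in> carrier Z \<Longrightarrow> b \<in> carrier Z \<Longrightarrow> a \<noteq> b \<Longrightarrow> precedes Z a b \<or> precedes Z b a"
proof -
  obtain T :: "nat ugraph" and lt f where T: "finite_tree T" and lin: "strict_linear_order_on (leaves T) lt"
    and f: "bij_betw f (carrier Z) (leaves T)"
    and len: "\<And>xs. xs \<in> rel Z Quartic \<Longrightarrow> \<exists>a b c d. xs = [a, b, c, d]"
      "\<And>xs. xs \<in> rel Z Less \<Longrightarrow> \<exists>a b. xs = [a, b]"
    and iffq: "\<And>a b c d. {a, b, c, d} \<subseteq> carrier Z \<Longrightarrow> quart Z a b c d \<longleftrightarrow> tree_quartic T (f a) (f b) (f c) (f d)"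
    and iff: "\<And>a b. a \<in> carrier Z \<Longrightarrow> b \<in> carrier Z \<Longrightarrow> precedes Z a b \<longleftrightarrow> (f a, f b) \<in> lt"
    by (rule labeled_treesE[OF Z]) (rule that)
  have car: "a \<in> carrier Z \<and> b \<in> carrier Z" if "precedes Z a b" for a b
    using is_structure_set[OF labeled_trees_is_structure[OF Z], of "[a, b]"] that unfolding precedes_def by simp
  have lt: "trans lt" "irrefl lt" "total_on (leaves T) lt"
    using lin by (auto simp: strict_linear_order_on_def)
  show "\<not> precedes Z a a"
    using car[of a a] iff[of a a] lt(2) by (auto simp: irrefl_def)
  show "precedes Z a c" if p: "precedes Z a b" "precedes Z b c"
  proof -
    have "(f a, f b) \<in> lt" "(f b, f c) \<in> lt"
      using p car[OF p(1)] car[OF p(2)] iff by simp_all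
    then show ?thesis
      using transD[OF lt(1)] car[OF p(1)] car[OF p(2)] iff[of a c] by simp
  qed
  show "precedes Z a b \<or> precedes Z b a" if ab: "a \<in> carrier Z" "b \<in> carrier Z" "a \<noteq> b"
  proof -
    have "f a \<in> leaves T" "f b \<in> leaves T" "f a \<noteq> f b"
      using f ab unfolding bij_betw_def inj_on_def by auto
    then show ?thesis
      using lt(3) iff ab unfolding total_on_def by simp
  qed
qed

lemma rel_labeled_trees:
  assumes Z: "Z \<in> labeled_trees"
  shows "rel Z Quartic = {[a, b, c, d] | a b c d. quart Z a b c d}"
    "rel Z Less = {[a, b] | a b. precedes Z a b}"
proof -
  obtain T :: "nat ugraph" and lt f where T: "finite_tree T" and lin: "strict_linear_order_on (leaves T) lt"
    and f: "bij_betw f (carrier Z) (leaves T)"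
    and len: "\<And>xs. xs \<in> rel Z Quartic \<Longrightarrow> \<exists>a b c d. xs = [a, b, c, d]"
      "\<And>xs. xs \<in> rel Z Less \<Longrightarrow> \<exists>a b. xs = [a, b]"
    and iffq: "\<And>a b c d. {a, b, c, d} \<subseteq> carrier Z \<Longrightarrow> quart Z a b c d \<longleftrightarrow> tree_quartic T (f a) (f b) (f c) (f d)"
    and iffl: "\<And>a b. a \<in> carrier Z \<Longrightarrow> b \<in> carrier Z \<Longrightarrow> precedes Z a b \<longleftrightarrow> (f a, f b) \<in> lt"
    by (rule labeled_treesE[OF Z]) (rule that)
  show "rel Z Quartic = {[a, b, c, d] | a b c d. quart Z a b c d}"
    unfolding quart_def using len(1) by blast
  show "rel Z Less = {[a, b] | a b. precedes Z a b}"
    unfolding precedes_def using len(2) by blast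
qed

text \<open>The tuples by which the relation records the single split \<open>ab|cd\<close>. For
  distinct points there are eight: each pair may be swapped, and the two pairs may be
  exchanged.\<close>

definition quartets :: "'a \<Rightarrow> 'a \<Rightarrow> 'a \<Rightarrow> 'a \<Rightarrow> 'a list set" where
  "quartets a b c d = {[p, q, r, s] | p q r s.
     {p, q} = {a, b} \<and> {r, s} = {c, d} \<or> {p, q} = {c, d} \<and> {r, s} = {a, b}}"

lemma in_quartets [simp]: "[p, q, r, s] \<in> quartets a b c d \<longleftrightarrow>
    {p, q} = {a, b} \<and> {r, s} = {c, d} \<or> {p, q} = {c, d} \<and> {r, s} = {a, b}"
  by (simp add: quartets_def)

lemma quart_iff:
  assumes Z: "Z \<in> labeled_trees"
  shows "quart Z b a c d \<longleftrightarrow> quart Z a b c d" "quart Z c d a b \<longleftrightarrow> quart Z a b c d"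
    "quart Z a b d c \<longleftrightarrow> quart Z a b c d"
  using quart_swap[OF Z] by blast+

lemma quartets_swap:
  "[q, p, r, s] \<in> quartets a b c d \<longleftrightarrow> [p, q, r, s] \<in> quartets a b c d"
  "[r, s, p, q] \<in> quartets a b c d \<longleftrightarrow> [p, q, r, s] \<in> quartets a b c d"
  by (simp_all add: insert_commute conj_commute disj_commute)

text \<open>Four points admit three splits. The symmetries move \<open>a\<close> to the first place
  of a tuple, and the partner of \<open>a\<close> then determines the split.\<close>

lemma quartic_on_four_points:
  assumes Z: "Z \<in> labeled_trees"
  shows "rel Z Quartic \<inter> lists {a, b, c, d} =
    (if quart Z a b c d then quartets a b c d else {}) \<union>
    (if quart Z a c b d then quartets a c b d else {}) \<union>
    (if quart Z a d b c then quartets a d b c else {})" (is "_ = ?R")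
proof -
  note eqs = quart_iff[OF Z]
  have iff: "quart Z b a c d \<longleftrightarrow> quart Z a b c d" "quart Z a b d c \<longleftrightarrow> quart Z a b c d"
    "quart Z b a d c \<longleftrightarrow> quart Z a b c d" "quart Z c d a b \<longleftrightarrow> quart Z a b c d"
    "quart Z c d b a \<longleftrightarrow> quart Z a b c d" "quart Z d c a b \<longleftrightarrow> quart Z a b c d"
    "quart Z d c b a \<longleftrightarrow> quart Z a b c d" for a b c d
    by (rule eqs(1), rule eqs(3), rule trans[OF eqs(1) eqs(3)], rule eqs(2), rule trans[OF eqs(2) eqs(1)],
        rule trans[OF eqs(1) eqs(2)], rule trans[OF eqs(1) trans[OF eqs(2) eqs(1)]])
  define R where "R = ?R"
  have R: "xs \<in> R \<longleftrightarrow> quart Z a b c d \<and> xs \<in> quartets a b c d \<or>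
      quart Z a c b d \<and> xs \<in> quartets a c b d \<or> quart Z a d b c \<and> xs \<in> quartets a d b c" for xs
    by (simp add: R_def)
  have sw: "[q, p, r, s] \<in> R \<longleftrightarrow> [p, q, r, s] \<in> R" "[r, s, p, q] \<in> R \<longleftrightarrow> [p, q, r, s] \<in> R" for p q r s
    by (simp_all only: R quartets_swap(1)[of q p r s] quartets_swap(2)[of r s p q])
  have base: "[a, q, r, s] \<in> R" if "{q, r, s} \<subseteq> {a, b, c, d}" and pq: "quart Z a q r s" for q r s
  proof -
    have "q \<in> {b, c, d}" "r \<in> {b, c, d}" "s \<in> {b, c, d}" "q \<noteq> r" "q \<noteq> s" "r \<noteq> s"
      using that quart_distinct[OF Z pq] by auto
    then have "q = b \<and> r = c \<and> s = d \<or> q = b \<and> r = d \<and> s = c \<or> q = c \<and> r = b \<and> s = d \<or>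
      q = c \<and> r = d \<and> s = b \<or> q = d \<and> r = b \<and> s = c \<or> q = d \<and> r = c \<and> s = b"
      by (elim insertE emptyE) simp_all
    then show ?thesis
      using pq iff(2)[of a b c d] iff(2)[of a c b d] iff(2)[of a d b c] unfolding R
      by (elim disjE conjE) (simp_all add: insert_commute)
  qed
  have mem: "[p, q, r, s] \<in> R" if sub: "{p, q, r, s} \<subseteq> {a, b, c, d}" and pq: "quart Z p q r s" for p q r s
  proof -
    \<comment> \<open>Entries of a related tuple are distinct, so the tuple uses all four points and
      \<open>a\<close> is one of them.\<close>
    have "card {p, q, r, s} = 4"
      using quart_distinct[OF Z pq] by simp
    moreover have "card {a, b, c, d} \<le> 4"
      using card_length[of "[a, b, c, d]"] by simp
    ultimately have "{p, q, r, s} = {a, b, c, d}"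
      by (intro card_seteq sub) simp_all
    then have "a \<in> {p, q, r, s}" by simp
    then consider "p = a" | "q = a" | "r = a" | "s = a"
      by auto
    then show ?thesis
    proof cases
      case 1
      then show ?thesis using base[of q r s] sub pq by simp
    next
      case 2
      then have "[q, p, r, s] \<in> R" using base[of p r s] sub pq iff(1)[of q p r s] by simp
      then show ?thesis using sw(1)[of p q r s] by (simp only:)
    next
      case 3
      then have "[r, s, p, q] \<in> R" using base[of s p q] sub pq iff(4)[of r s p q] by simp
      then show ?thesis using sw(2)[of p q r s] by (simp only:)
    next
      case 4
      then have "[s, r, p, q] \<in> R" using base[of r p q] sub pq iff(6)[of s r p q] iff(5)[of p q r s] by simp
      then show ?thesis using sw(1)[of r s p q] sw(2)[of p q r s] by (simp only:)
    qed
  qed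
  have sub: "xs \<in> R" if xs: "xs \<in> rel Z Quartic" "xs \<in> lists {a, b, c, d}" for xs
  proof -
    obtain p q r s where pq: "xs = [p, q, r, s]" "quart Z p q r s"
      using xs(1) unfolding rel_labeled_trees(1)[OF Z] by blast
    then show ?thesis
      using mem[of p q r s] xs(2) by simp
  qed
  have sup: "quartets p q r s \<subseteq> rel Z Quartic" if "quart Z p q r s" for p q r s
    using that iff[of p q r s] unfolding quartets_def quart_def by (auto simp: doubleton_eq_iff)
  have "quartets a b c d \<subseteq> lists {a, b, c, d}" "quartets a c b d \<subseteq> lists {a, b, c, d}"
    "quartets a d b c \<subseteq> lists {a, b, c, d}"
    by (auto simp: quartets_def doubleton_eq_iff)
  then have "xs \<in> rel Z Quartic \<inter> lists {a, b, c, d}" if "xs \<in> R" for xs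
    using that sup[of a b c d] sup[of a c b d] sup[of a d b c] unfolding R by auto
  then show ?thesis
    unfolding R_def[symmetric] using sub by blast
qed

section \<open>Structures given by an increasing list\<close>

primrec list_order :: "'a list \<Rightarrow> ('a \<times> 'a) set" where
  "list_order [] = {}"
| "list_order (x # xs) = {x} \<times> set xs \<union> list_order xs"

lemma list_order_subset: "list_order xs \<subseteq> set xs \<times> set xs"
  by (induction xs) auto

lemma strict_linear_order_on_list_order:
  "distinct xs \<Longrightarrow> strict_linear_order_on (set xs) (list_order xs)"
proof (induction xs)
  case (Cons x xs)
  then show ?case
    using list_order_subset[of xs]
    unfolding strict_linear_order_on_def trans_def irrefl_def total_on_def by (simp; blast)
qed (simp add: strict_linear_order_on_def irrefl_def)

text \<open>The list is read from least to greatest, independently of the size of numbers: in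
  \<open>ordered_structure [3, 0] Q\<close> the point 3 precedes 0.\<close>

definition ordered_structure :: "'a list \<Rightarrow> 'a list set \<Rightarrow> ('a, tree_symbol) rel_structure" where
  "ordered_structure xs Q =
     \<lparr>carrier = set xs,
      rel = (\<lambda>r. case r of Quartic \<Rightarrow> Q | Less \<Rightarrow> {[x, y] | x y. (x, y) \<in> list_order xs})\<rparr>"

lemma ordered_structure_sel [simp]:
  "carrier (ordered_structure xs Q) = set xs"
  "rel (ordered_structure xs Q) Quartic = Q"
  "rel (ordered_structure xs Q) Less = {[x, y] | x y. (x, y) \<in> list_order xs}"
  by (simp_all add: ordered_structure_def)

lemma ordered_structure_in_labeled_trees:
  assumes "finite_tree T" "leaves T = set xs" "distinct xs"
    "Q = {[a, b, c, d] | a b c d. {a, b, c, d} \<subseteq> leaves T \<and> tree_quartic T a b c d}"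
  shows "ordered_structure xs Q \<in> labeled_trees"
proof -
  have S: "ordered_structure xs Q = labeled_tree_structure T (list_order xs)" (is "_ = ?L")
  proof (rule rel_structure_eqI)
    fix r
    show "rel (ordered_structure xs Q) r = rel ?L r"
      using list_order_subset[of xs] assms(2,4)
      by (cases r) (auto simp: labeled_tree_structure_def)
  qed (simp add: labeled_tree_structure_def assms(2))
  have "is_structure ?L"
    unfolding is_structure_def labeled_tree_structure_def by (auto split: tree_symbol.split)
  then have "is_embedding (inclusion ?L ?L)"
    by (intro is_embedding_inclusion) (simp_all add: restr_carrier)
  then have "isomorphic ?L ?L"
    unfolding isomorphic_def is_isomorphism_def by (intro exI[of _ "inclusion ?L ?L"]) simp
  then show ?thesis
    using assms(1) strict_linear_order_on_list_order[OF assms(3)]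
    unfolding labeled_trees_def S assms(2)[symmetric] by blast
qed

lemma star_in_labeled_trees:
  assumes "distinct xs" "xs \<noteq> []"
  shows "ordered_structure xs {} \<in> labeled_trees"
proof -
  obtain T where T: "finite_tree T" "leaves T = set xs"
    "\<And>a b c d. {a, b, c, d} \<subseteq> set xs \<Longrightarrow> \<not> tree_quartic T a b c d"
  \<comment> \<open>A star with one outer vertex has two leaves, so a single point is realised by
    the one-vertex tree instead.\<close>
  proof (cases "length xs = 1")
    case True
    then obtain x where x: "xs = [x]" by (metis One_nat_def length_0_conv length_Suc_conv)
    have "leaves (star_tree x {}) = {x}"
      by (auto simp: leaves_def star_tree_def)
    then show ?thesis
      using that[of "star_tree x {}"] finite_tree_star_tree[of "{}" x]
      by (auto simp: x tree_quartic_def)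
  next
    case False
    obtain u where u: "u \<notin> set xs" using ex_new_if_finite[OF infinite_UNIV_nat finite_set] by blast
    have "length xs \<ge> 2" using False assms(2) by (cases xs rule: remdups_adj.cases) auto
    then have "card (set xs) \<ge> 2" using assms(1) by (simp add: distinct_card)
    then show ?thesis
      using that[of "star_tree u (set xs)"] finite_tree_star_tree[of "set xs" u] u
        leaves_star_tree[of "set xs" u] not_tree_quartic_star_tree[of u "set xs"] by auto
  qed
  then show ?thesis
    using assms(1) by (intro ordered_structure_in_labeled_trees[of T]) auto
qed

text \<open>Only the split \<open>ab|cd\<close> is read off from the tree. Exclusivity and
  \<open>quartic_on_four_points\<close> then determine the whole relation without examining further
  paths.\<close>

lemma quartet_in_labeled_trees:
  assumes "distinct xs" "set xs = {a, b, c, d}" "distinct [a, b, c, d]"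
  shows "ordered_structure xs (quartets a b c d) \<in> labeled_trees"
proof -
  obtain T where T: "finite_tree T" "leaves T = {a, b, c, d}" "tree_quartic T a b c d"
    using ex_quartet_tree[OF assms(3)] by blast
  define Q where "Q = {[p, q, r, s] | p q r s. {p, q, r, s} \<subseteq> leaves T \<and> tree_quartic T p q r s}"
  have Z: "ordered_structure xs Q \<in> labeled_trees" (is "?Z \<in> _")
    using assms T unfolding Q_def by (intro ordered_structure_in_labeled_trees[of T]) simp_all
  have q: "quart ?Z a b c d"
    using T by (simp add: quart_def Q_def)
  have "\<not> quart ?Z a c b d" "\<not> quart ?Z a d b c"
    using quart_exclusive[OF Z q] quart_exclusive[OF Z, of a b d c] quart_iff[OF Z] q by blast+
  then have "rel ?Z Quartic \<inter> lists (set xs) = quartets a b c d"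
    using quartic_on_four_points[OF Z, of a b c d] q assms(2) by simp
  moreover have "rel ?Z Quartic \<subseteq> lists (set xs)"
    using labeled_trees_is_structure[OF Z] unfolding is_structure_def ordered_structure_sel(1) by blast
  ultimately have "Q = quartets a b c d"
    by (simp add: inf_absorb1)
  then show ?thesis using Z by simp
qed

lemma finite_labeled_trees_on: "finite {Z \<in> labeled_trees. carrier Z = A}"
proof (cases "finite A")
  case True
  have "finite {xs. set xs \<subseteq> A \<and> length xs = n}" for n
    using finite_lists_length_eq[OF True] .
  then have fin: "finite (Pow {xs. set xs \<subseteq> A \<and> length xs = 4} \<times> Pow {xs. set xs \<subseteq> A \<and> length xs = 2})"
    by simp
  let ?f = "\<lambda>Z :: (nat, tree_symbol) rel_structure. (rel Z Quartic, rel Z Less)"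
  show ?thesis
  proof (rule inj_on_finite[OF _ _ fin])
    show "inj_on ?f {Z \<in> labeled_trees. carrier Z = A}"
    proof (rule inj_onI)
      fix M N assume "M \<in> {Z \<in> labeled_trees. carrier Z = A}" "N \<in> {Z \<in> labeled_trees. carrier Z = A}"
        and eq: "?f M = ?f N"
      moreover have "rel M r = rel N r" for r
        using eq by (cases r) auto
      ultimately show "M = N" by (intro rel_structure_eqI) auto
    qed
    show "?f ` {Z \<in> labeled_trees. carrier Z = A} \<subseteq>
        Pow {xs. set xs \<subseteq> A \<and> length xs = 4} \<times> Pow {xs. set xs \<subseteq> A \<and> length xs = 2}"
    proof (rule image_subsetI)
      fix Z :: "(nat, tree_symbol) rel_structure"
      assume "Z \<in> {Z \<in> labeled_trees. carrier Z = A}"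
      then have Z: "Z \<in> labeled_trees" "carrier Z = A" by auto
      have "set xs \<subseteq> A" if "xs \<in> rel Z r" for xs r
        using is_structure_set[OF labeled_trees_is_structure[OF Z(1)] that] Z(2) by simp
      moreover have "length xs = 4" if "xs \<in> rel Z Quartic" for xs
        using that rel_labeled_trees(1)[OF Z(1)] by auto
      moreover have "length xs = 2" if "xs \<in> rel Z Less" for xs
        using that rel_labeled_trees(2)[OF Z(1)] by auto
      ultimately show "?f Z \<in> Pow {xs. set xs \<subseteq> A \<and> length xs = 4} \<times> Pow {xs. set xs \<subseteq> A \<and> length xs = 2}"
        by blast
    qed
  qed
next
  case False
  \<comment> \<open>For infinite \<open>A\<close> the set is empty, because carriers are in
    bijection with the leaves of finite trees.\<close>
  have "finite (carrier Z)" if Z: "Z \<in> labeled_trees" for Z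
  proof -
    obtain T :: "nat ugraph" and lt f where T: "finite_tree T" and lin: "strict_linear_order_on (leaves T) lt"
      and f: "bij_betw f (carrier Z) (leaves T)"
      and len: "\<And>xs. xs \<in> rel Z Quartic \<Longrightarrow> \<exists>a b c d. xs = [a, b, c, d]"
        "\<And>xs. xs \<in> rel Z Less \<Longrightarrow> \<exists>a b. xs = [a, b]"
      and iffq: "\<And>a b c d. {a, b, c, d} \<subseteq> carrier Z \<Longrightarrow> quart Z a b c d \<longleftrightarrow> tree_quartic T (f a) (f b) (f c) (f d)"
      and iff: "\<And>a b. a \<in> carrier Z \<Longrightarrow> b \<in> carrier Z \<Longrightarrow> precedes Z a b \<longleftrightarrow> (f a, f b) \<in> lt"
      by (rule labeled_treesE[OF Z]) (rule that)
    show ?thesis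
      using bij_betw_finite[OF f] T by (simp add: finite_tree_def leaves_def)
  qed
  then show ?thesis using False by (auto intro: finite_subset[of _ "{}"])
qed

section \<open>Relations between small extensions\<close>

text \<open>Apart from \<open>Star\<close>, the letters name the pair that contains the first point.
  For points listed in increasing order, the classes belonging to \<open>Star\<close>,
  \<open>AB\<close>, \<open>AC\<close>, \<open>AD\<close> are s, x, y, z.\<close>

datatype shape = Star | AB | AC | AD

definition shape_quartets :: "shape \<Rightarrow> 'a \<Rightarrow> 'a \<Rightarrow> 'a \<Rightarrow> 'a \<Rightarrow> 'a list set" where
  "shape_quartets \<sigma> a b c d =
     (case \<sigma> of Star \<Rightarrow> {} | AB \<Rightarrow> quartets a b c d | AC \<Rightarrow> quartets a c b d | AD \<Rightarrow> quartets a d b c)"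

definition has_shape :: "shape \<Rightarrow> ('a, tree_symbol) rel_structure \<Rightarrow> 'a \<Rightarrow> 'a \<Rightarrow> 'a \<Rightarrow> 'a \<Rightarrow> bool" where
  "has_shape \<sigma> Z a b c d \<longleftrightarrow>
     (case \<sigma> of Star \<Rightarrow> \<not> quart Z a b c d \<and> \<not> quart Z a c b d \<and> \<not> quart Z a d b c
      | AB \<Rightarrow> quart Z a b c d | AC \<Rightarrow> quart Z a c b d | AD \<Rightarrow> quart Z a d b c)"

lemma quart_pairwise_exclusive:
  assumes Z: "Z \<in> labeled_trees"
  shows "\<not> (quart Z a b c d \<and> quart Z a c b d)" "\<not> (quart Z a b c d \<and> quart Z a d b c)"
    "\<not> (quart Z a c b d \<and> quart Z a d b c)"
proof -
  note ex = quart_exclusive[OF Z] and sw = quart_iff[OF Z]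
  show "\<not> (quart Z a b c d \<and> quart Z a c b d)" using ex[of a b c d] by blast
  show "\<not> (quart Z a b c d \<and> quart Z a d b c)"
    using ex[of a b d c] sw(3)[where a = a and b = b and c = c and d = d] by blast
  show "\<not> (quart Z a c b d \<and> quart Z a d b c)"
    using ex[of a c d b] sw(3)[where a = a and b = c and c = b and d = d]
      sw(3)[where a = a and b = d and c = b and d = c] by blast
qed

lemma has_shape_unique:
  assumes "Z \<in> labeled_trees" "has_shape \<sigma> Z a b c d" "has_shape \<tau> Z a b c d"
  shows "\<sigma> = \<tau>"
  using assms(2,3) quart_pairwise_exclusive[OF assms(1), where a = a and b = b and c = c and d = d]
  by (cases \<sigma>; cases \<tau>) (simp_all add: has_shape_def)

lemma ex_has_shape: "\<exists>\<sigma>. has_shape \<sigma> Z a b c d"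
proof (cases "quart Z a b c d \<or> quart Z a c b d \<or> quart Z a d b c")
  case True
  then show ?thesis
    by (elim disjE) (rule exI[of _ AB] exI[of _ AC] exI[of _ AD]; simp add: has_shape_def)+
next
  case False
  then show ?thesis by (intro exI[of _ Star]) (simp add: has_shape_def)
qed

lemma quartic_on_four_points_shape:
  assumes Z: "Z \<in> labeled_trees" and sub: "{a, b, c, d} \<subseteq> carrier Z"
  shows "rel Z Quartic \<inter> lists {a, b, c, d} = shape_quartets \<sigma> a b c d \<longleftrightarrow> has_shape \<sigma> Z a b c d"
proof -
  obtain \<tau> where \<tau>: "has_shape \<tau> Z a b c d" using ex_has_shape[of Z a b c d] ..
  have eq: "rel Z Quartic \<inter> lists {a, b, c, d} = shape_quartets \<tau> a b c d"
    using \<tau> quartic_on_four_points[OF Z, of a b c d] quart_pairwise_exclusive[OF Z, where a = a and b = b and c = c and d = d]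
    by (cases \<tau>) (simp_all add: has_shape_def shape_quartets_def)
  have "has_shape \<sigma> Z a b c d" if s: "rel Z Quartic \<inter> lists {a, b, c, d} = shape_quartets \<sigma> a b c d"
  proof -
    have "quart Z p q r s \<longleftrightarrow> [p, q, r, s] \<in> shape_quartets \<sigma> a b c d"
      if "{p, q, r, s} \<subseteq> {a, b, c, d}" for p q r s
      using that unfolding s[symmetric] quart_def by simp
    from this[of a b c d] this[of a c b d] this[of a d b c] show ?thesis
      by (cases \<sigma>) (simp_all add: has_shape_def shape_quartets_def)
  qed
  then show ?thesis
    using eq has_shape_unique[OF Z \<tau>] by blast
qed

lemma quartic_on_three_points:
  assumes Z: "Z \<in> labeled_trees" and "length ys \<le> 3"
  shows "rel Z Quartic \<inter> lists (set ys) = {}"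
proof -
  have no: False if "quart Z a b c d" "{a, b, c, d} \<subseteq> set ys" for a b c d
  proof -
    have "card {a, b, c, d} = 4"
      using quart_distinct[OF Z that(1)] by simp
    moreover have "card {a, b, c, d} \<le> card (set ys)"
      by (rule card_mono) (use that in auto)
    ultimately show False using card_length[of ys] assms(2) by linarith
  qed
  show ?thesis
    unfolding rel_labeled_trees(1)[OF Z] using no by fastforce
qed

lemma sorted_wrt_iff_list_order:
  "sorted_wrt P xs \<longleftrightarrow> (\<forall>(x, y) \<in> list_order xs. P x y)"
  by (induction xs) auto

text \<open>Turns the restriction conditions that index an amalgamation sum into conditions on the
  order and the tree. Being sorted suffices for the order, since the order of a list is total on its
  points and \<open>precedes Z\<close> is asymmetric.\<close>

lemma restr_eq_ordered_structure_iff: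
  assumes Z: "Z \<in> labeled_trees" and sub: "set ys \<subseteq> carrier Z" and dist: "distinct ys"
  shows "restr Z (set ys) = ordered_structure ys Q \<longleftrightarrow>
    sorted_wrt (precedes Z) ys \<and> rel Z Quartic \<inter> lists (set ys) = Q"
proof
  assume eq: "restr Z (set ys) = ordered_structure ys Q"
  have rel: "rel Z r \<inter> lists (set ys) = rel (ordered_structure ys Q) r" for r
    by (simp flip: eq)
  have "precedes Z x y" if "(x, y) \<in> list_order ys" for x y
    using rel[of Less] that unfolding precedes_def by auto
  then show "sorted_wrt (precedes Z) ys \<and> rel Z Quartic \<inter> lists (set ys) = Q"
    using rel[of Quartic] unfolding sorted_wrt_iff_list_order by auto
next
  assume s: "sorted_wrt (precedes Z) ys \<and> rel Z Quartic \<inter> lists (set ys) = Q"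
  have lin: "strict_linear_order_on (set ys) (list_order ys)"
    by (rule strict_linear_order_on_list_order[OF dist])
  have prec: "precedes Z x y" if "(x, y) \<in> list_order ys" for x y
    using s that unfolding sorted_wrt_iff_list_order by auto
  have iff: "precedes Z x y \<longleftrightarrow> (x, y) \<in> list_order ys" if "x \<in> set ys" "y \<in> set ys" for x y
  proof
    assume p: "precedes Z x y"
    then have "x \<noteq> y" using precedes_irrefl[OF Z] by blast
    then have "(x, y) \<in> list_order ys \<or> (y, x) \<in> list_order ys"
      using lin that unfolding strict_linear_order_on_def total_on_def by blast
    moreover have "(y, x) \<notin> list_order ys"
      using prec[of y x] p precedes_trans[OF Z, of x y x] precedes_irrefl[OF Z] by blast
    ultimately show "(x, y) \<in> list_order ys" by blast
  qed (rule prec)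
  show "restr Z (set ys) = ordered_structure ys Q"
  proof (rule rel_structure_eqI)
    fix r
    have "rel Z Less \<inter> lists (set ys) = {[x, y] | x y. (x, y) \<in> list_order ys}"
      unfolding rel_labeled_trees(2)[OF Z] using iff list_order_subset[of ys] by auto
    then show "rel (restr Z (set ys)) r = rel (ordered_structure ys Q) r"
      using s by (cases r) simp_all
  qed simp
qed

section \<open>Standard structures and their relabelling\<close>

definition four_points :: "shape \<Rightarrow> nat \<Rightarrow> nat \<Rightarrow> nat \<Rightarrow> nat \<Rightarrow> (nat, tree_symbol) rel_structure" where
  "four_points \<sigma> a b c d = ordered_structure [a, b, c, d] (shape_quartets \<sigma> a b c d)"

text \<open>Meant for at most three points, where the quartic relation is necessarily empty.\<close>

definition few_points :: "nat list \<Rightarrow> (nat, tree_symbol) rel_structure" where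
  "few_points ys = ordered_structure ys {}"

lemma carrier_points [simp]:
  "carrier (four_points \<sigma> a b c d) = {a, b, c, d}" "carrier (few_points ys) = set ys"
  by (simp_all add: four_points_def few_points_def)

lemma precedes_points [simp]:
  "precedes (four_points \<sigma> a b c d) x y \<longleftrightarrow> (x, y) \<in> list_order [a, b, c, d]"
  "precedes (few_points ys) x y \<longleftrightarrow> (x, y) \<in> list_order ys"
  by (simp_all add: four_points_def few_points_def precedes_def)

lemma four_points_in: "distinct [a, b, c, d] \<Longrightarrow> four_points \<sigma> a b c d \<in> labeled_trees"
  unfolding four_points_def shape_quartets_def
  by (cases \<sigma>) (auto intro!: star_in_labeled_trees quartet_in_labeled_trees)

lemma few_points_in: "distinct ys \<Longrightarrow> ys \<noteq> [] \<Longrightarrow> few_points ys \<in> labeled_trees"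
  unfolding few_points_def by (rule star_in_labeled_trees)

lemma restr_eq_four_points:
  assumes "Z \<in> labeled_trees" "{a, b, c, d} \<subseteq> carrier Z" "distinct [a, b, c, d]"
  shows "restr Z {a, b, c, d} = four_points \<sigma> a b c d \<longleftrightarrow>
    sorted_wrt (precedes Z) [a, b, c, d] \<and> has_shape \<sigma> Z a b c d"
  using restr_eq_ordered_structure_iff[OF assms(1), of "[a, b, c, d]" "shape_quartets \<sigma> a b c d"] assms
    quartic_on_four_points_shape[OF assms(1,2), of \<sigma>]
  unfolding four_points_def by simp

lemma restr_eq_few_points:
  assumes "Z \<in> labeled_trees" "set ys \<subseteq> carrier Z" "distinct ys" "length ys \<le> 3"
  shows "restr Z (set ys) = few_points ys \<longleftrightarrow> sorted_wrt (precedes Z) ys"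
  using restr_eq_ordered_structure_iff[OF assms(1-3), of "{}"] quartic_on_three_points[OF assms(1,4)]
  unfolding few_points_def by simp

lemma has_shape_four_points: 
  assumes "distinct [a, b, c, d]"
  shows "has_shape \<sigma> (four_points \<sigma> a b c d) a b c d"
  using restr_eq_four_points[OF four_points_in[OF assms], of a b c d \<sigma> \<sigma>] assms
    restr_carrier[OF labeled_trees_is_structure[OF four_points_in[OF assms]], of \<sigma>] by simp

abbreviation labeled_tree_cong :: "(((nat, tree_symbol) arrow \<Rightarrow>\<^sub>0 nat) \<Rightarrow>\<^sub>0 int) \<Rightarrow> _ \<Rightarrow> bool" (infix "\<approx>" 50) where
  "p \<approx> q \<equiv> meas_cong labeled_trees p q"

abbreviation ext :: "(nat, tree_symbol) rel_structure \<Rightarrow> _ \<Rightarrow> (((nat, tree_symbol) arrow \<Rightarrow>\<^sub>0 nat) \<Rightarrow>\<^sub>0 int)" where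
  "ext W Z \<equiv> gen (inclusion W Z)"

lemma list_order_map:
  assumes "inj_on f (set xs)" "x \<in> set xs" "y \<in> set xs"
  shows "(f x, f y) \<in> list_order (map f xs) \<longleftrightarrow> (x, y) \<in> list_order xs"
proof -
  have "list_order (map f xs) = map_prod f f ` list_order xs"
    by (induction xs) (auto simp: image_iff)
  moreover have "u = x \<and> v = y" if "(u, v) \<in> list_order xs" "f u = f x" "f v = f y" for u v
    using inj_onD[OF assms(1)] that assms(2,3) list_order_subset[of xs] by auto
  ultimately show ?thesis by auto
qed

lemma rel_ordered_structure_map:
  assumes inj: "inj_on f (set xs)" and sub: "set l \<subseteq> set xs"
    and Q: "\<And>l. set l \<subseteq> set xs \<Longrightarrow> l \<in> Q \<longleftrightarrow> map f l \<in> Q'"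
  shows "l \<in> rel (ordered_structure xs Q) r \<longleftrightarrow> map f l \<in> rel (ordered_structure (map f xs) Q') r"
proof (cases r)
  case Quartic
  then show ?thesis using Q[OF sub] by simp
next
  case Less
  show ?thesis
  proof (cases "\<exists>x y. l = [x, y]")
    case True
    then obtain x y where l: "l = [x, y]" by blast
    then have "x \<in> set xs" "y \<in> set xs" using sub by auto
    then show ?thesis
      using list_order_map[OF inj, of x y] by (simp add: l Less)
  next
    case False
    then show ?thesis by (auto simp: Less map_eq_Cons_conv)
  qed
qed

lemma quartets_map:
  assumes inj: "inj_on f A" and sub: "{a, b, c, d} \<subseteq> A" "set l \<subseteq> A"
  shows "l \<in> quartets a b c d \<longleftrightarrow> map f l \<in> quartets (f a) (f b) (f c) (f d)"
proof (cases "\<exists>p q r s. l = [p, q, r, s]")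
  case True
  then obtain p q r s where l: "l = [p, q, r, s]" by blast
  have "{f x, f y} = {f z, f w} \<longleftrightarrow> {x, y} = {z, w}" if "{x, y, z, w} \<subseteq> A" for x y z w
    using inj_on_image_eq_iff[OF inj, of "{x, y}" "{z, w}"] that by simp
  then show ?thesis using sub by (simp add: l)
next
  case False
  then show ?thesis by (auto simp: quartets_def map_eq_Cons_conv)
qed

lemma relabel_four_points:
  assumes "distinct [a, b, c, d]" "distinct [a', b', c', d']"
  obtains f where "inj_on f {a, b, c, d}" "f a = a'" "f b = b'" "f c = c'" "f d = d'"
    "\<And>l. set l \<subseteq> {a, b, c, d} \<Longrightarrow>
      l \<in> shape_quartets \<sigma> a b c d \<longleftrightarrow> map f l \<in> shape_quartets \<sigma> a' b' c' d'"
proof -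
  define f where "f = (\<lambda>x. if x = a then a' else if x = b then b' else if x = c then c' else d')"
  have f: "f a = a'" "f b = b'" "f c = c'" "f d = d'"
    using assms by (auto simp: f_def)
  have inj: "inj_on f {a, b, c, d}"
    using assms f by (auto simp: inj_on_def)
  show thesis
  proof (rule that[OF inj f])
    fix l assume "set l \<subseteq> {a, b, c, d}"
    then show "l \<in> shape_quartets \<sigma> a b c d \<longleftrightarrow> map f l \<in> shape_quartets \<sigma> a' b' c' d'"
      using quartets_map[OF inj _ _, of _ _ _ _ l] f by (cases \<sigma>) (simp_all add: shape_quartets_def)
  qed
qed

text \<open>The class of such an extension depends only on positions in the order and on the quartic
  tuples, not on the names of the points. This reduces all small extensions to fixed
  numerals.\<close>

lemma relabel_ext:
  assumes xs: "distinct xs" and ys: "set ys \<subseteq> set xs" "distinct ys" "ys \<noteq> []" "length ys \<le> 3"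
    and M: "ordered_structure xs Q \<in> labeled_trees" "ordered_structure (map f xs) Q' \<in> labeled_trees"
    and sorted: "sorted_wrt (\<lambda>x y. (x, y) \<in> list_order xs) ys"
    and inj: "inj_on f (set xs)"
    and Q: "\<And>l. set l \<subseteq> set xs \<Longrightarrow> l \<in> Q \<longleftrightarrow> map f l \<in> Q'"
  shows "ext (few_points ys) (ordered_structure xs Q) \<approx> ext (few_points (map f ys)) (ordered_structure (map f xs) Q')"
proof (rule LT.meas_cong_relabel[where f = f])
  have injy: "inj_on f (set ys)" using inj ys(1) by (rule inj_on_subset)
  have dm: "distinct (map f ys)" using ys(2) injy by (simp add: distinct_map)
  show "few_points ys \<in> labeled_trees" "few_points (map f ys) \<in> labeled_trees"
    using few_points_in[OF ys(2,3)] few_points_in[OF dm] ys(3) by simp_all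
  have prec: "precedes (ordered_structure ws P) = (\<lambda>x y. (x, y) \<in> list_order ws)" for ws :: "nat list" and P
    by (simp add: precedes_def fun_eq_iff)
  have "restr (ordered_structure xs Q) (set ys) = few_points ys"
    using restr_eq_few_points[OF M(1) _ ys(2,4)] ys(1) sorted by (simp add: prec)
  then show "few_points ys = restr (ordered_structure xs Q) (carrier (few_points ys))"
    by simp
  have "sorted_wrt (\<lambda>x y. (f x, f y) \<in> list_order (map f xs)) ys"
    by (rule sorted_wrt_mono_rel[OF _ sorted]) (use list_order_map[OF inj] ys(1) in auto)
  then have "restr (ordered_structure (map f xs) Q') (set (map f ys)) = few_points (map f ys)"
    using restr_eq_few_points[OF M(2) _ dm] ys(1,4) by (simp add: prec sorted_wrt_map image_mono)
  then show "few_points (map f ys) = restr (ordered_structure (map f xs) Q') (carrier (few_points (map f ys)))"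
    by simp
  show "bij_betw f (carrier (ordered_structure xs Q)) (carrier (ordered_structure (map f xs) Q'))"
    using inj by (simp add: bij_betw_def)
  show "l \<in> rel (ordered_structure xs Q) r \<longleftrightarrow> map f l \<in> rel (ordered_structure (map f xs) Q') r"
    if "set l \<subseteq> carrier (ordered_structure xs Q)" for l r
    using rel_ordered_structure_map[OF inj _ Q] that by simp
qed (use M ys in simp_all)

lemma relabel_few_points:
  assumes "distinct xs" "length xs \<le> 3" "distinct zs" "length zs = length xs"
    and "set ys \<subseteq> set xs" "distinct ys" "ys \<noteq> []"
    and "sorted_wrt (\<lambda>x y. (x, y) \<in> list_order xs) ys" "zs = map f xs"
  shows "ext (few_points ys) (few_points xs) \<approx> ext (few_points (map f ys)) (few_points zs)"
proof -
  have "xs \<noteq> []" "length ys \<le> 3"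
    using assms by (auto simp: card_mono distinct_card[symmetric] intro!: order.trans[OF card_mono[of "set xs" "set ys"]])
  moreover have "inj_on f (set xs)"
    using assms by (simp add: distinct_map)
  ultimately show ?thesis
    using assms relabel_ext[of xs ys "{}" f "{}"] few_points_in[of xs] few_points_in[of zs]
    unfolding few_points_def by simp
qed

text \<open>The map \<open>h\<close> of \<open>meas_cong_one_point\<close>, which renames the added
  point \<open>x\<close> to \<open>y\<close>; the summand 1 appears exactly if it is an
  isomorphism.\<close>

definition move :: "'a \<Rightarrow> 'a \<Rightarrow> ('a, 'r) rel_structure \<Rightarrow> ('a, 'r) rel_structure \<Rightarrow> ('a, 'r) arrow" where
  "move x y M N = Arrow M N (\<lambda>z\<in>carrier M. if z = x then y else z)"

lemma one_point_few:
  assumes W: "distinct ws" "ws \<noteq> []" "length ws \<le> 3"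
    and M: "M \<in> labeled_trees" "carrier M = insert x (set ws)" "sorted_wrt (precedes M) ws"
    and N: "N \<in> labeled_trees" "carrier N = insert y (set ws)" "sorted_wrt (precedes N) ws"
    and xy: "x \<notin> set ws" "y \<notin> set ws" "x \<noteq> y"
  shows "ext (few_points ws) M \<approx> (if is_isomorphism (move x y M N) then 1 else 0) +
    (\<Sum>Z | Z \<in> labeled_trees \<and> carrier Z = insert x (insert y (set ws)) \<and>
        restr Z (carrier M) = M \<and> restr Z (carrier N) = N. ext N Z)"
proof -
  have "few_points ws = restr M (carrier (few_points ws))" "few_points ws = restr N (carrier (few_points ws))"
    using restr_eq_few_points[OF M(1) _ W(1,3)] restr_eq_few_points[OF N(1) _ W(1,3)] M N
    by (simp_all add: subset_insertI)
  moreover have "finite {Z \<in> labeled_trees. carrier Z = insert x (insert y (set ws)) \<and>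
        restr Z (carrier M) = M \<and> restr Z (carrier N) = N}"
    by (rule finite_subset[OF _ finite_labeled_trees_on[of "insert x (insert y (set ws))"]]) auto
  ultimately show ?thesis
    using LT.meas_cong_one_point[of M x "few_points ws" N y] M(1,2) N(1,2) xy few_points_in[OF W(1,2)]
    unfolding move_def by simp
qed

text \<open>The index set enters through an equation, so that each use can supply its own
  description of the amalgams.\<close>

lemma one_point_few_sum:
  assumes S: "S = {Z \<in> labeled_trees. carrier Z = insert x (insert y (set ws)) \<and>
        restr Z (carrier M) = M \<and> restr Z (carrier N) = N}"
    and W: "distinct ws" "ws \<noteq> []" "length ws \<le> 3"
    and M: "M \<in> labeled_trees" "carrier M = insert x (set ws)" "sorted_wrt (precedes M) ws"
    and N: "N \<in> labeled_trees" "carrier N = insert y (set ws)" "sorted_wrt (precedes N) ws"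
    and xy: "x \<notin> set ws" "y \<notin> set ws" "x \<noteq> y"
  shows "\<not> is_isomorphism (move x y M N) \<Longrightarrow> ext (few_points ws) M \<approx> (\<Sum>Z\<in>S. ext N Z)"
    and "is_isomorphism (move x y M N) \<Longrightarrow> ext (few_points ws) M \<approx> 1 + (\<Sum>Z\<in>S. ext N Z)"
  using one_point_few[OF W M N xy] by (simp_all add: S)

text \<open>One of two obstructions to identifying the added points: their places in the order
  differ. The other, a difference in shape, is detected with
  \<open>isomorphism_move_shape\<close>.\<close>

lemma not_isomorphism_move:
  assumes "precedes M u v" "u \<in> carrier M" "v \<in> carrier M"
    "\<not> precedes N (if u = x then y else u) (if v = x then y else v)"
  shows "\<not> is_isomorphism (move x y M N)"
proof
  assume "is_isomorphism (move x y M N)"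
  then have "is_embedding (move x y M N)" by (simp add: is_isomorphism_def)
  from embedding_rel[OF this, of "[u, v]" Less] show False
    using assms by (simp add: move_def precedes_def)
qed

lemma isomorphism_move_shape:
  assumes "is_isomorphism (move x y M N)" "{a, b, c, d} \<subseteq> carrier M" "has_shape \<sigma> M a b c d"
  shows "has_shape \<sigma> N (if a = x then y else a) (if b = x then y else b)
    (if c = x then y else c) (if d = x then y else d)"
proof -
  have emb: "is_embedding (move x y M N)" using assms(1) by (simp add: is_isomorphism_def)
  define h where "h = (\<lambda>z. if z = x then y else z)"
  have "quart N (h p) (h q) (h r) (h s) \<longleftrightarrow> quart M p q r s" if "{p, q, r, s} \<subseteq> carrier M" for p q r s
    using embedding_rel[OF emb, of "[p, q, r, s]" Quartic] that
    by (simp add: move_def quart_def h_def)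
  from this[of a b c d] this[of a c b d] this[of a d b c]
  have "has_shape \<sigma> N (h a) (h b) (h c) (h d)"
    using assms(2,3) by (cases \<sigma>) (simp_all add: has_shape_def)
  then show ?thesis by (simp add: h_def)
qed

lemma isomorphism_move:
  assumes "M = ordered_structure xs Q" "N = ordered_structure (map (\<lambda>z. if z = x then y else z) xs) Q'"
    "M \<in> labeled_trees" "N \<in> labeled_trees" "y \<notin> set xs"
    and Q: "\<And>l. set l \<subseteq> set xs \<Longrightarrow> l \<in> Q \<longleftrightarrow> map (\<lambda>z. if z = x then y else z) l \<in> Q'"
  shows "is_isomorphism (move x y M N)"
proof -
  have inj: "inj_on (\<lambda>z. if z = x then y else z) (set xs)"
    using assms(5) by (auto simp: inj_on_def)
  show ?thesis
    unfolding move_def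
  proof (rule is_isomorphismI)
    show "bij_betw (\<lambda>z. if z = x then y else z) (carrier M) (carrier N)"
      using inj by (simp add: assms(1,2) bij_betw_def)
    show "l \<in> rel M r \<longleftrightarrow> map (\<lambda>z. if z = x then y else z) l \<in> rel N r"
      if "set l \<subseteq> carrier M" for l r
      using rel_ordered_structure_map[OF inj _ Q, of l r] that unfolding assms(1,2) by simp
  qed (use assms(3,4) labeled_trees_is_structure in blast)+
qed

lemma ext_closed:
  assumes "W \<in> labeled_trees" "Z \<in> labeled_trees" "restr Z (carrier W) = W" "carrier W \<subseteq> carrier Z"
  shows "ext W Z \<in> carrier (free_cring (embeddings labeled_trees))"
  using assms by (intro free_cring_closed(5) LT.inclusion_in_embeddings) auto

lemma ext_trans:
  assumes "M \<in> labeled_trees" "Z \<in> labeled_trees" "W \<in> labeled_trees" "carrier W \<subseteq> carrier M"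
    "carrier M \<subseteq> carrier Z" "restr Z (carrier M) = M" "restr M (carrier W) = W"
  shows "ext W Z \<approx> ext M Z * ext W M"
  using assms by (intro LT.meas_cong_inclusion_trans) auto

section \<open>Classes of extensions to three and four points\<close>

definition mid :: "((nat, tree_symbol) arrow \<Rightarrow>\<^sub>0 nat) \<Rightarrow>\<^sub>0 int" where
  "mid = ext (few_points [2, 4]) (few_points [2, 3, 4])"

text \<open>The second point is the added one; by \<open>val_remove_third\<close>, adding the third
  point has the same class. The numerals are mere labels, as \<open>val_remove_second\<close>
  shows.\<close>

definition val :: "shape \<Rightarrow> ((nat, tree_symbol) arrow \<Rightarrow>\<^sub>0 nat) \<Rightarrow>\<^sub>0 int" where
  "val \<sigma> = ext (few_points [2, 4, 5]) (four_points \<sigma> 2 3 4 5)"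

lemma mid_any:
  assumes "distinct [a, b, c]"
  shows "ext (few_points [a, c]) (few_points [a, b, c]) \<approx> mid"
proof -
  define f where "f = (\<lambda>x::nat. if x = a then 2 else if x = b then 3 else 4 :: nat)"
  have f: "map f [a, b, c] = [2, 3, 4]" "map f [a, c] = [2, 4]"
    using assms by (auto simp: f_def)
  have "ext (few_points [a, c]) (few_points [a, b, c]) \<approx> ext (few_points (map f [a, c])) (few_points [2, 3, 4])"
    by (rule relabel_few_points) (use assms f(1) in auto)
  then show ?thesis
    unfolding f(2) mid_def .
qed

text \<open>\<open>?p\<close> adds a point 3 below 0. Relative to a point 2 above 0 its position is
  forced; relative to a point 2 below 0 it lies below 2, at 2, or between 2 and 0. The terms for
  lying below both points agree and cancel.\<close>

lemma mid_eq: "0 \<approx> 1 + mid"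
proof -
  let ?p = "ext (few_points [0]) (few_points [3, 0])"
  let ?l = "ext (few_points [2, 0]) (few_points [3, 2, 0])"
  have points: "few_points xs \<in> labeled_trees" if "xs \<in> {[0], [3, 0], [0, 2], [2, 0], [3, 0, 2], [3, 2, 0], [2, 3, 0]}"
    for xs :: "nat list"
    using that by (intro few_points_in) auto
  have few: "Z = few_points ys \<longleftrightarrow> Z \<in> labeled_trees \<and> carrier Z = set ys \<and> sorted_wrt (precedes Z) ys"
    if "distinct ys" "length ys = 3" for Z ys
  proof
    assume "Z = few_points ys"
    moreover have "few_points ys \<in> labeled_trees" using that by (intro few_points_in) auto
    moreover have "restr (few_points ys) (set ys) = few_points ys"
      using restr_carrier[OF labeled_trees_is_structure[OF \<open>few_points ys \<in> labeled_trees\<close>]] by simp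
    ultimately show "Z \<in> labeled_trees \<and> carrier Z = set ys \<and> sorted_wrt (precedes Z) ys"
      using restr_eq_few_points[of "few_points ys" ys] that by simp
  next
    assume Z: "Z \<in> labeled_trees \<and> carrier Z = set ys \<and> sorted_wrt (precedes Z) ys"
    then show "Z = few_points ys"
      using restr_eq_few_points[of Z ys] that restr_carrier[OF labeled_trees_is_structure, of Z] by simp
  qed
  have restr2: "restr Z {u, v} = few_points [u, v] \<longleftrightarrow> precedes Z u v"
    if "Z \<in> labeled_trees" "u \<in> carrier Z" "v \<in> carrier Z" "u \<noteq> v" for Z u v
    using restr_eq_few_points[of Z "[u, v]"] that by simp
  have L: "?p \<approx> ?l"
  proof -
    have "\<not> is_isomorphism (move 3 2 (few_points [3, 0]) (few_points [0, 2]))"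
      by (rule not_isomorphism_move[of _ 3 0]) auto
    moreover have "{few_points [3, 0, 2]} = {Z \<in> labeled_trees. carrier Z = insert 3 (insert 2 (set [0])) \<and>
        restr Z (carrier (few_points [3, 0])) = few_points [3, 0] \<and>
        restr Z (carrier (few_points [0, 2])) = few_points [0, 2]}" (is "_ = ?S")
    proof -
      have "Z \<in> ?S \<longleftrightarrow> Z = few_points [3, 0, 2]" for Z
        unfolding few[of "[3, 0, 2]", simplified] using restr2[of Z 3 0] restr2[of Z 0 2] precedes_trans[of Z 3 0 2]
        by auto
      then show ?thesis by blast
    qed
    ultimately have "?p \<approx> (\<Sum>Z\<in>{few_points [3, 0, 2]}. ext (few_points [0, 2]) Z)"
      by (intro one_point_few_sum(1)) (use points in auto)
    also have "\<dots> = ext (few_points [0, 2]) (few_points [3, 0, 2])" by simp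
    \<comment> \<open>Exchanging the names 0 and 2 turns the chain 3, 0, 2 into 3, 2, 0, the form
      that occurs in the other expansion of \<open>?p\<close>.\<close>
    also have "\<dots> \<approx> ext (few_points (map (\<lambda>x. if x = 0 then 2 else if x = 2 then 0 else x) [0, 2])) (few_points [3, 2, 0])"
      by (rule relabel_few_points) auto
    finally show ?thesis by simp
  qed
  have "?p \<approx> 1 + (?l + mid)"
  proof -
    have "is_isomorphism (move 3 2 (few_points [3, 0]) (few_points [2, 0]))"
      using points by (intro isomorphism_move[of _ "[3, 0]" "{}" _ _ _ "{}"]) (auto simp: few_points_def)
    moreover have "{few_points [3, 2, 0], few_points [2, 3, 0]} =
        {Z \<in> labeled_trees. carrier Z = insert 3 (insert 2 (set [0])) \<and>
        restr Z (carrier (few_points [3, 0])) = few_points [3, 0] \<and>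
        restr Z (carrier (few_points [2, 0])) = few_points [2, 0]}" (is "_ = ?S")
    proof -
      have "Z \<in> ?S \<longleftrightarrow> Z = few_points [3, 2, 0] \<or> Z = few_points [2, 3, 0]" for Z
        unfolding few[of "[3, 2, 0]", simplified] few[of "[2, 3, 0]", simplified]
        using restr2[of Z 3 0] restr2[of Z 2 0] precedes_total[of Z 3 2]
        by auto
      then show ?thesis by blast
    qed
    ultimately have "?p \<approx> 1 + (\<Sum>Z\<in>{few_points [3, 2, 0], few_points [2, 3, 0]}. ext (few_points [2, 0]) Z)"
      by (intro one_point_few_sum(2)) (use points in auto)
    also have "few_points [3, 2, 0] \<noteq> few_points [2, 3, 0]"
    proof
      assume eq: "few_points [3, 2, 0] = few_points [2, 3, 0]"
      have "precedes (few_points [3, 2, 0]) 3 2" by simp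
      then show False unfolding eq by simp
    qed
    then have "(\<Sum>Z\<in>{few_points [3, 2, 0], few_points [2, 3, 0]}. ext (few_points [2, 0]) Z) =
        ?l + ext (few_points [2, 0]) (few_points [2, 3, 0])"
      by simp
    also have "1 + \<dots> \<approx> 1 + (?l + mid)"
    proof (intro meas_cong_add meas_cong_refl mid_any)
      show "?l \<in> carrier (free_cring (embeddings labeled_trees))"
        using L by (simp add: meas_cong_def)
    qed (simp_all add: free_cring_closed)
    finally show ?thesis .
  qed
  from meas_cong_trans[OF meas_cong_sym[OF L] this]
  have "?l - (1 + (?l + mid)) \<in> meas_ideal labeled_trees"
    by (simp add: meas_cong_def)
  moreover have "mid \<in> carrier (free_cring (embeddings labeled_trees))"
    using mid_any[of 0 1 2] by (simp add: meas_cong_def)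
  ultimately show ?thesis
    by (simp add: meas_cong_def free_cring_closed)
qed

lemma val_remove_second:
  assumes "distinct [a, b, c, d]"
  shows "ext (few_points [a, c, d]) (four_points \<sigma> a b c d) \<approx> val \<sigma>"
proof -
  obtain f :: "nat \<Rightarrow> nat" where inj: "inj_on f {a, b, c, d}" and f: "f a = 2" "f b = 3" "f c = 4" "f d = 5"
    and Q: "\<And>l. set l \<subseteq> {a, b, c, d} \<Longrightarrow>
      l \<in> shape_quartets \<sigma> a b c d \<longleftrightarrow> map f l \<in> shape_quartets \<sigma> 2 3 4 5"
    by (rule relabel_four_points[OF assms, of "2::nat" 3 4 5 \<sigma>]) (simp, rule that)
  have map: "map f [a, b, c, d] = [2, 3, 4, 5]" "map f [a, c, d] = [2, 4, 5]"
    using f by simp_all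
  have "ext (few_points [a, c, d]) (ordered_structure [a, b, c, d] (shape_quartets \<sigma> a b c d)) \<approx>
      ext (few_points (map f [a, c, d]))
        (ordered_structure (map f [a, b, c, d]) (shape_quartets \<sigma> 2 3 4 5))"
  proof (rule relabel_ext)
    show "ordered_structure [a, b, c, d] (shape_quartets \<sigma> a b c d) \<in> labeled_trees"
      using four_points_in[OF assms] by (simp add: four_points_def)
    show "ordered_structure (map f [a, b, c, d]) (shape_quartets \<sigma> 2 3 4 5) \<in> labeled_trees"
      using four_points_in[of 2 3 4 5 \<sigma>] unfolding map four_points_def by simp
  qed (use assms inj Q in auto)
  then show ?thesis
    unfolding map val_def four_points_def .
qed

text \<open>After multiplication by \<open>mid\<close> both sides equal the class of adding
  \<open>b\<close> and \<open>c\<close> to \<open>a\<close> and \<open>d\<close>, in either order.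
  The factor \<open>mid\<close> can be cancelled since it is -1 in the measure ring.\<close>

lemma val_remove_third:
  assumes "distinct [a, b, c, d]"
  shows "ext (few_points [a, b, d]) (four_points \<sigma> a b c d) \<approx> val \<sigma>"
proof -
  let ?Z = "four_points \<sigma> a b c d"
  have Z: "?Z \<in> labeled_trees" by (rule four_points_in[OF assms])
  have few: "few_points [a, b, d] \<in> labeled_trees" "few_points [a, c, d] \<in> labeled_trees"
    "few_points [a, d] \<in> labeled_trees"
    using assms by (auto intro!: few_points_in)
  have restr: "restr ?Z (set [a, b, d]) = few_points [a, b, d]" "restr ?Z (set [a, c, d]) = few_points [a, c, d]"
    using assms by (subst restr_eq_few_points[OF Z]; auto)+
  have restr2: "restr (few_points [a, b, d]) (set [a, d]) = few_points [a, d]"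
    "restr (few_points [a, c, d]) (set [a, d]) = few_points [a, d]"
    using assms by (subst restr_eq_few_points[OF few(1)]; auto) (use assms in \<open>subst restr_eq_few_points[OF few(2)]; auto\<close>)
  have b: "ext (few_points [a, d]) ?Z \<approx> ext (few_points [a, b, d]) ?Z * ext (few_points [a, d]) (few_points [a, b, d])"
    using restr restr2 by (intro ext_trans Z few) auto
  have c: "ext (few_points [a, d]) ?Z \<approx> ext (few_points [a, c, d]) ?Z * ext (few_points [a, d]) (few_points [a, c, d])"
    using restr restr2 by (intro ext_trans Z few) auto
  have m: "ext (few_points [a, d]) (few_points [a, b, d]) \<approx> mid" "ext (few_points [a, d]) (few_points [a, c, d]) \<approx> mid"
    using assms by (auto intro!: mid_any)
  let ?b = "ext (few_points [a, b, d]) ?Z"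
  let ?C = "carrier (free_cring (embeddings labeled_trees))"
  have bC: "?b \<in> ?C"
    using restr by (intro ext_closed Z few) auto
  have vC: "val \<sigma> \<in> ?C"
    using val_remove_second[OF assms, of \<sigma>] by (simp add: meas_cong_def)
  have "?b * mid \<approx> val \<sigma> * mid"
  proof -
    have "?b * mid \<approx> ext (few_points [a, d]) ?Z"
      by (rule meas_cong_sym[OF meas_cong_trans[OF b meas_cong_mult[OF meas_cong_refl[OF bC] m(1)]]])
    also have "\<dots> \<approx> val \<sigma> * mid"
      by (rule meas_cong_trans[OF c meas_cong_mult[OF val_remove_second[OF assms] m(2)]])
    finally show ?thesis .
  qed
  then have "?b * mid - val \<sigma> * mid \<in> meas_ideal labeled_trees" by (simp add: meas_cong_def)
  moreover have "(?b - val \<sigma>) * (0 - (1 + mid)) \<in> meas_ideal labeled_trees"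
  proof (rule meas_ideal_closed(4))
    show "0 - (1 + mid) \<in> meas_ideal labeled_trees"
      using mid_eq by (simp add: meas_cong_def)
    show "?b - val \<sigma> \<in> ?C"
      using free_cring_closed(3)[OF bC free_cring_uminus(1)[OF vC]] by simp
  qed
  \<comment> \<open>Cancellation of \<open>mid\<close> inside the ideal: the difference D of the two
    sides is \<open>- (D * mid + D * (- 1 - mid))\<close>, and both summands lie in the
    ideal.\<close>
  ultimately have "- ((?b * mid - val \<sigma> * mid) + (?b - val \<sigma>) * (0 - (1 + mid))) \<in> meas_ideal labeled_trees"
    by (rule meas_ideal_closed(3)[OF meas_ideal_closed(2)])
  moreover have "- ((?b * mid - val \<sigma> * mid) + (?b - val \<sigma>) * (0 - (1 + mid))) = ?b - val \<sigma>"
    by (simp add: algebra_simps)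
  ultimately show ?thesis
    using bC vC by (simp add: meas_cong_def)
qed

text \<open>The point 3 between 2 and 4 is compared with a point 0 below both. The order 0, 2, 3, 4
  is forced and only the shape varies. As 3 is the third of the four points,
  \<open>val_remove_third\<close> evaluates the terms.\<close>

lemma mid_eq_sum_val: "mid \<approx> val Star + (val AB + (val AC + val AD))"
proof -
  let ?f = "\<lambda>\<sigma>. four_points \<sigma> 0 2 3 4"
  have Z: "?f \<sigma> \<in> labeled_trees" for \<sigma> by (rule four_points_in) simp
  have few: "few_points [2, 3, 4] \<in> labeled_trees" "few_points [0, 2, 4] \<in> labeled_trees"
    by (auto intro!: few_points_in)
  have shape: "has_shape \<sigma> (?f \<sigma>) 0 2 3 4" for \<sigma> by (rule has_shape_four_points) simp
  have inj: "inj ?f"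
  proof (rule injI)
    fix \<sigma> \<tau> assume eq: "?f \<sigma> = ?f \<tau>"
    show "\<sigma> = \<tau>"
      by (rule has_shape_unique[OF Z shape]) (simp only: eq shape)
  qed
  have "\<not> is_isomorphism (move 3 0 (few_points [2, 3, 4]) (few_points [0, 2, 4]))"
    by (rule not_isomorphism_move[of _ 2 3]) auto
  moreover have "range ?f = {Z \<in> labeled_trees. carrier Z = insert 3 (insert 0 (set [2, 4])) \<and>
        restr Z (carrier (few_points [2, 3, 4])) = few_points [2, 3, 4] \<and>
        restr Z (carrier (few_points [0, 2, 4])) = few_points [0, 2, 4]}" (is "_ = ?S")
  proof (intro equalityI subsetI)
    fix M assume "M \<in> range ?f"
    then obtain \<sigma> where M: "M = ?f \<sigma>" by blast
    have "restr M (set [2, 3, 4]) = few_points [2, 3, 4]" "restr M (set [0, 2, 4]) = few_points [0, 2, 4]"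
      unfolding M by (subst restr_eq_few_points[OF Z]; auto)+
    then show "M \<in> ?S" using Z M by auto
  next
    fix M assume "M \<in> ?S"
    then have M: "M \<in> labeled_trees" "carrier M = {0, 2, 3, 4}"
      "restr M (set [2, 3, 4]) = few_points [2, 3, 4]" "restr M (set [0, 2, 4]) = few_points [0, 2, 4]"
      by auto
    obtain \<sigma> where \<sigma>: "has_shape \<sigma> M 0 2 3 4" using ex_has_shape[of M 0 2 3 4] ..
    have "sorted_wrt (precedes M) [2, 3, 4]" "sorted_wrt (precedes M) [0, 2, 4]"
      using M restr_eq_few_points[OF M(1), of "[2, 3, 4]"] restr_eq_few_points[OF M(1), of "[0, 2, 4]"] by auto
    then have "sorted_wrt (precedes M) [0, 2, 3, 4]"
      using precedes_trans[OF M(1), of 0 2 3] by auto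
    then have "restr M {0, 2, 3, 4} = ?f \<sigma>"
      using restr_eq_four_points[OF M(1), of 0 2 3 4 \<sigma>] M(2) \<sigma> by simp
    then show "M \<in> range ?f"
      using restr_carrier[OF labeled_trees_is_structure[OF M(1)]] M(2) by (metis rangeI)
  qed
  ultimately have "ext (few_points [2, 4]) (few_points [2, 3, 4]) \<approx> (\<Sum>Z\<in>range ?f. ext (few_points [0, 2, 4]) Z)"
    by (intro one_point_few_sum(1)) (use few in auto)
  also have "(\<Sum>Z\<in>range ?f. ext (few_points [0, 2, 4]) Z) = (\<Sum>\<sigma>\<in>UNIV. ext (few_points [0, 2, 4]) (?f \<sigma>))"
    by (simp add: sum.reindex[OF inj])
  also have "(UNIV :: shape set) = {Star, AB, AC, AD}"
    using shape.exhaust by blast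
  also have "(\<Sum>\<sigma>\<in>\<dots>. ext (few_points [0, 2, 4]) (?f \<sigma>)) \<approx> (\<Sum>\<sigma>\<in>{Star, AB, AC, AD}. val \<sigma>)"
    by (intro meas_cong_sum val_remove_third) simp
  finally show ?thesis
    unfolding mid_def[symmetric] by simp
qed

section \<open>Linear relations from five points\<close>

definition chain_structures :: "nat list \<Rightarrow> ((nat, tree_symbol) rel_structure \<Rightarrow> bool) \<Rightarrow> (nat, tree_symbol) rel_structure set" where
  "chain_structures xs P = {Z \<in> labeled_trees. carrier Z = set xs \<and> sorted_wrt (precedes Z) xs \<and> P Z}"

lemma finite_chain_structures: "finite (chain_structures xs P)"
  by (rule finite_subset[OF _ finite_labeled_trees_on[of "set xs"]]) (auto simp: chain_structures_def)

lemma val_closed: "val \<sigma> \<in> carrier (free_cring (embeddings labeled_trees))"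
  using val_remove_second[of 0 1 2 3 \<sigma>] by (simp add: meas_cong_def)

text \<open>An edge separates \<open>c\<close> and \<open>d\<close> from \<open>a\<close> and
  \<open>b\<close>, so both leave the path from \<open>a\<close> to \<open>b\<close> at the same
  vertex, and the splits of a further point with \<open>a\<close> and \<open>b\<close> do not
  distinguish them.\<close>

lemma quart_transfer:
  assumes Z: "Z \<in> labeled_trees" and q: "quart Z a b c d" and x: "x \<noteq> c" "x \<noteq> d"
  shows "quart Z a x b c \<longleftrightarrow> quart Z a x b d" "quart Z a b c x \<longleftrightarrow> quart Z a b d x"
proof -
  have q': "quart Z a b d c" using q quart_iff(3)[OF Z] by blast
  show "quart Z a x b c \<longleftrightarrow> quart Z a x b d"
    using quart_shift[OF Z q, of x] quart_shift[OF Z q', of x] x by blast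
  show "quart Z a b c x \<longleftrightarrow> quart Z a b d x"
    using quart_trans[OF Z q, of x] quart_trans[OF Z q', of x] x by blast
qed

text \<open>A point 6 is added between 2 and 4 to \<open>?N\<close>, whose tree is 24|35. Without 3
  there is one gap between 2 and 4; without 5 there are two gaps, on either side of 3. By
  \<open>shapes\<close> both descriptions select the same five-point structures. For the shape
  \<open>AC\<close> the point 6 could coincide with 3, which would add a summand 1.\<close>

lemma val_gap:
  assumes shapes: "\<And>Z. Z \<in> labeled_trees \<Longrightarrow> quart Z 2 4 3 5 \<Longrightarrow>
      (has_shape \<tau>\<^sub>1 Z 2 6 3 4 \<longleftrightarrow> has_shape \<tau> Z 2 6 4 5) \<and>
      (has_shape \<tau>\<^sub>2 Z 2 3 6 4 \<longleftrightarrow> has_shape \<tau> Z 2 6 4 5)"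
    and "\<tau> \<noteq> AC"
  shows "val \<tau> \<approx> val \<tau>\<^sub>1 + val \<tau>\<^sub>2"
proof -
  let ?N = "four_points AC 2 3 4 5"
  let ?P = "\<lambda>Z. quart Z 2 4 3 5 \<and> has_shape \<tau> Z 2 6 4 5"
  let ?S\<^sub>1 = "chain_structures [2, 6, 3, 4, 5] ?P"
  let ?S\<^sub>2 = "chain_structures [2, 3, 6, 4, 5] ?P"
  have N: "?N \<in> labeled_trees" by (rule four_points_in) simp
  have M: "four_points \<sigma> 2 6 3 4 \<in> labeled_trees" "four_points \<sigma> 2 3 6 4 \<in> labeled_trees"
    "four_points \<sigma> 2 6 4 5 \<in> labeled_trees" for \<sigma>
    by (rule four_points_in; simp)+
  have restr: "restr Z {2, 3, 4, 5} = ?N \<longleftrightarrow> sorted_wrt (precedes Z) [2, 3, 4, 5] \<and> quart Z 2 4 3 5"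
    "restr Z {2, 6, 3, 4} = four_points \<sigma> 2 6 3 4 \<longleftrightarrow> sorted_wrt (precedes Z) [2, 6, 3, 4] \<and> has_shape \<sigma> Z 2 6 3 4"
    "restr Z {2, 3, 6, 4} = four_points \<sigma> 2 3 6 4 \<longleftrightarrow> sorted_wrt (precedes Z) [2, 3, 6, 4] \<and> has_shape \<sigma> Z 2 3 6 4"
    "restr Z {2, 6, 4, 5} = four_points \<sigma> 2 6 4 5 \<longleftrightarrow> sorted_wrt (precedes Z) [2, 6, 4, 5] \<and> has_shape \<sigma> Z 2 6 4 5"
    if "Z \<in> labeled_trees" "carrier Z = {2, 3, 4, 5, 6}" for Z \<sigma>
    using restr_eq_four_points[OF that(1), of 2 3 4 5 AC] restr_eq_four_points[OF that(1), of 2 6 3 4 \<sigma>]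
      restr_eq_four_points[OF that(1), of 2 3 6 4 \<sigma>] restr_eq_four_points[OF that(1), of 2 6 4 5 \<sigma>] that(2)
    by (simp_all add: has_shape_def)
  have perm: "insert 6 (insert 5 (set [2, 3, 4])) = {2, 3, 4, 5, 6 :: nat}"
    "insert 6 (insert 3 (set [2, 4, 5])) = {2, 3, 4, 5, 6 :: nat}"
    "set [2, 6, 3, 4, 5] = {2, 3, 4, 5, 6 :: nat}" "set [2, 3, 6, 4, 5] = {2, 3, 4, 5, 6 :: nat}"
    by auto
  have "val \<tau>\<^sub>1 \<approx> (\<Sum>Z\<in>?S\<^sub>1. ext ?N Z)"
  proof -
    have "\<not> is_isomorphism (move 6 5 (four_points \<tau>\<^sub>1 2 6 3 4) ?N)"
      by (rule not_isomorphism_move[of _ 6 3]) auto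
    moreover have "?S\<^sub>1 = {Z \<in> labeled_trees. carrier Z = insert 6 (insert 5 (set [2, 3, 4])) \<and>
        restr Z (carrier (four_points \<tau>\<^sub>1 2 6 3 4)) = four_points \<tau>\<^sub>1 2 6 3 4 \<and> restr Z (carrier ?N) = ?N}"
      unfolding perm chain_structures_def
    proof (rule Collect_cong, rule conj_cong[OF refl], rule conj_cong[OF refl])
      fix Z :: "(nat, tree_symbol) rel_structure"
      assume Z: "Z \<in> labeled_trees" "carrier Z = {2, 3, 4, 5, 6}"
      have "precedes Z 6 5" if "precedes Z 6 4" "precedes Z 4 5"
        using precedes_trans[OF Z(1) that] .
      then show "(sorted_wrt (precedes Z) [2, 6, 3, 4, 5] \<and> ?P Z) =
          (restr Z (carrier (four_points \<tau>\<^sub>1 2 6 3 4)) = four_points \<tau>\<^sub>1 2 6 3 4 \<and> restr Z (carrier ?N) = ?N)"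
        using shapes[OF Z(1)] unfolding carrier_points restr[OF Z] by auto
    qed
    ultimately have "ext (few_points [2, 3, 4]) (four_points \<tau>\<^sub>1 2 6 3 4) \<approx> (\<Sum>Z\<in>?S\<^sub>1. ext ?N Z)"
      by (intro one_point_few_sum(1)) (use N M in auto)
    then show ?thesis
      using meas_cong_trans[OF meas_cong_sym[OF val_remove_second[of 2 6 3 4 \<tau>\<^sub>1]]] by simp
  qed
  moreover have "val \<tau>\<^sub>2 \<approx> (\<Sum>Z\<in>?S\<^sub>2. ext ?N Z)"
  proof -
    have "\<not> is_isomorphism (move 6 5 (four_points \<tau>\<^sub>2 2 3 6 4) ?N)"
      by (rule not_isomorphism_move[of _ 6 4]) auto
    moreover have "?S\<^sub>2 = {Z \<in> labeled_trees. carrier Z = insert 6 (insert 5 (set [2, 3, 4])) \<and>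
        restr Z (carrier (four_points \<tau>\<^sub>2 2 3 6 4)) = four_points \<tau>\<^sub>2 2 3 6 4 \<and> restr Z (carrier ?N) = ?N}"
      unfolding perm chain_structures_def
    proof (rule Collect_cong, rule conj_cong[OF refl], rule conj_cong[OF refl])
      fix Z :: "(nat, tree_symbol) rel_structure"
      assume Z: "Z \<in> labeled_trees" "carrier Z = {2, 3, 4, 5, 6}"
      have "precedes Z 6 5" if "precedes Z 6 4" "precedes Z 4 5"
        using precedes_trans[OF Z(1) that] .
      then show "(sorted_wrt (precedes Z) [2, 3, 6, 4, 5] \<and> ?P Z) =
          (restr Z (carrier (four_points \<tau>\<^sub>2 2 3 6 4)) = four_points \<tau>\<^sub>2 2 3 6 4 \<and> restr Z (carrier ?N) = ?N)"
        using shapes[OF Z(1)] unfolding carrier_points restr[OF Z] by auto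
    qed
    ultimately have "ext (few_points [2, 3, 4]) (four_points \<tau>\<^sub>2 2 3 6 4) \<approx> (\<Sum>Z\<in>?S\<^sub>2. ext ?N Z)"
      by (intro one_point_few_sum(1)) (use N M in auto)
    then show ?thesis
      using meas_cong_trans[OF meas_cong_sym[OF val_remove_third[of 2 3 6 4 \<tau>\<^sub>2]]] by simp
  qed
  moreover have "val \<tau> \<approx> (\<Sum>Z\<in>?S\<^sub>1 \<union> ?S\<^sub>2. ext ?N Z)"
  proof -
    have "\<not> is_isomorphism (move 6 3 (four_points \<tau> 2 6 4 5) ?N)"
    proof
      assume "is_isomorphism (move 6 3 (four_points \<tau> 2 6 4 5) ?N)"
      from isomorphism_move_shape[OF this, of 2 6 4 5 \<tau>] has_shape_four_points[of 2 6 4 5 \<tau>]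
      have "has_shape \<tau> ?N 2 3 4 5" by simp
      then show False
        using has_shape_unique[OF N _ has_shape_four_points[of 2 3 4 5 AC]] \<open>\<tau> \<noteq> AC\<close> by simp
    qed
    moreover have "?S\<^sub>1 \<union> ?S\<^sub>2 = {Z \<in> labeled_trees. carrier Z = insert 6 (insert 3 (set [2, 4, 5])) \<and>
        restr Z (carrier (four_points \<tau> 2 6 4 5)) = four_points \<tau> 2 6 4 5 \<and> restr Z (carrier ?N) = ?N}"
      unfolding perm chain_structures_def Collect_disj_eq[symmetric] conj_disj_distribL[symmetric]
    proof (rule Collect_cong, rule conj_cong[OF refl], rule conj_cong[OF refl])
      fix Z :: "(nat, tree_symbol) rel_structure"
      assume Z: "Z \<in> labeled_trees" "carrier Z = {2, 3, 4, 5, 6}"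
      \<comment> \<open>The two restrictions leave the order of 6 and 3 open; its two possibilities
        are the index sets \<open>?S\<^sub>1\<close> and \<open>?S\<^sub>2\<close>.\<close>
      have "precedes Z 6 3 \<or> precedes Z 3 6"
        using precedes_total[OF Z(1)] Z(2) by simp
      then show "(sorted_wrt (precedes Z) [2, 6, 3, 4, 5] \<and> ?P Z \<or> sorted_wrt (precedes Z) [2, 3, 6, 4, 5] \<and> ?P Z) =
          (restr Z (carrier (four_points \<tau> 2 6 4 5)) = four_points \<tau> 2 6 4 5 \<and> restr Z (carrier ?N) = ?N)"
        unfolding carrier_points restr[OF Z] by auto
    qed
    ultimately have "ext (few_points [2, 4, 5]) (four_points \<tau> 2 6 4 5) \<approx> (\<Sum>Z\<in>?S\<^sub>1 \<union> ?S\<^sub>2. ext ?N Z)"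
      by (intro one_point_few_sum(1)) (use N M in auto)
    then show ?thesis
      using meas_cong_trans[OF meas_cong_sym[OF val_remove_second[of 2 6 4 5 \<tau>]]] by simp
  qed
  moreover have "(\<Sum>Z\<in>?S\<^sub>1 \<union> ?S\<^sub>2. ext ?N Z) = (\<Sum>Z\<in>?S\<^sub>1. ext ?N Z) + (\<Sum>Z\<in>?S\<^sub>2. ext ?N Z)"
  proof (rule sum.union_disjoint[OF finite_chain_structures finite_chain_structures])
    have False if "Z \<in> ?S\<^sub>1" "Z \<in> ?S\<^sub>2" for Z
    proof -
      have "Z \<in> labeled_trees" "precedes Z 6 3" "precedes Z 3 6"
        using that by (simp_all add: chain_structures_def)
      then show False
        using precedes_trans[of Z 6 3 6] precedes_irrefl[of Z 6] by blast
    qed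
    then show "?S\<^sub>1 \<inter> ?S\<^sub>2 = {}" by blast
  qed
  ultimately show ?thesis
    using meas_cong_trans[OF _ meas_cong_sym[OF meas_cong_add]] by simp
qed

text \<open>Given 24|35, the points 3 and 5 look alike from 2, 4 and 6, so 5 may be replaced by 3
  and only the order of the names changes. Thus 26|45 becomes 26|34, which is \<open>AB\<close> in
  the list 2, 6, 3, 4 and \<open>AC\<close> in 2, 3, 6, 4; and 25|46 becomes 23|46, which is
  \<open>AC\<close> and \<open>AB\<close> respectively.\<close>

lemma val_relations:
  "val Star \<approx> val Star + val Star" "val AB \<approx> val AB + val AC" "val AD \<approx> val AC + val AB"
proof -
  have eqs: "quart Z 2 6 3 4 \<longleftrightarrow> quart Z 2 6 4 5" "quart Z 2 3 6 4 \<longleftrightarrow> quart Z 2 5 6 4"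
    "quart Z 2 4 6 3 \<longleftrightarrow> quart Z 2 4 6 5"
    if Z: "Z \<in> labeled_trees" and q: "quart Z 2 4 3 5" for Z
  proof -
    note sw = quart_iff[OF Z]
    have q': "quart Z 4 2 3 5" using q sw(1) by blast
    show "quart Z 2 6 3 4 \<longleftrightarrow> quart Z 2 6 4 5"
      using quart_transfer(1)[OF Z q, of 6] sw(3)[of 2 6 4 3] by simp
    show "quart Z 2 4 6 3 \<longleftrightarrow> quart Z 2 4 6 5"
      using quart_transfer(2)[OF Z q, of 6] sw(3)[of 2 4 6 3] sw(3)[of 2 4 6 5] by simp
    have "quart Z 4 6 2 3 \<longleftrightarrow> quart Z 4 6 2 5"
      using quart_transfer(1)[OF Z q', of 6] by simp
    moreover have "quart Z 4 6 2 s \<longleftrightarrow> quart Z 2 s 6 4" for s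
      using sw(2)[of 4 6 2 s] sw(3)[of 2 s 6 4] by simp
    ultimately show "quart Z 2 3 6 4 \<longleftrightarrow> quart Z 2 5 6 4" by simp
  qed
  have flip: "quart Z a c d b \<longleftrightarrow> quart Z a c b d" if "Z \<in> labeled_trees" for Z a b c d
    using quart_iff(3)[OF that] by blast
  show "val Star \<approx> val Star + val Star"
    by (rule val_gap) (use eqs flip in \<open>auto simp: has_shape_def\<close>)
  show "val AB \<approx> val AB + val AC"
    by (rule val_gap) (use eqs flip in \<open>auto simp: has_shape_def\<close>)
  show "val AD \<approx> val AC + val AB"
    by (rule val_gap) (use eqs flip in \<open>auto simp: has_shape_def\<close>)
qed

section \<open>Points equivalent with respect to a fixed pair\<close>

abbreviation branch :: "nat \<Rightarrow> nat \<Rightarrow> nat \<Rightarrow> nat \<Rightarrow> nat \<Rightarrow> (nat, tree_symbol) rel_structure set" where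
  "branch a b c d e \<equiv> chain_structures [a, b, c, d, e] (\<lambda>Z. quart Z a e b c \<and> quart Z a e c d)"

text \<open>The inclusion is factored by adding \<open>c\<close>, then \<open>b\<close>, then the
  rest of \<open>Z\<close>. The last factor is left unevaluated, since it is the one over which
  amalgamation sums run.\<close>

lemma ext_branch:
  assumes dist: "distinct [a, b, c, e]" and Z: "Z \<in> labeled_trees" "{a, b, c, e} \<subseteq> carrier Z"
    "sorted_wrt (precedes Z) [a, b, c, e]" "quart Z a e b c"
  shows "ext (few_points [a, e]) Z \<approx> ext (four_points AD a b c e) Z * (val AD * mid)"
proof -
  let ?N = "four_points AD a b c e"
  have N: "?N \<in> labeled_trees" by (rule four_points_in[OF dist])
  have few: "few_points [a, e] \<in> labeled_trees" "few_points [a, c, e] \<in> labeled_trees"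
    using dist by (auto intro!: few_points_in)
  have NZ: "restr Z (carrier ?N) = ?N"
    using restr_eq_four_points[OF Z(1,2) dist, of AD] Z(3,4) by (simp add: has_shape_def)
  have WN: "restr ?N (set [a, e]) = few_points [a, e]" "restr ?N (set [a, c, e]) = few_points [a, c, e]"
    using dist by (subst restr_eq_few_points[OF N]; auto)+
  have WM: "restr (few_points [a, c, e]) (set [a, e]) = few_points [a, e]"
    using dist by (subst restr_eq_few_points[OF few(2)]; auto)
  have NC: "ext ?N Z \<in> carrier (free_cring (embeddings labeled_trees))"
    using NZ Z N by (intro ext_closed) auto
  have "ext (few_points [a, e]) Z \<approx> ext ?N Z * ext (few_points [a, e]) ?N"
    using NZ WN Z N few by (intro ext_trans) auto
  also have "\<dots> \<approx> ext ?N Z * (ext (few_points [a, c, e]) ?N * ext (few_points [a, e]) (few_points [a, c, e]))"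
    using WN WM N few by (intro meas_cong_mult meas_cong_refl NC ext_trans) auto
  also have "\<dots> \<approx> ext ?N Z * (val AD * mid)"
    using dist by (intro meas_cong_mult meas_cong_refl NC val_remove_second mid_any) auto
  finally show ?thesis .
qed

lemma mid_closed: "mid \<in> carrier (free_cring (embeddings labeled_trees))"
  using mid_any[of 0 1 2] by (simp add: meas_cong_def)

text \<open>Counts the triples from their middle point: a point \<open>b\<close> below
  \<open>c\<close> and a point \<open>d\<close> above \<open>c\<close> are amalgamated over
  \<open>a\<close>, \<open>c\<close>, \<open>e\<close>, where their order is forced. So the last
  factors of \<open>ext_branch\<close> sum up to a single \<open>val AD\<close>.\<close>

lemma sum_branch:
  assumes dist: "distinct [a, b, c, d, e]"
  shows "(\<Sum>Z\<in>branch a b c d e. ext (few_points [a, e]) Z) \<approx> val AD * (val AD * mid)"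
proof -
  let ?N = "four_points AD a b c e" and ?M = "four_points AD a c d e"
  have MN: "?M \<in> labeled_trees" "?N \<in> labeled_trees"
    using dist by (auto intro!: four_points_in)
  have ext_Z: "ext (few_points [a, e]) Z \<approx> ext ?N Z * (val AD * mid)" if "Z \<in> branch a b c d e" for Z
    using that dist by (intro ext_branch) (auto simp: chain_structures_def)
  have "\<not> is_isomorphism (move d b ?M ?N)"
    using dist by (intro not_isomorphism_move[of _ c d]) auto
  moreover have "branch a b c d e = {Z \<in> labeled_trees. carrier Z = insert d (insert b (set [a, c, e])) \<and>
      restr Z (carrier ?M) = ?M \<and> restr Z (carrier ?N) = ?N}"
  proof -
    have perm: "insert d (insert b (set [a, c, e])) = set [a, b, c, d, e]" by auto
    show ?thesis
      unfolding perm chain_structures_def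
    proof (rule Collect_cong, rule conj_cong[OF refl], rule conj_cong[OF refl])
      fix Z :: "(nat, tree_symbol) rel_structure"
      assume Z: "Z \<in> labeled_trees" "carrier Z = set [a, b, c, d, e]"
      have "restr Z {a, c, d, e} = ?M \<longleftrightarrow> sorted_wrt (precedes Z) [a, c, d, e] \<and> quart Z a e c d"
        using restr_eq_four_points[OF Z(1), of a c d e AD] Z(2) dist by (simp add: has_shape_def)
      moreover have "restr Z {a, b, c, e} = ?N \<longleftrightarrow> sorted_wrt (precedes Z) [a, b, c, e] \<and> quart Z a e b c"
        using restr_eq_four_points[OF Z(1), of a b c e AD] Z(2) dist by (simp add: has_shape_def)
      moreover have "precedes Z b d" if "precedes Z b c" "precedes Z c d"
        using precedes_trans[OF Z(1) that] .
      ultimately show "(sorted_wrt (precedes Z) [a, b, c, d, e] \<and> quart Z a e b c \<and> quart Z a e c d) =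
          (restr Z (carrier ?M) = ?M \<and> restr Z (carrier ?N) = ?N)"
        unfolding carrier_points by auto
    qed
  qed
  ultimately have "ext (few_points [a, c, e]) ?M \<approx> (\<Sum>Z\<in>branch a b c d e. ext ?N Z)"
    by (intro one_point_few_sum(1)) (use dist MN in auto)
  then have e: "(\<Sum>Z\<in>branch a b c d e. ext ?N Z) \<approx> val AD"
    using meas_cong_trans[OF meas_cong_sym val_remove_third[of a c d e AD]] dist by simp
  have "(\<Sum>Z\<in>branch a b c d e. ext (few_points [a, e]) Z) \<approx> (\<Sum>Z\<in>branch a b c d e. ext ?N Z * (val AD * mid))"
    by (intro meas_cong_sum ext_Z)
  also have "(\<Sum>Z\<in>branch a b c d e. ext ?N Z * (val AD * mid)) = (\<Sum>Z\<in>branch a b c d e. ext ?N Z) * (val AD * mid)"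
    by (simp add: sum_distrib_right)
  also have "\<dots> \<approx> val AD * (val AD * mid)"
    by (intro meas_cong_mult e meas_cong_refl free_cring_closed val_closed mid_closed)
  finally show ?thesis .
qed

text \<open>Counts the pairs 3, 4 from a common upper point 5: they coincide, or they come in one of
  two orders, each evaluated by \<open>sum_branch\<close>. The factor \<open>val AD * mid\<close> is
  the class of the inclusion of 2, 6 into \<open>?N\<close>; it turns each term into an extension of
  2, 6, the form in which \<open>sum_branch\<close> applies to both orders.\<close>

lemma val_AD_quadratic:
  "val AD * (val AD * mid) \<approx> val AD * mid + (val AD * (val AD * mid) + val AD * (val AD * mid))"
proof -
  let ?N = "four_points AD 2 3 5 6" and ?M = "four_points AD 2 4 5 6"
  let ?S\<^sub>1 = "branch 2 3 4 5 6" and ?S\<^sub>2 = "branch 2 4 3 5 6"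
  have MN: "?M \<in> labeled_trees" "?N \<in> labeled_trees"
    by (auto intro!: four_points_in)
  \<comment> \<open>By transitivity the chained conditions of \<open>branch\<close> mean, for either
    order of 3 and 4, that 3, 4 and 5 lie in one class.\<close>
  have quarts: "quart Z 2 6 3 4 \<and> quart Z 2 6 4 5 \<longleftrightarrow> quart Z 2 6 3 5 \<and> quart Z 2 6 4 5"
    "quart Z 2 6 4 3 \<and> quart Z 2 6 3 5 \<longleftrightarrow> quart Z 2 6 3 5 \<and> quart Z 2 6 4 5"
    if Z: "Z \<in> labeled_trees" for Z
  proof -
    note sw = quart_iff(3)[OF Z, of 2 6]
    show "quart Z 2 6 3 4 \<and> quart Z 2 6 4 5 \<longleftrightarrow> quart Z 2 6 3 5 \<and> quart Z 2 6 4 5"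
      using quart_trans[OF Z, of 2 6 4 3 5] quart_trans[OF Z, of 2 6 5 3 4] sw[of 3 4] sw[of 3 5] sw[of 4 5] by auto
    show "quart Z 2 6 4 3 \<and> quart Z 2 6 3 5 \<longleftrightarrow> quart Z 2 6 3 5 \<and> quart Z 2 6 4 5"
      using quart_trans[OF Z, of 2 6 3 4 5] quart_trans[OF Z, of 2 6 5 4 3] sw[of 3 4] sw[of 3 5] sw[of 4 5] by auto
  qed
  have perm: "insert 4 (insert 3 (set [2, 5, 6])) = {2, 3, 4, 5, 6 :: nat}"
    "set [2, 3, 4, 5, 6] = {2, 3, 4, 5, 6 :: nat}" "set [2, 4, 3, 5, 6] = {2, 3, 4, 5, 6 :: nat}"
    by auto
  have "?S\<^sub>1 \<union> ?S\<^sub>2 = {Z \<in> labeled_trees. carrier Z = insert 4 (insert 3 (set [2, 5, 6])) \<and>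
      restr Z (carrier ?M) = ?M \<and> restr Z (carrier ?N) = ?N}"
    unfolding perm chain_structures_def Collect_disj_eq[symmetric] conj_disj_distribL[symmetric]
  proof (rule Collect_cong, rule conj_cong[OF refl], rule conj_cong[OF refl])
    fix Z :: "(nat, tree_symbol) rel_structure"
    assume Z: "Z \<in> labeled_trees" "carrier Z = {2, 3, 4, 5, 6}"
    have "restr Z {2, 4, 5, 6} = ?M \<longleftrightarrow> sorted_wrt (precedes Z) [2, 4, 5, 6] \<and> quart Z 2 6 4 5"
      using restr_eq_four_points[OF Z(1), of 2 4 5 6 AD] Z(2) by (simp add: has_shape_def)
    moreover have "restr Z {2, 3, 5, 6} = ?N \<longleftrightarrow> sorted_wrt (precedes Z) [2, 3, 5, 6] \<and> quart Z 2 6 3 5"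
      using restr_eq_four_points[OF Z(1), of 2 3 5 6 AD] Z(2) by (simp add: has_shape_def)
    moreover have "precedes Z 3 4 \<or> precedes Z 4 3"
      using precedes_total[OF Z(1)] Z(2) by simp
    ultimately show "(sorted_wrt (precedes Z) [2, 3, 4, 5, 6] \<and> quart Z 2 6 3 4 \<and> quart Z 2 6 4 5 \<or>
        sorted_wrt (precedes Z) [2, 4, 3, 5, 6] \<and> quart Z 2 6 4 3 \<and> quart Z 2 6 3 5) =
        (restr Z (carrier ?M) = ?M \<and> restr Z (carrier ?N) = ?N)"
      unfolding carrier_points quarts[OF Z(1)] by auto
  qed
  moreover have "is_isomorphism (move 4 3 ?M ?N)"
  proof (rule isomorphism_move)
    show "?M = ordered_structure [2, 4, 5, 6] (shape_quartets AD 2 4 5 6)"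
      by (simp add: four_points_def)
    show "?N = ordered_structure (map (\<lambda>z. if z = 4 then 3 else z) [2, 4, 5, 6]) (shape_quartets AD 2 3 5 6)"
      by (simp add: four_points_def)
    have inj: "inj_on (\<lambda>z::nat. if z = 4 then 3 else z) {2, 4, 5, 6}"
      by (auto simp: inj_on_def)
    show "l \<in> shape_quartets AD 2 4 5 6 \<longleftrightarrow> map (\<lambda>z. if z = 4 then 3 else z) l \<in> shape_quartets AD 2 3 5 6"
      if "set l \<subseteq> set [2, 4, 5, 6]" for l :: "nat list"
      using quartets_map[OF inj, of 2 6 4 5 l] that by (simp add: shape_quartets_def)
  qed (use MN in auto)
  ultimately have "ext (few_points [2, 5, 6]) ?M \<approx> 1 + (\<Sum>Z\<in>?S\<^sub>1 \<union> ?S\<^sub>2. ext ?N Z)"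
    by (intro one_point_few_sum(2)) (use MN in auto)
  then have "val AD \<approx> 1 + (\<Sum>Z\<in>?S\<^sub>1 \<union> ?S\<^sub>2. ext ?N Z)"
    using meas_cong_trans[OF meas_cong_sym[OF val_remove_second[of 2 4 5 6 AD]]] by simp
  then have "val AD * (val AD * mid) \<approx> (1 + (\<Sum>Z\<in>?S\<^sub>1 \<union> ?S\<^sub>2. ext ?N Z)) * (val AD * mid)"
    by (intro meas_cong_mult meas_cong_refl free_cring_closed val_closed mid_closed)
  also have "\<dots> = val AD * mid + (\<Sum>Z\<in>?S\<^sub>1 \<union> ?S\<^sub>2. ext ?N Z * (val AD * mid))"
    by (simp add: distrib_right sum_distrib_right)
  also have "\<dots> \<approx> val AD * mid + (\<Sum>Z\<in>?S\<^sub>1 \<union> ?S\<^sub>2. ext (few_points [2, 6]) Z)"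
  proof (intro meas_cong_add meas_cong_refl meas_cong_sum)
    fix Z assume "Z \<in> ?S\<^sub>1 \<union> ?S\<^sub>2"
    then have Z: "Z \<in> labeled_trees" "carrier Z = {2, 3, 4, 5, 6}" "sorted_wrt (precedes Z) [2, 3, 5, 6]"
      "quart Z 2 6 3 5"
      using quarts[of Z] by (auto simp: chain_structures_def)
    show "ext ?N Z * (val AD * mid) \<approx> ext (few_points [2, 6]) Z"
      by (rule meas_cong_sym[OF ext_branch]) (use Z in auto)
  qed (intro free_cring_closed val_closed mid_closed)
  also have "(\<Sum>Z\<in>?S\<^sub>1 \<union> ?S\<^sub>2. ext (few_points [2, 6]) Z) =
      (\<Sum>Z\<in>?S\<^sub>1. ext (few_points [2, 6]) Z) + (\<Sum>Z\<in>?S\<^sub>2. ext (few_points [2, 6]) Z)"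
  proof (rule sum.union_disjoint[OF finite_chain_structures finite_chain_structures])
    have False if "Z \<in> ?S\<^sub>1" "Z \<in> ?S\<^sub>2" for Z
    proof -
      have "Z \<in> labeled_trees" "precedes Z 3 4" "precedes Z 4 3"
        using that by (simp_all add: chain_structures_def)
      then show False
        using precedes_trans[of Z 3 4 3] precedes_irrefl[of Z 3] by blast
    qed
    then show "?S\<^sub>1 \<inter> ?S\<^sub>2 = {}" by blast
  qed
  also have "val AD * mid + \<dots> \<approx> val AD * mid + (val AD * (val AD * mid) + val AD * (val AD * mid))"
    by (intro meas_cong_add sum_branch meas_cong_refl free_cring_closed val_closed mid_closed) auto
  finally show ?thesis .
qed

lemma one_eq_zero: "1 \<approx> 0"
proof -
  let ?C = "carrier (free_cring (embeddings labeled_trees))"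
  let ?I = "meas_ideal labeled_trees"
  define e where "e = val AD"
  define u where "u = 0 - (1 + mid)"
  define r where "r = val AD - (val AC + val AB)"
  define t where "t = mid - (val Star + (val AB + (val AC + val AD)))"
  define q where "q = e * (e * mid) - (e * mid + (e * (e * mid) + e * (e * mid)))"
  define s where "s = val Star - (val Star + val Star)"
  have I: "u \<in> ?I" "r \<in> ?I" "t \<in> ?I" "q \<in> ?I" "s \<in> ?I"
    using mid_eq val_relations mid_eq_sum_val val_AD_quadratic
    by (simp_all add: meas_cong_def u_def r_def t_def q_def s_def e_def)
  \<comment> \<open>As a polynomial \<open>w\<close> is \<open>2 * e + 1\<close>: the signs are such
    that \<open>mid\<close> and the classes of the other shapes cancel.\<close>
  define w where "w = s + (- u) + (- t) + r"
  have w: "w \<in> ?I"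
    unfolding w_def using I by (intro meas_ideal_closed)
  have C: "w \<in> ?C" "u \<in> ?C"
    using w I(1) ideal.Icarr[OF ideal_meas_ideal] by blast+
  have ew: "2 * e = w - 1"
    unfolding w_def u_def r_def t_def s_def e_def by (simp add: algebra_simps)
  \<comment> \<open>Taking \<open>q\<close> four times avoids a division by 2: with
    \<open>mid = - 1 - u\<close> and \<open>2 * e = w - 1\<close>, four times \<open>q\<close> is
    \<open>(1 + u) * (w * w - 1)\<close>, and solving for 1 leaves only multiples of
    \<open>u\<close>, \<open>w\<close> and \<open>q\<close>.\<close>
  have "1 = (w * w) * u + (- u) + w * w + (- (q + q + q + q))"
  proof -
    have "q + q + q + q = - (mid * ((2 * e) * (2 * e + 2)))"
      unfolding q_def by (simp add: algebra_simps)
    also have "mid = - 1 - u" unfolding u_def by simp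
    finally show ?thesis
      unfolding ew by (simp add: algebra_simps)
  qed
  also have "\<dots> \<in> ?I"
    using w I(1,4) C by (intro meas_ideal_closed free_cring_closed)
  finally show ?thesis
    by (simp add: meas_cong_def free_cring_closed)
qed

theorem theorem3p8:
  shows "measure_ring labeled_trees \<simeq> zero_ring \<and> complex_measures labeled_trees = {}"
  using trivial_measure_ring[OF one_eq_zero] by blast

end
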